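(* Let $\omega\in\widehat{\mathcal D}$ and $1<p,q<\infty$. Then the Bergman projection $P_\omega$ is bounded from $L^{p,q}_\omega$ to $L^{p,q}_\omega$.
   Context: A radial weight is a nonnegative $\omega\in L^1([0,1))$, extended by $\omega(z)=\omega(|z|)$; $\widehat\omega(r)=\int_r^1\omega(s)ds>0$ for all $r\in[0,1)$. $\omega\in\widehat{\mathcal D}$ means $\widehat\omega(r)\le C\widehat\omega(\frac{1+r}2)$ for some $C>0$ and all $0\le r<1$. $\omega_x=\int_0^1r^x\omega(r)dr$. $L^{p,q}_\omega$ consists of measurable $f$ on $\mathbb D$ with $\|f\|^q_{L^{p,q}_\omega}=\int_0^1\big(\frac1{2\pi}\int_0^{2\pi}|f(re^{i\theta})|^pd\theta\big)^{q/p}r\omega(r)\,dr<\infty$. $B^\omega_z(\zeta)=\sum_{n\ge0}\frac{(\overline z\zeta)^n}{2\omega_{2n+1}}$ is the reproducing kernel of the weighted Bergman space $A^2_\omega$, and $P_\omega f(z)=\int_{\mathbb D}f(\zeta)\overline{B^\omega_z(\zeta)}\omega(\zeta)\,dA(\zeta)$, with $dA$ normalized area measure. *)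

theory Defs
  imports "HOL-Analysis.Analysis"
begin

text \<open>Radial weights are represented by their profile \<open>\<omega> :: real \<Rightarrow> real\<close> on [0,1);
  the weight on the disc is \<open>\<omega>(|z|)\<close>.\<close>

definition radial_weight :: "(real \<Rightarrow> real) \<Rightarrow> bool" where
  "radial_weight \<omega> \<longleftrightarrow> (\<forall>r\<in>{0..<1}. 0 \<le> \<omega> r) \<and> set_integrable lborel {0..<1} \<omega>"

definition omega_hat :: "(real \<Rightarrow> real) \<Rightarrow> real \<Rightarrow> real" where
  "omega_hat \<omega> r = (LINT s:{r..<1}|lborel. \<omega> s)"

definition Dhat :: "(real \<Rightarrow> real) \<Rightarrow> bool" where
  "Dhat \<omega> \<longleftrightarrow> (\<exists>C>0. \<forall>r\<in>{0..<1}. omega_hat \<omega> r \<le> C * omega_hat \<omega> ((1 + r) / 2))"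

definition moment :: "(real \<Rightarrow> real) \<Rightarrow> real \<Rightarrow> real" where
  "moment \<omega> x = (LINT r:{0..<1}|lborel. r powr x * \<omega> r)"

text \<open>Real power of an extended nonnegative real (exponent assumed positive).\<close>
definition enn_powr :: "ennreal \<Rightarrow> real \<Rightarrow> ennreal" where
  "enn_powr x a = (if x = \<infinity> then \<infinity> else ennreal (enn2real x powr a))"

definition Mp :: "real \<Rightarrow> (complex \<Rightarrow> complex) \<Rightarrow> real \<Rightarrow> ennreal" where
  "Mp p f r = ennreal (1 / (2 * pi)) *
     (\<integral>\<^sup>+ \<theta>\<in>{0..2*pi}. ennreal (cmod (f (of_real r * cis \<theta>)) powr p) \<partial>lborel)"

definition Lpq_norm_q :: "(real \<Rightarrow> real) \<Rightarrow> real \<Rightarrow> real \<Rightarrow> (complex \<Rightarrow> complex) \<Rightarrow> ennreal" where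
  "Lpq_norm_q \<omega> p q f =
     (\<integral>\<^sup>+ r\<in>{0..<1}. enn_powr (Mp p f r) (q / p) * ennreal (r * \<omega> r) \<partial>lborel)"

definition Lpq_norm :: "(real \<Rightarrow> real) \<Rightarrow> real \<Rightarrow> real \<Rightarrow> (complex \<Rightarrow> complex) \<Rightarrow> real" where
  "Lpq_norm \<omega> p q f = enn2real (Lpq_norm_q \<omega> p q f) powr (1 / q)"

definition Lpq :: "(real \<Rightarrow> real) \<Rightarrow> real \<Rightarrow> real \<Rightarrow> (complex \<Rightarrow> complex) set" where
  "Lpq \<omega> p q = {f. (\<lambda>z. indicator (ball 0 1) z * f z) \<in> borel_measurable lborel
                    \<and> Lpq_norm_q \<omega> p q f < \<infinity>}"

definition bergman_kernel :: "(real \<Rightarrow> real) \<Rightarrow> complex \<Rightarrow> complex \<Rightarrow> complex" where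
  "bergman_kernel \<omega> z \<zeta> = (\<Sum>n. (cnj z * \<zeta>) ^ n / of_real (2 * moment \<omega> (2 * real n + 1)))"

text \<open>Integrand of the Bergman projection, w.r.t. Lebesgue measure on the disc
  (normalized area measure \<open>dA = dx dy / \<pi>\<close>).\<close>
definition bergman_integrand ::
  "(real \<Rightarrow> real) \<Rightarrow> (complex \<Rightarrow> complex) \<Rightarrow> complex \<Rightarrow> complex \<Rightarrow> complex" where
  "bergman_integrand \<omega> f z \<zeta> = f \<zeta> * cnj (bergman_kernel \<omega> z \<zeta>) * of_real (\<omega> (cmod \<zeta>))"

definition bergman_proj :: "(real \<Rightarrow> real) \<Rightarrow> (complex \<Rightarrow> complex) \<Rightarrow> complex \<Rightarrow> complex" where
  "bergman_proj \<omega> f z = of_real (1 / pi) * (LINT \<zeta>:ball 0 1|lborel. bergman_integrand \<omega> f z \<zeta>)"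

end

theory Submission
  imports Defs "HOL-Complex_Analysis.Complex_Analysis"
begin

text \<open>With \<open>m\<^sub>n = 1 / \<omega>\<^sub>2\<^sub>n\<^sub>+\<^sub>1\<close>, which increases in \<open>n\<close>, polar coordinates turn \<open>P\<^sub>\<omega> f (r e\<^sup>i\<^sup>\<theta>)\<close> into the integral
  against \<open>\<rho> \<omega>(\<rho>) d\<rho>\<close> of the convolution of \<open>f(\<rho> \<cdot>)\<close> with the kernel \<open>\<Sum> m\<^sub>n w\<^sup>n\<close>, \<open>|w| = r \<rho>\<close>. Abel
  summation gives \<open>\<Sum> m\<^sub>n w\<^sup>n = \<Sum> (m\<^sub>j - m\<^sub>j\<^sub>-\<^sub>1) w\<^sup>j / (1 - w)\<close>: a positive combination of modulated
  Cauchy kernels, each bounded on \<open>L\<^sup>p\<close> of the circle by the theorem of M. Riesz, uniformly in the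
  radius. So the convolution has norm at most a constant times
  \<open>\<Sum> (m\<^sub>j - m\<^sub>j\<^sub>-\<^sub>1) (r \<rho>)\<^sup>j = (1 - r \<rho>) \<Sum> m\<^sub>j (r \<rho>)\<^sup>j\<close>, which for \<open>\<omega>\<close> in the class \<open>Dhat\<close> is at most a
  constant over \<open>omega_hat \<omega> (min r \<rho>)\<close>. By the integral Minkowski inequality it remains to bound a positive Hardy type
  operator on \<open>L\<^sup>q(\<rho> \<omega>(\<rho>) d\<rho>)\<close>; this is a Schur test with the weight \<open>omega_hat \<omega>\<close> to the power \<open>- 1 / q\<close>.\<close>

section \<open>Powers and the integral Minkowski inequality in \<open>ennreal\<close>\<close>

text \<open>The angle and the radius are treated differently for a reason. When
  \<open>m\<^sub>n\<close> grows slowly, the kernel is close to the Cauchy kernel itself, whose mean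
  modulus over the circle of radius \<open>s\<close> grows logarithmically as \<open>s\<close> tends
  to 1. Absolute values inside the angular integral would therefore lose a factor that nothing
  recovers; the cancellation there is kept by the theorem of M. Riesz, and this is what restricts
  \<open>p\<close>. Once the norm in the angle has been taken, only a positive kernel in two radii
  is left. In the variable \<open>omega_hat\<close> it is controlled by the Hardy kernel
  \<open>1 / max s t\<close> on the half-line, which explains why the Schur weight is a power of
  \<open>omega_hat \<omega>\<close>. Doubling enters at a single point, in
  \<open>inv_moment_series\<close>. Integrals of nonnegative quantities are kept in
  \<open>ennreal\<close>, so that Tonelli and Minkowski apply before any integrability is
  known.\<close>

lemma enn_powr_ennreal: "0 \<le> x \<Longrightarrow> enn_powr (ennreal x) a = ennreal (x powr a)"
  by (simp add: enn_powr_def)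

lemma enn_powr_top [simp]: "enn_powr top a = top"
  by (simp add: enn_powr_def)

lemma enn_powr_0 [simp]: "enn_powr 0 a = 0"
  by (simp add: enn_powr_def)

lemma enn_powr_one [simp]: "enn_powr x 1 = x"
  by (cases x) (auto simp: enn_powr_ennreal)

lemma enn_powr_eq_0_iff [simp]: "enn_powr x a = 0 \<longleftrightarrow> x = 0"
  by (cases x) (auto simp: enn_powr_ennreal)

lemma enn_powr_eq_top_iff [simp]: "enn_powr x a = top \<longleftrightarrow> x = top"
  by (cases x) (auto simp: enn_powr_ennreal)

lemma enn_powr_less_top_iff [simp]: "enn_powr x a < top \<longleftrightarrow> x < top"
  by (metis enn_powr_eq_top_iff less_top)

lemma enn_powr_mono:
  assumes "0 \<le> a" "x \<le> y" shows "enn_powr x a \<le> enn_powr y a"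
  using assms by (cases x; cases y)
    (auto simp: enn_powr_ennreal top_unique intro!: ennreal_leI powr_mono2)

text \<open>No sign condition on \<open>a\<close> is imposed: 0 goes to 0 and top to top for every
  exponent, so the degenerate products, including \<open>0 * top = 0\<close>, agree on both
  sides.\<close>

lemma enn_powr_mult: "enn_powr (x * y) a = enn_powr x a * enn_powr y a"
proof (cases "x = 0 \<or> y = 0")
  case False
  then show ?thesis
    by (cases x; cases y)
      (auto simp: enn_powr_ennreal ennreal_top_mult ennreal_mult_top powr_mult ennreal_mult[symmetric])
qed auto

lemma enn_powr_powr: "enn_powr (enn_powr x a) b = enn_powr x (a * b)"
  by (cases x) (auto simp: enn_powr_ennreal powr_powr)

lemma enn_powr_add:
  "enn_powr x (a + b) = enn_powr x a * enn_powr x b"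
  by (cases x) (auto simp: enn_powr_ennreal powr_add ennreal_mult ennreal_mult_top)

lemma enn_powr_measurable [measurable]:
  assumes [measurable]: "f \<in> borel_measurable M"
  shows "(\<lambda>x. enn_powr (f x) a) \<in> borel_measurable M"
  unfolding enn_powr_def by measurable

lemma ennreal_divide_times_cancel:
  fixes a k :: ennreal
  assumes "k \<noteq> 0" "k \<noteq> top"
  shows "a / k * k = a"
  using assms by (metis mult_divide_eq_ennreal mult.commute ennreal_times_divide)

text \<open>Convexity: the graph of \<open>h powr p\<close> lies above its tangent at
  \<open>c\<close>. It is Young's inequality for the factors \<open>h\<close> and
  \<open>c powr (p - 1)\<close>.\<close>

lemma powr_tangent_ge:
  fixes p c h :: real
  assumes p: "1 < p" and c: "0 < c" and h: "0 \<le> h"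
  shows "p * c powr (p - 1) * h \<le> h powr p + (p - 1) * c powr p"
proof -
  define q where "q = p / (p - 1)"
  have q: "1 < q" "1 / p + 1 / q = 1"
    using p by (auto simp: q_def field_simps)
  have "h * c powr (p - 1) \<le> h powr p / p + (c powr (p - 1)) powr q / q"
    by (rule Youngs_inequality) (use p q h in auto)
  also have "(c powr (p - 1)) powr q = c powr p"
    using p by (simp add: powr_powr q_def)
  finally have "p * (h * c powr (p - 1)) \<le> p * (h powr p / p + c powr p / q)"
    using p by (intro mult_left_mono) auto
  also have "\<dots> = h powr p + (p - 1) * c powr p"
    using p by (simp add: q_def field_simps)
  finally show ?thesis by (simp add: mult_ac)
qed

text \<open>Integrating the tangent line bound with slope chosen at the mean \<open>I / W\<close>; working in
  \<open>ennreal\<close> makes finiteness assumptions unnecessary.\<close>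
lemma nn_integral_weighted_jensen:
  fixes h w :: "'a \<Rightarrow> ennreal"
  assumes [measurable]: "h \<in> borel_measurable M" "w \<in> borel_measurable M" and p: "1 < p"
  shows "enn_powr (\<integral>\<^sup>+x. h x * w x \<partial>M) p
           \<le> enn_powr (\<integral>\<^sup>+x. w x \<partial>M) (p - 1) * (\<integral>\<^sup>+x. enn_powr (h x) p * w x \<partial>M)"
proof -
  define I where "I = (\<integral>\<^sup>+x. h x * w x \<partial>M)"
  define W where "W = (\<integral>\<^sup>+x. w x \<partial>M)"
  define J where "J = (\<integral>\<^sup>+x. enn_powr (h x) p * w x \<partial>M)"
  have tangent: "ennreal (p * c powr (p - 1)) * I \<le> J + ennreal ((p - 1) * c powr p) * W"
    if c: "0 < c" for c
  proof -
    have pt: "ennreal (p * c powr (p - 1)) * h x \<le> enn_powr (h x) p + ennreal ((p - 1) * c powr p)" for x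
    proof (cases "h x")
      case (real r)
      then show ?thesis
        using powr_tangent_ge[OF p c, of r] p
        by (simp add: enn_powr_ennreal ennreal_mult[symmetric] ennreal_plus[symmetric] ennreal_leI del: ennreal_plus)
    qed auto
    have "ennreal (p * c powr (p - 1)) * I = (\<integral>\<^sup>+x. (ennreal (p * c powr (p - 1)) * h x) * w x \<partial>M)"
      unfolding I_def by (subst nn_integral_cmult[symmetric]) (auto simp: mult_ac)
    also have "\<dots> \<le> (\<integral>\<^sup>+x. (enn_powr (h x) p + ennreal ((p - 1) * c powr p)) * w x \<partial>M)"
      by (intro nn_integral_mono mult_right_mono pt) auto
    also have "\<dots> = J + ennreal ((p - 1) * c powr p) * W"
      unfolding J_def W_def by (simp add: distrib_right nn_integral_add nn_integral_cmult)
    finally show ?thesis .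
  qed
  \<comment> \<open>In \<open>ennreal\<close> the right-hand side vanishes as soon as
    \<open>W\<close> or \<open>J\<close> does, even if the other factor is top, so
    \<open>I = 0\<close> has to be derived in both cases.\<close>
  have zero: "I = 0" if "W = 0"
  proof -
    have "AE x in M. w x = 0" using that unfolding W_def by (subst (asm) nn_integral_0_iff_AE) auto
    then have "AE x in M. h x * w x = 0" by eventually_elim auto
    then show ?thesis unfolding I_def by (subst nn_integral_0_iff_AE) auto
  qed
  have zero': "I = 0" if "J = 0"
  proof -
    have "AE x in M. enn_powr (h x) p * w x = 0" using that unfolding J_def by (subst (asm) nn_integral_0_iff_AE) auto
    then have "AE x in M. h x * w x = 0" by eventually_elim auto
    then show ?thesis unfolding I_def by (subst nn_integral_0_iff_AE) auto
  qed
  have "enn_powr I p \<le> enn_powr W (p - 1) * J"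
  proof (cases "W = 0 \<or> J = 0 \<or> W = top \<or> J = top \<or> I = 0")
    case True
    then show ?thesis using zero zero' by (auto simp: ennreal_top_mult ennreal_mult_top)
  next
    case False
    then obtain w' j where w': "W = ennreal w'" "0 < w'" and j: "J = ennreal j" "0 < j"
      by (cases W; cases J) auto
    have "ennreal p * I \<le> ennreal (j + (p - 1) * w')"
      using tangent[of 1] w' j p by (simp add: ennreal_plus ennreal_mult)
    then have "ennreal p * I \<noteq> top" by (metis ennreal_less_top leD top.extremum_unique)
    then have "I \<noteq> top" using p by (auto simp: ennreal_mult_top)
    then obtain i where i: "I = ennreal i" "0 < i" using False by (cases I) auto
    define c where "c = i / w'"
    have c: "0 < c" using i w' by (simp add: c_def)
    have "p * c powr (p - 1) * i \<le> j + (p - 1) * c powr p * w'"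
      using tangent[OF c] unfolding i w' j using i w' j p
      by (simp add: ennreal_mult[symmetric] ennreal_plus[symmetric] del: ennreal_plus)
    moreover have "c powr (p - 1) * i = w' powr (1 - p) * i powr p"
      using i w' by (simp add: c_def powr_divide powr_diff field_simps)
    moreover have "c powr p * w' = w' powr (1 - p) * i powr p"
      using i w' by (simp add: c_def powr_divide powr_diff field_simps)
    moreover have "p * c powr (p - 1) * i = p * (c powr (p - 1) * i)"
      "(p - 1) * c powr p * w' = (p - 1) * (c powr p * w')" by (simp_all add: mult.assoc)
    ultimately have "p * (w' powr (1 - p) * i powr p) \<le> j + (p - 1) * (w' powr (1 - p) * i powr p)"
      by simp
    then have "w' powr (1 - p) * i powr p \<le> j"
      by (simp add: algebra_simps)
    then have "w' powr (p - 1) * (w' powr (1 - p) * i powr p) \<le> w' powr (p - 1) * j"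
      by (rule mult_left_mono) auto
    moreover have "w' powr (p - 1) * w' powr (1 - p) = 1"
      using w' by (simp flip: powr_add)
    ultimately have "i powr p \<le> w' powr (p - 1) * j"
      by (simp flip: mult.assoc)
    then show ?thesis
      using i j w' by (simp add: enn_powr_ennreal ennreal_mult[symmetric] ennreal_leI)
  qed
  then show ?thesis by (simp add: I_def W_def J_def)
qed

text \<open>Jensen with weight \<open>K\<close>, applied to the quotient \<open>H x y / K x\<close>,
  followed by Tonelli; no duality is involved. \<open>K\<close> is any majorant of the norms of the
  slices rather than the norms themselves, so operator bounds can be inserted directly.\<close>

lemma (in pair_sigma_finite) nn_integral_minkowski:
  fixes H :: "'a \<Rightarrow> 'b \<Rightarrow> ennreal" and K :: "'a \<Rightarrow> ennreal"
  assumes H [measurable]: "(\<lambda>(x, y). H x y) \<in> borel_measurable (M1 \<Otimes>\<^sub>M M2)"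
    and [measurable]: "K \<in> borel_measurable M1" and p: "1 < p"
    and HK: "\<And>x. (\<integral>\<^sup>+y. enn_powr (H x y) p \<partial>M2) \<le> enn_powr (K x) p"
  shows "(\<integral>\<^sup>+y. enn_powr (\<integral>\<^sup>+x. H x y \<partial>M1) p \<partial>M2) \<le> enn_powr (\<integral>\<^sup>+x. K x \<partial>M1) p"
proof (cases "(\<integral>\<^sup>+x. K x \<partial>M1) = top")
  case False
  then have fin: "AE x in M1. K x \<noteq> \<infinity>"
    by (intro nn_integral_PInf_AE) auto
  \<comment> \<open>Dividing by \<open>K x\<close> and multiplying back restores
    \<open>H x y\<close> only where \<open>K x\<close> is neither 0 nor top. On the zero set of
    \<open>K\<close> the hypothesis forces \<open>H x y = 0\<close> almost everywhere, and top is
    excluded by \<open>fin\<close>.\<close>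
  have "AE x in M1. AE y in M2. K x = 0 \<longrightarrow> H x y = 0"
  proof (rule AE_I2)
    fix x assume [measurable]: "x \<in> space M1"
    show "AE y in M2. K x = 0 \<longrightarrow> H x y = 0"
    proof (cases "K x = 0")
      case True
      then have "(\<integral>\<^sup>+y. enn_powr (H x y) p \<partial>M2) = 0" using HK[of x] p by simp
      then have "AE y in M2. enn_powr (H x y) p = 0" by (subst (asm) nn_integral_0_iff_AE) auto
      then show ?thesis by simp
    qed simp
  qed
  then have zero: "AE y in M2. AE x in M1. K x = 0 \<longrightarrow> H x y = 0"
    by (subst (asm) AE_commute) auto
  have "(\<integral>\<^sup>+y. enn_powr (\<integral>\<^sup>+x. H x y \<partial>M1) p \<partial>M2)
      \<le> (\<integral>\<^sup>+y. enn_powr (\<integral>\<^sup>+x. K x \<partial>M1) (p - 1) * (\<integral>\<^sup>+x. enn_powr (H x y / K x) p * K x \<partial>M1) \<partial>M2)"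
  proof (rule nn_integral_mono_AE)
    show "AE y in M2. enn_powr (\<integral>\<^sup>+x. H x y \<partial>M1) p
       \<le> enn_powr (\<integral>\<^sup>+x. K x \<partial>M1) (p - 1) * (\<integral>\<^sup>+x. enn_powr (H x y / K x) p * K x \<partial>M1)"
      using zero AE_space
    proof eventually_elim
      case (elim y)
      have [measurable]: "y \<in> space M2" using elim by simp
      have "AE x in M1. H x y = (H x y / K x) * K x"
        using elim(1) fin
      proof eventually_elim
        case (elim x)
        then show ?case by (cases "K x = 0") (simp_all add: ennreal_divide_times_cancel)
      qed
      then have "(\<integral>\<^sup>+x. H x y \<partial>M1) = (\<integral>\<^sup>+x. (H x y / K x) * K x \<partial>M1)"
        by (rule nn_integral_cong_AE)
      then show ?case using nn_integral_weighted_jensen[of "\<lambda>x. H x y / K x" M1 K p] p by simp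
    qed
  qed
  also have "\<dots> = enn_powr (\<integral>\<^sup>+x. K x \<partial>M1) (p - 1) * (\<integral>\<^sup>+y. (\<integral>\<^sup>+x. enn_powr (H x y / K x) p * K x \<partial>M1) \<partial>M2)"
    by (rule nn_integral_cmult) measurable
  also have "(\<integral>\<^sup>+y. (\<integral>\<^sup>+x. enn_powr (H x y / K x) p * K x \<partial>M1) \<partial>M2)
      = (\<integral>\<^sup>+x. (\<integral>\<^sup>+y. enn_powr (H x y / K x) p * K x \<partial>M2) \<partial>M1)"
    by (rule Fubini') measurable
  also have "\<dots> \<le> (\<integral>\<^sup>+x. K x \<partial>M1)"
  proof (rule nn_integral_mono_AE)
    show "AE x in M1. (\<integral>\<^sup>+y. enn_powr (H x y / K x) p * K x \<partial>M2) \<le> K x"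
      using fin AE_space
    proof eventually_elim
      case (elim x)
      have [measurable]: "x \<in> space M1" using elim by simp
      show ?case
      proof (cases "K x = 0")
        case False
        have "(\<integral>\<^sup>+y. enn_powr (H x y / K x) p * K x \<partial>M2)
            = enn_powr (inverse (K x)) p * K x * (\<integral>\<^sup>+y. enn_powr (H x y) p \<partial>M2)"
          by (subst nn_integral_cmult[symmetric]) (auto simp: divide_ennreal_def enn_powr_mult mult_ac)
        also have "\<dots> \<le> enn_powr (inverse (K x)) p * K x * enn_powr (K x) p"
          by (intro mult_left_mono HK) auto
        also have "\<dots> = enn_powr (K x / K x) p * K x"
          by (simp add: divide_ennreal_def enn_powr_mult mult_ac)
        also have "K x / K x = 1"
          using False elim by (auto intro: ennreal_divide_self simp: less_top)
        finally show ?thesis by (simp add: enn_powr_def)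
      qed simp
    qed
  qed
  also have "enn_powr (\<integral>\<^sup>+x. K x \<partial>M1) (p - 1) * (\<integral>\<^sup>+x. K x \<partial>M1) = enn_powr (\<integral>\<^sup>+x. K x \<partial>M1) p"
    using enn_powr_add[of _ "p - 1" 1] by simp
  finally show ?thesis by (simp add: mult_left_mono)
qed simp

section \<open>The circle and the Cauchy transform\<close>

lemma borel_measurable_cis [measurable]: "cis \<in> borel_measurable borel"
  by (intro borel_measurable_continuous_onI continuous_intros)

lemma borel_measurable_cnj [measurable]: "cnj \<in> borel_measurable borel"
  by (intro borel_measurable_continuous_onI continuous_intros)

section \<open>Normalised arc length and means over circles\<close>

definition circ :: "real measure" where
  "circ = density lborel (\<lambda>\<theta>. ennreal (1 / (2 * pi)) * indicator {0..2*pi} \<theta>)"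

lemma sets_circ [simp, measurable_cong]: "sets circ = sets borel"
  by (simp add: circ_def)

lemma space_circ [simp]: "space circ = UNIV"
  by (simp add: circ_def)

lemma nn_integral_circ:
  assumes [measurable]: "f \<in> borel_measurable borel"
  shows "(\<integral>\<^sup>+\<theta>. f \<theta> \<partial>circ) = ennreal (1 / (2 * pi)) * (\<integral>\<^sup>+\<theta>\<in>{0..2*pi}. f \<theta> \<partial>lborel)"
proof -
  have "(\<integral>\<^sup>+\<theta>. f \<theta> \<partial>circ)
      = (\<integral>\<^sup>+\<theta>. ennreal (1 / (2 * pi)) * (f \<theta> * indicator {0..2*pi} \<theta>) \<partial>lborel)"
    unfolding circ_def by (subst nn_integral_density) (simp_all only: mult_ac, simp_all)
  then show ?thesis by (simp add: nn_integral_cmult)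
qed

lemma emeasure_circ_UNIV [simp]: "emeasure circ UNIV = 1"
proof -
  have "emeasure circ UNIV = (\<integral>\<^sup>+\<theta>. 1 \<partial>circ)" by simp
  also have "\<dots> = ennreal (1 / (2 * pi)) * ennreal (2 * pi)"
    by (subst nn_integral_circ) simp_all
  also have "\<dots> = 1" by (subst ennreal_mult[symmetric]) simp_all
  finally show ?thesis .
qed

lemma measure_circ_UNIV [simp]: "measure circ UNIV = 1"
  by (simp add: measure_def)

interpretation circ: finite_measure circ
  by standard simp

interpretation circ2: pair_sigma_finite circ circ ..

lemma integrable_circ_bounded:
  fixes f :: "real \<Rightarrow> 'b::{banach, second_countable_topology}"
  assumes "f \<in> borel_measurable borel" "\<And>\<theta>. norm (f \<theta>) \<le> B"
  shows "integrable circ f"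
  using assms by (intro circ.integrable_const_bound[where B = B]) auto

lemma integral_circ:
  fixes f :: "real \<Rightarrow> 'b::{banach, second_countable_topology}"
  assumes [measurable]: "f \<in> borel_measurable borel"
  shows "(\<integral>\<theta>. f \<theta> \<partial>circ) = (1 / (2 * pi)) *\<^sub>R (LINT \<theta>:{0..2*pi}|lborel. f \<theta>)"
proof -
  have eq: "circ = density lborel (\<lambda>\<theta>. ennreal (1 / (2 * pi) * indicator {0..2*pi} \<theta>))"
    unfolding circ_def by (intro arg_cong2[where f = density] refl ext) (auto split: split_indicator)
  have "(\<integral>\<theta>. f \<theta> \<partial>circ) = (\<integral>\<theta>. (1 / (2 * pi) * indicator {0..2*pi} \<theta>) *\<^sub>R f \<theta> \<partial>lborel)"
    unfolding eq by (rule integral_density) auto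
  also have "\<dots> = (\<integral>\<theta>. (1 / (2 * pi)) *\<^sub>R (indicator {0..2*pi} \<theta> *\<^sub>R f \<theta>) \<partial>lborel)"
    by simp
  finally show ?thesis
    by (simp only: set_lebesgue_integral_def integral_scaleR_right)
qed

lemma cmod_circle [simp]: "cmod (of_real s * cis \<theta>) = \<bar>s\<bar>"
  by (simp add: norm_mult)

lemma continuous_on_circle:
  fixes H :: "complex \<Rightarrow> 'b::topological_space"
  assumes "continuous_on (ball 0 1) H" "0 \<le> s" "s < 1"
  shows "continuous_on UNIV (\<lambda>\<theta>. H (of_real s * cis \<theta>))"
  by (rule continuous_on_compose2[OF assms(1)]) (use assms in \<open>auto intro!: continuous_intros\<close>)

lemma circle_measurable:
  fixes H :: "complex \<Rightarrow> complex"
  assumes "continuous_on (ball 0 1) H" "0 \<le> s" "s < 1"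
  shows "(\<lambda>\<theta>. H (of_real s * cis \<theta>)) \<in> borel_measurable borel"
  using continuous_on_circle[OF assms] by (rule borel_measurable_continuous_onI)

lemma circle_bounded:
  fixes H :: "complex \<Rightarrow> complex"
  assumes "continuous_on (ball 0 1) H" "0 \<le> s" "s < 1"
  obtains B where "\<And>\<theta>. cmod (H (of_real s * cis \<theta>)) \<le> B"
proof -
  have "continuous_on (cball 0 s) H"
    using assms by (intro continuous_on_subset[OF assms(1)]) auto
  then have "bounded (H ` cball 0 s)"
    by (intro compact_imp_bounded compact_continuous_image) auto
  then obtain B where "\<forall>x\<in>H ` cball 0 s. cmod x \<le> B" by (auto simp: bounded_iff)
  then show ?thesis using assms by (intro that[of B]) auto
qed

lemma integrable_circle:
  fixes H :: "complex \<Rightarrow> complex"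
  assumes "continuous_on (ball 0 1) H" "0 \<le> s" "s < 1"
  shows "integrable circ (\<lambda>\<theta>. H (of_real s * cis \<theta>))"
  using circle_bounded[OF assms] circle_measurable[OF assms] integrable_circ_bounded by metis

lemma circle_mean_value:
  assumes H: "H holomorphic_on ball 0 1" and s: "0 \<le> s" "s < 1"
  shows "(\<integral>\<theta>. H (of_real s * cis \<theta>) \<partial>circ) = H 0"
proof (cases "s = 0")
  case True
  then show ?thesis by simp
next
  case False
  then have s': "0 < s" using s by simp
  have cont: "continuous_on (ball 0 1) H" by (rule holomorphic_on_imp_continuous_on[OF H])
  have "((\<lambda>u. H u / (u - 0)) has_contour_integral (2 * of_real pi * \<i> * H 0)) (circlepath 0 s)"
    by (rule Cauchy_integral_circlepath_simple) (use s s' in \<open>auto intro: holomorphic_on_subset[OF H]\<close>)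
  then have "((\<lambda>t. H (of_real s * cis t) / (of_real s * cis t) * of_real s * \<i> * cis t)
      has_integral (2 * of_real pi * \<i> * H 0)) {0..2*pi}"
    unfolding circlepath_def by (subst (asm) has_contour_integral_part_circlepath_iff) auto
  then have "((\<lambda>t. \<i> * H (of_real s * cis t)) has_integral (2 * of_real pi * \<i> * H 0)) {0..2*pi}"
    using s' by (simp add: field_simps)
  from has_integral_mult_right[OF this, of "-\<i>"]
  have I: "((\<lambda>t. H (of_real s * cis t)) has_integral (2 * of_real pi * H 0)) {0..2*pi}"
    by (simp add: field_simps)
  have "set_integrable lborel {0..2*pi} (\<lambda>t. H (of_real s * cis t))"
    by (rule borel_integrable_atLeastAtMost') (rule continuous_on_subset[OF continuous_on_circle[OF cont s]], simp)
  then have "(LINT t:{0..2*pi}|lborel. H (of_real s * cis t)) = 2 * of_real pi * H 0"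
    using set_borel_integral_eq_integral(2) integral_unique[OF I] by metis
  then show ?thesis
    by (subst integral_circ) (use circle_measurable[OF cont s] in \<open>auto simp: scaleR_conv_of_real\<close>)
qed

text \<open>On the circle of radius \<open>s\<close> this is the Riesz projection onto the
  nonnegative frequencies, with frequency \<open>n\<close> damped by \<open>s ^ n\<close>; see
  \<open>cauchy_transform_sums\<close>.\<close>

definition cauchy_transform :: "(real \<Rightarrow> complex) \<Rightarrow> complex \<Rightarrow> complex" where
  "cauchy_transform f z = (\<integral>\<phi>. f \<phi> / (1 - z * cis (- \<phi>)) \<partial>circ)"

lemma cauchy_kernel_denom:
  assumes "cmod w < 1"
  shows "1 - w \<noteq> 0" "1 - cmod w \<le> cmod (1 - w)" "cmod (1 / (1 - w)) \<le> 1 / (1 - cmod w)"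
proof -
  show "1 - w \<noteq> 0" using assms by auto
  show ge: "1 - cmod w \<le> cmod (1 - w)" using norm_triangle_ineq2[of 1 w] by simp
  show "cmod (1 / (1 - w)) \<le> 1 / (1 - cmod w)"
    using assms ge by (simp add: norm_divide frac_le)
qed

lemma cauchy_transform_integrable:
  assumes f: "integrable circ f" and z: "cmod z < 1"
  shows "integrable circ (\<lambda>\<phi>. f \<phi> / (1 - z * cis (- \<phi>)))"
proof (rule Bochner_Integration.integrable_bound)
  show "integrable circ (\<lambda>\<phi>. (1 / (1 - cmod z)) *\<^sub>R f \<phi>)" using f by simp
  have [measurable]: "f \<in> borel_measurable circ" using f by auto
  show "(\<lambda>\<phi>. f \<phi> / (1 - z * cis (- \<phi>))) \<in> borel_measurable circ" by measurable
  have "norm (f \<phi> / (1 - z * cis (- \<phi>))) \<le> norm ((1 / (1 - cmod z)) *\<^sub>R f \<phi>)" for \<phi>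
  proof -
    have "cmod (f \<phi>) * cmod (1 / (1 - z * cis (- \<phi>))) \<le> cmod (f \<phi>) * (1 / (1 - cmod z))"
      using cauchy_kernel_denom(3)[of "z * cis (- \<phi>)"] z by (intro mult_left_mono) (auto simp: norm_mult)
    then show ?thesis using z by (simp add: norm_divide)
  qed
  then show "AE \<phi> in circ. norm (f \<phi> / (1 - z * cis (- \<phi>))) \<le> norm ((1 / (1 - cmod z)) *\<^sub>R f \<phi>)" by simp
qed

text \<open>Termwise integration of the geometric series. The power series is what yields
  holomorphy, without differentiating under the integral.\<close>

lemma cauchy_transform_sums:
  assumes f: "integrable circ f" and z: "cmod z < 1"
  shows "(\<lambda>n. (\<integral>\<phi>. f \<phi> * cis (- \<phi>) ^ n \<partial>circ) * z ^ n) sums cauchy_transform f z"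
proof -
  have [measurable]: "f \<in> borel_measurable circ" using f by auto
  define g where "g = (\<lambda>n \<phi>. f \<phi> * (z * cis (- \<phi>)) ^ n)"
  have ng: "norm (g n \<phi>) = norm (f \<phi>) * cmod z ^ n" for n \<phi>
    by (simp add: g_def norm_mult norm_power)
  have ig: "integrable circ (g n)" for n
  proof (rule Bochner_Integration.integrable_bound[OF f])
    show "g n \<in> borel_measurable circ" unfolding g_def by measurable
    show "AE x in circ. norm (g n x) \<le> norm (f x)"
      using z by (simp add: ng mult_left_le power_le_one)
  qed
  have su: "summable (\<lambda>n. cmod z ^ n)" using z by (simp add: summable_geometric)
  have "(\<lambda>n. integral\<^sup>L circ (g n)) sums (\<integral>\<phi>. (\<Sum>n. g n \<phi>) \<partial>circ)"
    by (rule sums_integral[OF ig]) (use su in \<open>simp_all add: ng summable_mult\<close>)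
  moreover have "(\<Sum>n. g n \<phi>) = f \<phi> / (1 - z * cis (- \<phi>))" for \<phi>
  proof -
    have "cmod (z * cis (- \<phi>)) < 1" using z by (simp add: norm_mult)
    from sums_mult[OF geometric_sums[OF this], of "f \<phi>"]
    show ?thesis unfolding g_def by (simp add: sums_iff)
  qed
  moreover have "integral\<^sup>L circ (g n) = (\<integral>\<phi>. f \<phi> * cis (- \<phi>) ^ n \<partial>circ) * z ^ n" for n
    unfolding g_def by (subst integral_mult_left_zero[symmetric]) (simp add: power_mult_distrib mult_ac)
  ultimately show ?thesis by (simp add: cauchy_transform_def)
qed

lemma cauchy_transform_holomorphic:
  assumes f: "integrable circ f"
  shows "cauchy_transform f holomorphic_on ball 0 1"
  by (rule power_series_holomorphic[where a = "\<lambda>n. \<integral>\<phi>. f \<phi> * cis (- \<phi>) ^ n \<partial>circ"])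
    (use cauchy_transform_sums[OF f] in auto)

lemma cauchy_transform_0: "cauchy_transform f 0 = (\<integral>\<phi>. f \<phi> \<partial>circ)"
  by (simp add: cauchy_transform_def)

lemma cauchy_transform_measurable:
  assumes "integrable circ f" "0 \<le> s" "s < 1"
  shows "(\<lambda>\<theta>. cauchy_transform f (of_real s * cis \<theta>)) \<in> borel_measurable borel"
  using circle_measurable holomorphic_on_imp_continuous_on cauchy_transform_holomorphic assms by metis

lemma norm_cauchy_transform_le:
  assumes f: "integrable circ f" and z: "cmod z < 1"
  shows "cmod (cauchy_transform f z) \<le> (\<integral>\<phi>. cmod (f \<phi>) \<partial>circ) / (1 - cmod z)"
proof -
  have "cmod (cauchy_transform f z) \<le> (\<integral>\<phi>. cmod (f \<phi> / (1 - z * cis (- \<phi>))) \<partial>circ)"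
    unfolding cauchy_transform_def by (rule integral_norm_bound)
  also have "\<dots> \<le> (\<integral>\<phi>. cmod (f \<phi>) / (1 - cmod z) \<partial>circ)"
  proof (rule integral_mono)
    show "integrable circ (\<lambda>\<phi>. cmod (f \<phi> / (1 - z * cis (- \<phi>))))"
      by (intro integrable_norm cauchy_transform_integrable f z)
    show "integrable circ (\<lambda>\<phi>. cmod (f \<phi>) / (1 - cmod z))" using f by simp
    fix \<phi>
    have "1 - cmod z \<le> cmod (1 - z * cis (- \<phi>))"
      using cauchy_kernel_denom(2)[of "z * cis (- \<phi>)"] z by (simp add: norm_mult)
    then show "cmod (f \<phi> / (1 - z * cis (- \<phi>))) \<le> cmod (f \<phi>) / (1 - cmod z)"
      using z by (simp add: norm_divide frac_le)
  qed
  finally show ?thesis by simp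
qed

section \<open>The theorem of M. Riesz\<close>

text \<open>The Moebius map \<open>1 / (1 - w)\<close> sends the unit disc onto the half-plane of
  real part above 1 / 2. This is what places the transform of a nonnegative function in the right
  half-plane.\<close>

lemma Re_cauchy_kernel_ge:
  assumes "cmod w < 1"
  shows "1 / 2 \<le> Re (1 / (1 - w))"
proof -
  have "(cmod w)\<^sup>2 \<le> 1" using assms by (simp add: power_le_one)
  then have "(Re w)\<^sup>2 + (Im w)\<^sup>2 \<le> 1" by (simp add: cmod_power2)
  then have "(1 - Re w)\<^sup>2 + (Im w)\<^sup>2 \<le> 2 * (1 - Re w)"
    by (simp add: power2_eq_square algebra_simps)
  moreover have "0 < (1 - Re w)\<^sup>2 + (Im w)\<^sup>2"
  proof -
    have "Re w < 1" using assms complex_Re_le_cmod[of w] by linarith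
    then show ?thesis by (intro add_pos_nonneg) auto
  qed
  ultimately show ?thesis by (simp add: Re_divide field_simps)
qed

text \<open>Since \<open>1 / (1 - w)\<close> is the average of 1 and
  \<open>(1 + w) / (1 - w)\<close>, this is the average of 1 and the Poisson kernel, hence a
  positive kernel of mean 1.\<close>

definition half_poisson :: "real \<Rightarrow> real \<Rightarrow> real \<Rightarrow> real" where
  "half_poisson s \<theta> \<phi> = Re (1 / (1 - of_real s * cis \<theta> * cis (- \<phi>)))"

lemma half_poisson_measurable [measurable]:
  "(\<lambda>(\<theta>, \<phi>). half_poisson s \<theta> \<phi>) \<in> borel_measurable (borel \<Otimes>\<^sub>M borel)"
  unfolding half_poisson_def by measurable

lemma half_poisson_ge:
  assumes "0 \<le> s" "s < 1" shows "1 / 2 \<le> half_poisson s \<theta> \<phi>"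
  unfolding half_poisson_def by (rule Re_cauchy_kernel_ge) (use assms in \<open>simp add: norm_mult\<close>)

lemma half_poisson_commute: "half_poisson s \<theta> \<phi> = half_poisson s \<phi> \<theta>"
proof -
  have "cnj (1 / (1 - of_real s * cis \<theta> * cis (- \<phi>))) = 1 / (1 - of_real s * cis \<phi> * cis (- \<theta>))"
    by (simp add: cis_cnj mult_ac)
  then show ?thesis unfolding half_poisson_def by (metis cnj.simps(1))
qed

lemma nn_integral_half_poisson:
  assumes s: "0 \<le> s" "s < 1"
  shows "(\<integral>\<^sup>+\<theta>. ennreal (half_poisson s \<theta> \<phi>) \<partial>circ) = 1"
    and "(\<integral>\<^sup>+\<theta>. ennreal (half_poisson s \<phi> \<theta>) \<partial>circ) = 1"
proof -
  define H where "H = (\<lambda>z. 1 / (1 - z * cis (- \<phi>)))"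
  have hol: "H holomorphic_on ball 0 1"
    unfolding H_def
  proof (intro holomorphic_intros)
    fix z :: complex assume "z \<in> ball 0 1"
    then show "1 - z * cis (- \<phi>) \<noteq> 0"
      using cauchy_kernel_denom(1)[of "z * cis (- \<phi>)"] by (simp add: norm_mult)
  qed
  have int: "integrable circ (\<lambda>\<theta>. H (of_real s * cis \<theta>))"
    by (rule integrable_circle[OF holomorphic_on_imp_continuous_on[OF hol] s])
  have "(\<integral>\<theta>. half_poisson s \<theta> \<phi> \<partial>circ) = Re (\<integral>\<theta>. H (of_real s * cis \<theta>) \<partial>circ)"
    unfolding half_poisson_def H_def[symmetric] by (subst integral_Re[OF int, symmetric]) (simp add: H_def)
  also have "\<dots> = 1" by (subst circle_mean_value[OF hol s]) (simp add: H_def)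
  finally have 1: "(\<integral>\<theta>. half_poisson s \<theta> \<phi> \<partial>circ) = 1" .
  have int': "integrable circ (\<lambda>\<theta>. half_poisson s \<theta> \<phi>)"
    using integrable_Re[OF int] by (simp add: half_poisson_def H_def)
  have "0 \<le> half_poisson s \<theta> \<phi>" for \<theta> using half_poisson_ge[OF s, of \<theta> \<phi>] by simp
  then show I: "(\<integral>\<^sup>+\<theta>. ennreal (half_poisson s \<theta> \<phi>) \<partial>circ) = 1"
    using int' by (subst nn_integral_eq_integral) (auto simp: 1)
  then show "(\<integral>\<^sup>+\<theta>. ennreal (half_poisson s \<phi> \<theta>) \<partial>circ) = 1"
    by (subst half_poisson_commute)
qed

text \<open>For \<open>w = F z\<close> with \<open>F\<close> holomorphic, \<open>Re F > 0\<close> and \<open>F 0 > 0\<close>, the mean of the subtracted term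
  over a circle is \<open>B * F 0 powr p \<ge> 0\<close> and can be dropped.\<close>
lemma right_half_plane_powr_bound:
  assumes p: "1 < p" "p \<le> 2"
  obtains A B :: real where "0 \<le> A" "0 \<le> B"
    "\<And>w. 0 < Re w \<Longrightarrow> cmod w powr p \<le> A * Re w powr p - B * Re (w powr of_real p)"
proof -
  \<comment> \<open>The angle \<open>p * (pi / 2)\<close> lies beyond \<open>pi / 2\<close> and,
    because \<open>p \<le> 2\<close>, not beyond \<open>pi\<close>; its cosine is therefore
    negative.\<close>
  define c where "c = - cos (p * (pi / 2))"
  have c: "0 < c"
  proof -
    have "cos (p * (pi / 2)) < cos (pi / 2)"
      using p by (intro cos_monotone_0_pi) (auto simp: field_simps)
    then show ?thesis by (simp add: c_def)
  qed
  have "isCont (\<lambda>t. cos (p * t)) (pi / 2)" by (intro continuous_intros)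
  then obtain d where d: "0 < d" "\<And>t. \<bar>t - pi / 2\<bar> < d \<Longrightarrow> \<bar>cos (p * t) - cos (p * (pi / 2))\<bar> < c / 2"
    unfolding continuous_at_eps_delta using c by (force simp: dist_real_def dest: spec[of _ "c / 2"])
  define e where "e = min (d / 2) (pi / 4)"
  have e: "0 < e" "e < d" "e < pi / 2" using d by (auto simp: e_def min_def)
  \<comment> \<open>Within distance \<open>d\<close> of the direction \<open>pi / 2\<close> the term
    with \<open>B\<close> alone reaches 1. Farther away \<open>cos t \<ge> sin e\<close>, and
    \<open>A\<close> is large enough to give \<open>1 + B\<close>, which covers the worst value of
    \<open>B * cos (p * t)\<close>.\<close>
  define B where "B = 2 / c"
  define A where "A = (1 + B) / (sin e) powr p"
  have se: "0 < sin e" using e by (intro sin_gt_zero) auto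
  have B: "0 \<le> B" using c by (simp add: B_def)
  have A: "0 \<le> A" using B by (simp add: A_def)
  \<comment> \<open>The claim for \<open>w\<close> of modulus 1 and argument \<open>t\<close>. Both
    sides are homogeneous of degree \<open>p\<close> in the modulus, and cosine is even, so
    \<open>0 \<le> t\<close> is enough.\<close>
  have main: "1 \<le> A * cos t powr p - B * cos (p * t)" if t: "0 \<le> t" "t < pi / 2" for t
  proof (cases "pi / 2 - t < d")
    case True
    then have "cos (p * t) < - c / 2"
      using d(2)[of t] t by (auto simp: c_def abs_if split: if_splits)
    then have "1 \<le> - B * cos (p * t)" using c by (simp add: B_def field_simps)
    moreover have "0 \<le> A * cos t powr p" using A by simp
    ultimately show ?thesis by simp
  next
    case False
    then have "sin e \<le> cos t"
      using e t by (subst sin_cos_eq) (auto intro!: cos_monotone_0_pi_le)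
    then have "(sin e) powr p \<le> cos t powr p" using se p by (intro powr_mono2) auto
    then have "A * (sin e) powr p \<le> A * cos t powr p" by (rule mult_left_mono[OF _ A])
    then have "1 + B \<le> A * cos t powr p" using se by (simp add: A_def)
    moreover have "B * cos (p * t) \<le> B" using B by (simp add: mult_left_le)
    ultimately show ?thesis by simp
  qed
  show ?thesis
  proof (rule that[OF A B])
    fix w :: complex assume w: "0 < Re w"
    then have w0: "w \<noteq> 0" by auto
    define t where "t = Im (Ln w)"
    have t: "\<bar>t\<bar> < pi / 2" using Re_Ln_pos_lt_imp[OF w] by (simp add: t_def)
    define r where "r = cmod w"
    have r: "0 < r" using w0 by (simp add: r_def)
    have "w = exp (Ln w)" using w0 by simp
    then have "Re w = exp (Re (Ln w)) * cos t" unfolding t_def by (metis Re_exp)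
    then have Re1: "Re w = r * cos t" using w0 by (simp add: r_def)
    have "Re (w powr of_real p) = exp (p * Re (Ln w)) * cos (p * t)"
      using w0 by (simp add: powr_def Re_exp t_def)
    also have "exp (p * Re (Ln w)) = r powr p" using w0 by (simp add: powr_def r_def)
    finally have Re2: "Re (w powr of_real p) = r powr p * cos (p * t)" .
    have "cos t = cos \<bar>t\<bar>" "cos (p * t) = cos (p * \<bar>t\<bar>)" by (auto simp: abs_if)
    moreover have "0 < cos \<bar>t\<bar>" using t by (intro cos_gt_zero_pi) auto
    ultimately have "A * Re w powr p - B * Re (w powr of_real p)
        = r powr p * (A * cos \<bar>t\<bar> powr p - B * cos (p * \<bar>t\<bar>))"
      unfolding Re1 Re2 using r by (simp add: powr_mult algebra_simps)
    also have "\<dots> \<ge> r powr p * 1"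
      using main[of "\<bar>t\<bar>"] t by (intro mult_left_mono) auto
    finally show "cmod w powr p \<le> A * Re w powr p - B * Re (w powr of_real p)"
      by (simp add: r_def)
  qed
qed

lemma Re_cauchy_transform_eq:
  assumes f: "integrable circ f" and s: "0 \<le> s" "s < 1"
  shows "Re (cauchy_transform (\<lambda>\<phi>. of_real (f \<phi>)) (of_real s * cis \<theta>)) = (\<integral>\<phi>. f \<phi> * half_poisson s \<theta> \<phi> \<partial>circ)"
    and "integrable circ (\<lambda>\<phi>. f \<phi> * half_poisson s \<theta> \<phi>)"
proof -
  have int: "integrable circ (\<lambda>\<phi>. complex_of_real (f \<phi>) / (1 - of_real s * cis \<theta> * cis (- \<phi>)))"
    by (rule cauchy_transform_integrable) (use s f in \<open>auto\<close>)
  have Re: "Re (complex_of_real (f \<phi>) / (1 - of_real s * cis \<theta> * cis (- \<phi>))) = f \<phi> * half_poisson s \<theta> \<phi>" for \<phi>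
  proof -
    have "complex_of_real (f \<phi>) / w = of_real (f \<phi>) * (1 / w)" for w by simp
    then show ?thesis unfolding half_poisson_def by (simp only: times_complex.sel Re_complex_of_real Im_complex_of_real mult_zero_left diff_zero)
  qed
  show "Re (cauchy_transform (\<lambda>\<phi>. of_real (f \<phi>)) (of_real s * cis \<theta>)) = (\<integral>\<phi>. f \<phi> * half_poisson s \<theta> \<phi> \<partial>circ)"
    unfolding cauchy_transform_def by (subst integral_Re[OF int, symmetric]) (simp only: Re)
  show "integrable circ (\<lambda>\<phi>. f \<phi> * half_poisson s \<theta> \<phi>)"
    using integrable_Re[OF int] by (simp only: Re)
qed

text \<open>For real \<open>f\<close> the real part of the transform averages \<open>f\<close>
  against \<open>half_poisson\<close>, which has mass 1 in each variable: Jensen uses the mass in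
  \<phi>, Tonelli the mass in \<theta>, and the constant is 1.\<close>

lemma nn_integral_Re_cauchy_transform_powr_le:
  assumes f: "integrable circ f" "\<And>\<phi>. 0 \<le> f \<phi>" and s: "0 \<le> s" "s < 1" and p: "1 < p"
  shows "(\<integral>\<^sup>+\<theta>. ennreal (Re (cauchy_transform (\<lambda>\<phi>. of_real (f \<phi>)) (of_real s * cis \<theta>)) powr p) \<partial>circ)
    \<le> (\<integral>\<^sup>+\<phi>. ennreal (f \<phi> powr p) \<partial>circ)"
proof -
  have [measurable]: "f \<in> borel_measurable borel" using f by (auto dest: borel_measurable_integrable)
  have hp: "0 \<le> half_poisson s \<theta> \<phi>" for \<theta> \<phi> using half_poisson_ge[OF s, of \<theta> \<phi>] by simp
  have "ennreal (Re (cauchy_transform (\<lambda>\<phi>. of_real (f \<phi>)) (of_real s * cis \<theta>)) powr p)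
      \<le> (\<integral>\<^sup>+\<phi>. ennreal (f \<phi> powr p) * ennreal (half_poisson s \<theta> \<phi>) \<partial>circ)" for \<theta>
  proof -
    have "ennreal (Re (cauchy_transform (\<lambda>\<phi>. of_real (f \<phi>)) (of_real s * cis \<theta>)) powr p)
        = enn_powr (\<integral>\<^sup>+\<phi>. ennreal (f \<phi>) * ennreal (half_poisson s \<theta> \<phi>) \<partial>circ) p"
      unfolding Re_cauchy_transform_eq(1)[OF f(1) s]
      using Re_cauchy_transform_eq(2)[OF f(1) s, of \<theta>] f(2) hp
      by (subst enn_powr_ennreal[symmetric]) (auto simp: nn_integral_eq_integral[symmetric] ennreal_mult intro!: integral_nonneg_AE)
    also have "\<dots> \<le> enn_powr (\<integral>\<^sup>+\<phi>. ennreal (half_poisson s \<theta> \<phi>) \<partial>circ) (p - 1)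
        * (\<integral>\<^sup>+\<phi>. enn_powr (ennreal (f \<phi>)) p * ennreal (half_poisson s \<theta> \<phi>) \<partial>circ)"
      by (rule nn_integral_weighted_jensen) (use p in measurable)
    finally show ?thesis
      using f(2) by (simp add: nn_integral_half_poisson[OF s] enn_powr_ennreal enn_powr_ennreal[of 1, simplified])
  qed
  then have "(\<integral>\<^sup>+\<theta>. ennreal (Re (cauchy_transform (\<lambda>\<phi>. of_real (f \<phi>)) (of_real s * cis \<theta>)) powr p) \<partial>circ)
      \<le> (\<integral>\<^sup>+\<theta>. \<integral>\<^sup>+\<phi>. ennreal (f \<phi> powr p) * ennreal (half_poisson s \<theta> \<phi>) \<partial>circ \<partial>circ)"
    by (intro nn_integral_mono)
  also have "\<dots> = (\<integral>\<^sup>+\<phi>. \<integral>\<^sup>+\<theta>. ennreal (f \<phi> powr p) * ennreal (half_poisson s \<theta> \<phi>) \<partial>circ \<partial>circ)"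
    by (rule circ2.Fubini') measurable
  also have "\<dots> = (\<integral>\<^sup>+\<phi>. ennreal (f \<phi> powr p) \<partial>circ)"
    by (simp add: nn_integral_cmult nn_integral_half_poisson[OF s])
  finally show ?thesis .
qed

text \<open>Positivity of \<open>f\<close> keeps the transform in the right half-plane, where its
  power of exponent \<open>p\<close> is holomorphic. The mean value property turns the circle mean
  of that power into its value at 0, and only the real part is left to estimate. \<open>A\<close>
  and \<open>B\<close> are fixed beforehand, so the bound is uniform in \<open>f\<close> and
  \<open>s\<close>.\<close>

lemma cauchy_transform_powr_le_pos:
  assumes p: "1 < p" and AB: "0 \<le> A" "0 \<le> B"
      "\<And>w. 0 < Re w \<Longrightarrow> cmod w powr p \<le> A * Re w powr p - B * Re (w powr of_real p)"
    and f: "integrable circ f" "\<And>\<phi>. 0 \<le> f \<phi>" and s: "0 \<le> s" "s < 1"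
  shows "(\<integral>\<^sup>+\<theta>. ennreal (cmod (cauchy_transform (\<lambda>\<phi>. of_real (f \<phi>)) (of_real s * cis \<theta>)) powr p) \<partial>circ)
    \<le> ennreal A * (\<integral>\<^sup>+\<phi>. ennreal (f \<phi> powr p) \<partial>circ)"
proof -
  define F where "F = cauchy_transform (\<lambda>\<phi>. of_real (f \<phi>))"
  define a where "a = (\<integral>\<phi>. f \<phi> \<partial>circ)"
  have a0: "0 \<le> a" unfolding a_def using f by (intro integral_nonneg_AE) auto
  have F0: "F 0 = of_real a" by (simp add: F_def cauchy_transform_0 a_def)
  have holF: "F holomorphic_on ball 0 1" unfolding F_def by (rule cauchy_transform_holomorphic) (use f in auto)
  show ?thesis
  proof (cases "a = 0")
    \<comment> \<open>With mean 0 the transform vanishes identically and does not lie in the open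
      right half-plane, so the argument by holomorphic powers does not cover this case.\<close>
    case True
    have "F (of_real s * cis \<theta>) = 0" for \<theta>
      using norm_cauchy_transform_le[of "\<lambda>\<phi>. of_real (f \<phi>)" "of_real s * cis \<theta>"] f s True
      by (simp add: F_def a_def)
    then show ?thesis unfolding F_def[symmetric] by simp
  next
    case False
    have RF: "0 < Re (F z)" if z: "cmod z < 1" for z
    proof -
      obtain \<theta> where z': "z = of_real (cmod z) * cis \<theta>" using rcis_cmod_Arg[of z] by (metis rcis_def)
      have "(\<integral>\<phi>. f \<phi> * (1 / 2) \<partial>circ) \<le> (\<integral>\<phi>. f \<phi> * half_poisson (cmod z) \<theta> \<phi> \<partial>circ)"
        using f z by (intro integral_mono Re_cauchy_transform_eq(2) mult_left_mono half_poisson_ge) auto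
      also have "\<dots> = Re (F z)"
        unfolding F_def by (subst (2) z', subst Re_cauchy_transform_eq(1)) (use f z in auto)
      finally show ?thesis using a0 False by (simp add: a_def)
    qed
    define G where "G = (\<lambda>z. F z powr of_real p)"
    have holG: "G holomorphic_on ball 0 1"
      unfolding G_def
    proof (intro holomorphic_intros holF)
      fix z :: complex assume "z \<in> ball 0 1"
      then show "F z \<notin> \<real>\<^sub>\<le>\<^sub>0" using RF[of z] by (auto simp: complex_nonpos_Reals_iff)
    qed
    let ?F = "\<lambda>\<theta>. F (of_real s * cis \<theta>)" and ?G = "\<lambda>\<theta>. G (of_real s * cis \<theta>)"
    note contF = holomorphic_on_imp_continuous_on[OF holF]
    have [measurable]: "?F \<in> borel_measurable borel"
      by (rule circle_measurable[OF contF s])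
    obtain b where b: "\<And>\<theta>. cmod (?F \<theta>) \<le> b" using circle_bounded[OF contF s] by blast
    have Rp: "0 < Re (?F \<theta>)" for \<theta> by (rule RF) (use s in simp)
    have iG: "integrable circ ?G" by (rule integrable_circle[OF holomorphic_on_imp_continuous_on[OF holG] s])
    have i1: "integrable circ (\<lambda>\<theta>. cmod (?F \<theta>) powr p)"
      using b p by (intro integrable_circ_bounded[where B = "b powr p"]) (auto intro!: powr_mono2)
    have i2: "integrable circ (\<lambda>\<theta>. Re (?F \<theta>) powr p)"
    proof (intro integrable_circ_bounded[where B = "b powr p"])
      show "norm (Re (?F \<theta>) powr p) \<le> b powr p" for \<theta>
        using p Rp[of \<theta>] complex_Re_le_cmod[of "?F \<theta>"] b[of \<theta>] by (auto intro!: powr_mono2)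
    qed simp
    have "(\<integral>\<theta>. cmod (?F \<theta>) powr p \<partial>circ) \<le> (\<integral>\<theta>. A * Re (?F \<theta>) powr p - B * Re (?G \<theta>) \<partial>circ)"
      using i1 i2 iG by (intro integral_mono) (auto simp: G_def intro: AB(3)[OF Rp])
    also have "\<dots> = A * (\<integral>\<theta>. Re (?F \<theta>) powr p \<partial>circ) - B * Re (\<integral>\<theta>. ?G \<theta> \<partial>circ)"
      using i2 iG by (simp add: integral_Re)
    also have "(\<integral>\<theta>. ?G \<theta> \<partial>circ) = of_real (a powr p)"
      using circle_mean_value[OF holG s] a0 by (simp add: G_def F0 powr_of_real)
    also have "A * (\<integral>\<theta>. Re (?F \<theta>) powr p \<partial>circ) - B * Re (of_real (a powr p)) \<le> A * (\<integral>\<theta>. Re (?F \<theta>) powr p \<partial>circ)"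
      using AB by simp
    finally have le: "(\<integral>\<theta>. cmod (?F \<theta>) powr p \<partial>circ) \<le> A * (\<integral>\<theta>. Re (?F \<theta>) powr p \<partial>circ)" .
    have "(\<integral>\<^sup>+\<theta>. ennreal (cmod (?F \<theta>) powr p) \<partial>circ) = ennreal (\<integral>\<theta>. cmod (?F \<theta>) powr p \<partial>circ)"
      using i1 by (intro nn_integral_eq_integral) auto
    also have "\<dots> \<le> ennreal A * ennreal (\<integral>\<theta>. Re (?F \<theta>) powr p \<partial>circ)"
      using le AB by (simp add: ennreal_mult[symmetric] ennreal_leI)
    also have "ennreal (\<integral>\<theta>. Re (?F \<theta>) powr p \<partial>circ) = (\<integral>\<^sup>+\<theta>. ennreal (Re (?F \<theta>) powr p) \<partial>circ)"
      using i2 by (intro nn_integral_eq_integral[symmetric]) auto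
    also have "ennreal A * \<dots> \<le> ennreal A * (\<integral>\<^sup>+\<phi>. ennreal (f \<phi> powr p) \<partial>circ)"
      unfolding F_def by (intro mult_left_mono nn_integral_Re_cauchy_transform_powr_le f s p) auto
    finally show ?thesis unfolding F_def .
  qed
qed

section \<open>From nonnegative functions to complex ones and to all exponents\<close>

lemma cauchy_transform_add:
  assumes "integrable circ f" "integrable circ g" "cmod z < 1"
  shows "cauchy_transform (\<lambda>\<phi>. f \<phi> + g \<phi>) z = cauchy_transform f z + cauchy_transform g z"
  unfolding cauchy_transform_def
  using cauchy_transform_integrable[OF assms(1,3)] cauchy_transform_integrable[OF assms(2,3)]
  by (simp add: add_divide_distrib)

lemma cauchy_transform_diff:
  assumes "integrable circ f" "integrable circ g" "cmod z < 1"
  shows "cauchy_transform (\<lambda>\<phi>. f \<phi> - g \<phi>) z = cauchy_transform f z - cauchy_transform g z"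
  unfolding cauchy_transform_def
  using cauchy_transform_integrable[OF assms(1,3)] cauchy_transform_integrable[OF assms(2,3)]
  by (simp add: diff_divide_distrib)

lemma cauchy_transform_cmult:
  "cauchy_transform (\<lambda>\<phi>. c * f \<phi>) z = c * cauchy_transform f z"
  unfolding cauchy_transform_def by (simp flip: times_divide_eq_right)

lemma powr_add4_le:
  fixes a b c d p :: real
  assumes "0 \<le> a" "0 \<le> b" "0 \<le> c" "0 \<le> d" "0 \<le> p"
  shows "(a + b + c + d) powr p \<le> 4 powr p * (a powr p + b powr p + c powr p + d powr p)"
proof -
  define m where "m = max (max a b) (max c d)"
  have "(a + b + c + d) powr p \<le> (4 * m) powr p"
    using assms by (intro powr_mono2) (auto simp: m_def)
  also have "\<dots> = 4 powr p * m powr p" using assms by (simp add: powr_mult m_def)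
  also have "m powr p \<le> a powr p + b powr p + c powr p + d powr p"
  proof -
    have "m powr p \<in> {a powr p, b powr p, c powr p, d powr p}" by (auto simp: m_def max_def)
    then show ?thesis by (auto intro: add_increasing add_increasing2)
  qed
  finally show ?thesis by (simp add: mult_left_mono)
qed

text \<open>The function is split into the positive and negative parts of its real and imaginary
  parts, each dominated by the modulus of \<open>f\<close>. The constant collects
  \<open>4 powr p\<close> from the sum of four powers and \<open>4 * A\<close> from the four equal
  bounds.\<close>

lemma cauchy_transform_powr_le_2:
  assumes p: "1 < p" "p \<le> 2"
  obtains C where "0 \<le> C"
    "\<And>f s. integrable circ f \<Longrightarrow> 0 \<le> s \<Longrightarrow> s < 1 \<Longrightarrow>
      (\<integral>\<^sup>+\<theta>. ennreal (cmod (cauchy_transform f (of_real s * cis \<theta>)) powr p) \<partial>circ)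
        \<le> ennreal C * (\<integral>\<^sup>+\<phi>. ennreal (cmod (f \<phi>) powr p) \<partial>circ)"
proof -
  obtain A B :: real where AB: "0 \<le> A" "0 \<le> B"
    "\<And>w. 0 < Re w \<Longrightarrow> cmod w powr p \<le> A * Re w powr p - B * Re (w powr of_real p)"
    using right_half_plane_powr_bound[OF p] by blast
  show ?thesis
  proof (rule that[of "4 powr p * (4 * A)"])
    show "0 \<le> 4 powr p * (4 * A)" using AB by simp
    fix f :: "real \<Rightarrow> complex" and s :: real
    assume f: "integrable circ f" and s: "0 \<le> s" "s < 1"
    define N where "N = (\<integral>\<^sup>+\<phi>. ennreal (cmod (f \<phi>) powr p) \<partial>circ)"
    define T where "T = (\<lambda>u \<theta>. cauchy_transform (\<lambda>\<phi>. of_real (max (u (f \<phi>)) 0)) (of_real s * cis \<theta>))"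
    have iRe: "integrable circ (\<lambda>\<phi>. Re (f \<phi>))" and iIm: "integrable circ (\<lambda>\<phi>. Im (f \<phi>))"
      using f by (auto intro: integrable_Re integrable_Im)
    have imax: "integrable circ (\<lambda>\<phi>. max (g \<phi>) (0::real))" if "integrable circ g" for g
      using that by simp
    have T: "(\<integral>\<^sup>+\<theta>. ennreal (cmod (T u \<theta>) powr p) \<partial>circ) \<le> ennreal A * N"
      and Tm: "T u \<in> borel_measurable borel"
      if u: "integrable circ (\<lambda>\<phi>. u (f \<phi>))" "\<And>w. u w \<le> cmod w" for u
    proof -
      have "(\<integral>\<^sup>+\<theta>. ennreal (cmod (T u \<theta>) powr p) \<partial>circ) \<le> ennreal A * (\<integral>\<^sup>+\<phi>. ennreal (max (u (f \<phi>)) 0 powr p) \<partial>circ)"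
        unfolding T_def by (rule cauchy_transform_powr_le_pos[OF p(1) AB imax[OF u(1)] _ s]) auto
      also have "\<dots> \<le> ennreal A * N"
        unfolding N_def using u(2) p by (intro mult_left_mono nn_integral_mono ennreal_leI powr_mono2) auto
      finally show "(\<integral>\<^sup>+\<theta>. ennreal (cmod (T u \<theta>) powr p) \<partial>circ) \<le> ennreal A * N" .
      show "T u \<in> borel_measurable borel"
        unfolding T_def using imax[OF u(1)] s by (intro cauchy_transform_measurable) auto
    qed
    have bounds: "Re w \<le> cmod w" "- Re w \<le> cmod w" "Im w \<le> cmod w" "- Im w \<le> cmod w" for w
      using abs_Re_le_cmod[of w] abs_Im_le_cmod[of w] by linarith+
    note [measurable] = Tm[OF iRe bounds(1)] Tm[OF Bochner_Integration.integrable_minus[OF iRe] bounds(2)]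
      Tm[OF iIm bounds(3)] Tm[OF Bochner_Integration.integrable_minus[OF iIm] bounds(4)]
    note Tb = T[OF iRe bounds(1)] T[OF Bochner_Integration.integrable_minus[OF iRe] bounds(2)]
      T[OF iIm bounds(3)] T[OF Bochner_Integration.integrable_minus[OF iIm] bounds(4)]
    have split: "cauchy_transform f (of_real s * cis \<theta>)
        = T Re \<theta> + (-1) * T (\<lambda>w. - Re w) \<theta> + \<i> * T Im \<theta> + (-\<i>) * T (\<lambda>w. - Im w) \<theta>" for \<theta>
    proof -
      have z: "cmod (of_real s * cis \<theta>) < 1" using s by simp
      have eq: "f = (\<lambda>\<phi>. of_real (max (Re (f \<phi>)) 0) + (-1) * of_real (max (- Re (f \<phi>)) 0)
          + \<i> * of_real (max (Im (f \<phi>)) 0) + (-\<i>) * of_real (max (- Im (f \<phi>)) 0))"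
        by (auto simp: complex_eq_iff max_def)
      note i = imax[OF iRe] imax[OF Bochner_Integration.integrable_minus[OF iRe]]
        imax[OF iIm] imax[OF Bochner_Integration.integrable_minus[OF iIm]]
      note ic = i[THEN integrable_of_real, where 'a = complex]
      show ?thesis
        unfolding T_def using ic z
        by (subst eq) (simp add: cauchy_transform_add cauchy_transform_diff cauchy_transform_cmult)
    qed
    have "cmod (cauchy_transform f (of_real s * cis \<theta>)) powr p \<le> 4 powr p *
       (cmod (T Re \<theta>) powr p + cmod (T (\<lambda>w. - Re w) \<theta>) powr p + cmod (T Im \<theta>) powr p + cmod (T (\<lambda>w. - Im w) \<theta>) powr p)" for \<theta>
    proof -
      have "cmod (cauchy_transform f (of_real s * cis \<theta>)) \<le>
          cmod (T Re \<theta>) + cmod (T (\<lambda>w. - Re w) \<theta>) + cmod (T Im \<theta>) + cmod (T (\<lambda>w. - Im w) \<theta>)"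
        unfolding split by (intro order_trans[OF norm_triangle_ineq] add_mono) (auto simp: norm_mult)
      then have "cmod (cauchy_transform f (of_real s * cis \<theta>)) powr p \<le>
          (cmod (T Re \<theta>) + cmod (T (\<lambda>w. - Re w) \<theta>) + cmod (T Im \<theta>) + cmod (T (\<lambda>w. - Im w) \<theta>)) powr p"
        using p by (intro powr_mono2) auto
      also have "\<dots> \<le> 4 powr p *
       (cmod (T Re \<theta>) powr p + cmod (T (\<lambda>w. - Re w) \<theta>) powr p + cmod (T Im \<theta>) powr p + cmod (T (\<lambda>w. - Im w) \<theta>) powr p)"
        using p by (intro powr_add4_le) auto
      finally show ?thesis .
    qed
    then have "(\<integral>\<^sup>+\<theta>. ennreal (cmod (cauchy_transform f (of_real s * cis \<theta>)) powr p) \<partial>circ)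
      \<le> (\<integral>\<^sup>+\<theta>. ennreal (4 powr p) * (ennreal (cmod (T Re \<theta>) powr p) + ennreal (cmod (T (\<lambda>w. - Re w) \<theta>) powr p)
          + ennreal (cmod (T Im \<theta>) powr p) + ennreal (cmod (T (\<lambda>w. - Im w) \<theta>) powr p)) \<partial>circ)"
      by (intro nn_integral_mono) (simp add: ennreal_mult[symmetric] ennreal_plus[symmetric] ennreal_leI del: ennreal_plus)
    also have "\<dots> = ennreal (4 powr p) * ((\<integral>\<^sup>+\<theta>. ennreal (cmod (T Re \<theta>) powr p) \<partial>circ)
        + (\<integral>\<^sup>+\<theta>. ennreal (cmod (T (\<lambda>w. - Re w) \<theta>) powr p) \<partial>circ)
        + (\<integral>\<^sup>+\<theta>. ennreal (cmod (T Im \<theta>) powr p) \<partial>circ)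
        + (\<integral>\<^sup>+\<theta>. ennreal (cmod (T (\<lambda>w. - Im w) \<theta>) powr p) \<partial>circ))"
      by (simp add: nn_integral_cmult nn_integral_add)
    also have "\<dots> \<le> ennreal (4 powr p) * (ennreal A * N + ennreal A * N + ennreal A * N + ennreal A * N)"
      by (intro mult_left_mono add_mono Tb) auto
    also have "\<dots> = ennreal (4 powr p * (4 * A)) * N"
    proof -
      have "ennreal A * N + ennreal A * N + ennreal A * N + ennreal A * N = ennreal (4 * A) * N"
        using AB by (simp add: ennreal_plus[symmetric] flip: distrib_right del: ennreal_plus)
      then show ?thesis using AB by (simp add: ennreal_mult mult_ac)
    qed
    finally show "(\<integral>\<^sup>+\<theta>. ennreal (cmod (cauchy_transform f (of_real s * cis \<theta>)) powr p) \<partial>circ)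
      \<le> ennreal (4 powr p * (4 * A)) * (\<integral>\<^sup>+\<phi>. ennreal (cmod (f \<phi>) powr p) \<partial>circ)"
      unfolding N_def .
  qed
qed

text \<open>Conjugating the Cauchy kernel exchanges its two angles, so at each fixed radius the
  operator is self-adjoint. Boundedness of \<open>h\<close> makes Fubini available for a merely
  integrable \<open>f\<close>.\<close>

lemma cauchy_transform_adjoint:
  assumes f: "integrable circ f" and [measurable]: "h \<in> borel_measurable borel"
    and h: "\<And>\<theta>. cmod (h \<theta>) \<le> B" and s: "0 \<le> s" "s < 1"
  shows "(\<integral>\<theta>. cauchy_transform f (of_real s * cis \<theta>) * cnj (h \<theta>) \<partial>circ)
       = (\<integral>\<phi>. f \<phi> * cnj (cauchy_transform h (of_real s * cis \<phi>)) \<partial>circ)"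
proof -
  have [measurable]: "f \<in> borel_measurable borel" using f by (auto dest: borel_measurable_integrable)
  define g where "g = (\<lambda>\<theta> \<phi>. f \<phi> / (1 - of_real s * cis \<theta> * cis (- \<phi>)) * cnj (h \<theta>))"
  have [measurable]: "(\<lambda>(\<theta>, \<phi>). g \<theta> \<phi>) \<in> borel_measurable (borel \<Otimes>\<^sub>M borel)"
    unfolding g_def by measurable
  have B: "0 \<le> B" using h[of 0] norm_ge_zero order_trans by blast
  have gb: "cmod (g \<theta> \<phi>) \<le> B / (1 - s) * cmod (f \<phi>)" for \<theta> \<phi>
  proof -
    have "1 - s \<le> cmod (1 - of_real s * cis \<theta> * cis (- \<phi>))"
      using cauchy_kernel_denom(2)[of "of_real s * cis \<theta> * cis (- \<phi>)"] s by (simp add: norm_mult)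
    then have "cmod (f \<phi>) / cmod (1 - of_real s * cis \<theta> * cis (- \<phi>)) * cmod (h \<theta>) \<le> cmod (f \<phi>) / (1 - s) * B"
      using h s by (intro mult_mono frac_le) auto
    then show ?thesis by (simp add: g_def norm_mult norm_divide mult_ac)
  qed
  have int: "integrable (circ \<Otimes>\<^sub>M circ) (\<lambda>(\<theta>, \<phi>). g \<theta> \<phi>)"
  proof (rule integrableI_bounded)
    have "(\<integral>\<^sup>+x. ennreal (norm (case x of (\<theta>, \<phi>) \<Rightarrow> g \<theta> \<phi>)) \<partial>(circ \<Otimes>\<^sub>M circ))
        = (\<integral>\<^sup>+\<theta>. \<integral>\<^sup>+\<phi>. ennreal (cmod (g \<theta> \<phi>)) \<partial>circ \<partial>circ)"
      by (subst circ.nn_integral_fst[symmetric]) auto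
    also have "\<dots> \<le> (\<integral>\<^sup>+\<theta>. \<integral>\<^sup>+\<phi>. ennreal (B / (1 - s) * cmod (f \<phi>)) \<partial>circ \<partial>circ)"
      by (intro nn_integral_mono ennreal_leI gb)
    also have "\<dots> = (\<integral>\<^sup>+\<phi>. ennreal (norm (B / (1 - s) * cmod (f \<phi>))) \<partial>circ)"
      using B s by simp
    also have "\<dots> < \<infinity>"
    proof -
      have "integrable circ (\<lambda>\<phi>. B / (1 - s) * cmod (f \<phi>))" using f by simp
      then show ?thesis unfolding integrable_iff_bounded by blast
    qed
    finally show "(\<integral>\<^sup>+x. ennreal (norm (case x of (\<theta>, \<phi>) \<Rightarrow> g \<theta> \<phi>)) \<partial>(circ \<Otimes>\<^sub>M circ)) < \<infinity>" .
  qed measurable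
  have inner: "(\<integral>\<theta>. g \<theta> \<phi> \<partial>circ) = f \<phi> * cnj (cauchy_transform h (of_real s * cis \<phi>))" for \<phi>
  proof -
    have "cnj (cauchy_transform h (of_real s * cis \<phi>))
        = (\<integral>\<theta>. cnj (h \<theta> / (1 - of_real s * cis \<phi> * cis (- \<theta>))) \<partial>circ)"
      unfolding cauchy_transform_def by (rule Bochner_Integration.integral_cnj[symmetric])
    also have "f \<phi> * \<dots> = (\<integral>\<theta>. f \<phi> * cnj (h \<theta> / (1 - of_real s * cis \<phi> * cis (- \<theta>))) \<partial>circ)"
      by (rule integral_mult_right_zero[symmetric])
    also have "\<dots> = (\<integral>\<theta>. g \<theta> \<phi> \<partial>circ)"
      by (rule Bochner_Integration.integral_cong) (simp_all add: g_def cis_cnj mult_ac)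
    finally show ?thesis ..
  qed
  have "(\<integral>\<theta>. cauchy_transform f (of_real s * cis \<theta>) * cnj (h \<theta>) \<partial>circ) = (\<integral>\<theta>. \<integral>\<phi>. g \<theta> \<phi> \<partial>circ \<partial>circ)"
    unfolding cauchy_transform_def g_def by (simp only: integral_mult_left_zero)
  also have "\<dots> = (\<integral>\<phi>. \<integral>\<theta>. g \<theta> \<phi> \<partial>circ \<partial>circ)"
    by (rule circ2.Fubini_integral[OF int, symmetric])
  also have "\<dots> = (\<integral>\<phi>. f \<phi> * cnj (cauchy_transform h (of_real s * cis \<phi>)) \<partial>circ)"
    by (simp only: inner)
  finally show ?thesis .
qed

text \<open>For \<open>p > 2\<close> the bound follows from the one for the conjugate exponent, testing the Cauchy
  transform \<open>F\<close> of \<open>f\<close> against \<open>F |F|\<^sup>p\<^sup>-\<^sup>2\<close>.\<close>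
theorem cauchy_transform_riesz:
  assumes p: "1 < p"
  obtains C where "0 \<le> C"
    "\<And>f s. integrable circ f \<Longrightarrow> 0 \<le> s \<Longrightarrow> s < 1 \<Longrightarrow>
      (\<integral>\<^sup>+\<theta>. ennreal (cmod (cauchy_transform f (of_real s * cis \<theta>)) powr p) \<partial>circ)
        \<le> ennreal C * (\<integral>\<^sup>+\<phi>. ennreal (cmod (f \<phi>) powr p) \<partial>circ)"
proof (cases "p \<le> 2")
  case True
  with cauchy_transform_powr_le_2[OF p] that show ?thesis by blast
next
  case False
  define q where "q = p / (p - 1)"
  have q: "1 < q" "q \<le> 2" "1 / p + 1 / q = 1" "(p - 1) * q = p"
    using False by (auto simp: q_def field_simps)
  obtain D where D: "0 \<le> D"
    "\<And>f s. integrable circ f \<Longrightarrow> 0 \<le> s \<Longrightarrow> s < 1 \<Longrightarrow>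
      (\<integral>\<^sup>+\<theta>. ennreal (cmod (cauchy_transform f (of_real s * cis \<theta>)) powr q) \<partial>circ)
        \<le> ennreal D * (\<integral>\<^sup>+\<phi>. ennreal (cmod (f \<phi>) powr q) \<partial>circ)"
    using cauchy_transform_powr_le_2[OF q(1,2)] by blast
  \<comment> \<open>Balances Young's inequality: with this \<open>l\<close> the term containing the
    transform of \<open>h\<close> is at most half of the left-hand side \<open>X\<close>, which is
    finite and can absorb it. \<open>D + 1\<close> keeps \<open>l\<close> positive when
    \<open>D = 0\<close>.\<close>
  define l where "l = (2 * (D + 1)) powr (1 / q)"
  have l: "0 < l" "l powr q = 2 * (D + 1)" using D q by (auto simp: l_def powr_powr)
  show ?thesis
  proof (rule that[of "2 * l powr p"])
    show "0 \<le> 2 * l powr p" by simp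
    fix f :: "real \<Rightarrow> complex" and s :: real
    assume f: "integrable circ f" and s: "0 \<le> s" "s < 1"
    have [measurable]: "f \<in> borel_measurable borel" using f by (auto dest: borel_measurable_integrable)
    define F where "F = (\<lambda>\<theta>. cauchy_transform f (of_real s * cis \<theta>))"
    define h where "h = (\<lambda>\<theta>. F \<theta> * of_real (cmod (F \<theta>) powr (p - 2)))"
    define G where "G = (\<lambda>\<theta>. cauchy_transform h (of_real s * cis \<theta>))"
    note cont = holomorphic_on_imp_continuous_on[OF cauchy_transform_holomorphic]
    have [measurable]: "F \<in> borel_measurable borel"
      unfolding F_def by (rule cauchy_transform_measurable[OF f s])
    have [measurable]: "h \<in> borel_measurable borel" unfolding h_def by measurable
    obtain b where b: "\<And>\<theta>. cmod (F \<theta>) \<le> b"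
      unfolding F_def using circle_bounded[OF cont[OF f] s] by blast
    have nh: "cmod (h \<theta>) = cmod (F \<theta>) powr (p - 1)" for \<theta>
      using powr_add[of "cmod (F \<theta>)" 1 "p - 2"] by (cases "F \<theta> = 0") (simp_all add: h_def norm_mult)
    have hb: "cmod (h \<theta>) \<le> b powr (p - 1)" for \<theta>
      unfolding nh using b p by (intro powr_mono2) auto
    have ih: "integrable circ h" by (rule integrable_circ_bounded[OF _ hb]) simp
    have [measurable]: "G \<in> borel_measurable borel"
      unfolding G_def by (rule cauchy_transform_measurable[OF ih s])
    obtain b' where b': "\<And>\<theta>. cmod (G \<theta>) \<le> b'"
      unfolding G_def using circle_bounded[OF cont[OF ih] s] by blast
    have hq: "cmod (h \<theta>) powr q = cmod (F \<theta>) powr p" for \<theta>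
      by (simp add: nh powr_powr q)
    have Fh: "F \<theta> * cnj (h \<theta>) = of_real (cmod (F \<theta>) powr p)" for \<theta>
    proof -
      have "F \<theta> * cnj (h \<theta>) = of_real ((cmod (F \<theta>))\<^sup>2 * cmod (F \<theta>) powr (p - 2))"
        by (simp add: h_def complex_norm_square[simplified] flip: mult.assoc)
      also have "(cmod (F \<theta>))\<^sup>2 * cmod (F \<theta>) powr (p - 2) = cmod (F \<theta>) powr p"
        using powr_add[of "cmod (F \<theta>)" 2 "p - 2"] by (cases "F \<theta> = 0") simp_all
      finally show ?thesis .
    qed
    define X where "X = (\<integral>\<theta>. cmod (F \<theta>) powr p \<partial>circ)"
    define N where "N = (\<integral>\<^sup>+\<phi>. ennreal (cmod (f \<phi>) powr p) \<partial>circ)"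
    have X0: "0 \<le> X" by (simp add: X_def)
    have iF: "integrable circ (\<lambda>\<theta>. cmod (F \<theta>) powr p)"
      using b p by (intro integrable_circ_bounded[where B = "b powr p"]) (auto intro!: powr_mono2)
    have X: "(\<integral>\<^sup>+\<theta>. ennreal (cmod (F \<theta>) powr p) \<partial>circ) = ennreal X"
      unfolding X_def using iF by (intro nn_integral_eq_integral) auto
    have "complex_of_real X = (\<integral>\<theta>. F \<theta> * cnj (h \<theta>) \<partial>circ)"
      unfolding X_def by (simp add: Fh)
    also have "\<dots> = (\<integral>\<phi>. f \<phi> * cnj (G \<phi>) \<partial>circ)"
      unfolding F_def G_def by (rule cauchy_transform_adjoint[OF f _ hb s]) measurable
    finally have "X = cmod (\<integral>\<phi>. f \<phi> * cnj (G \<phi>) \<partial>circ)" using X0 by (metis abs_of_nonneg norm_of_real)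
    then have "X \<le> (\<integral>\<phi>. cmod (f \<phi> * cnj (G \<phi>)) \<partial>circ)" by simp
    then have "ennreal X \<le> ennreal (\<integral>\<phi>. cmod (f \<phi> * cnj (G \<phi>)) \<partial>circ)" by (rule ennreal_leI)
    also have "\<dots> \<le> (\<integral>\<^sup>+\<phi>. ennreal (cmod (f \<phi> * cnj (G \<phi>))) \<partial>circ)"
    proof (subst nn_integral_eq_integral)
      show "integrable circ (\<lambda>\<phi>. cmod (f \<phi> * cnj (G \<phi>)))"
      proof (rule Bochner_Integration.integrable_bound)
        show "integrable circ (\<lambda>\<phi>. b' *\<^sub>R f \<phi>)" using f by simp
        show "AE \<phi> in circ. norm (cmod (f \<phi> * cnj (G \<phi>))) \<le> norm (b' *\<^sub>R f \<phi>)"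
          using b' by (auto simp: norm_mult intro!: mult_right_mono AE_I2 order_trans[OF b' abs_ge_self] simp: mult.commute)
      qed measurable
    qed auto
    also have "\<dots> \<le> (\<integral>\<^sup>+\<phi>. ennreal (l powr p) * ennreal (cmod (f \<phi>) powr p)
        + ennreal (1 / l powr q) * ennreal (cmod (G \<phi>) powr q) \<partial>circ)"
    proof (intro nn_integral_mono)
      fix \<phi>
      have "(l * cmod (f \<phi>)) * (cmod (G \<phi>) / l) \<le> (l * cmod (f \<phi>)) powr p / p + (cmod (G \<phi>) / l) powr q / q"
        using p q l by (intro Youngs_inequality) auto
      also have "\<dots> \<le> (l * cmod (f \<phi>)) powr p + (cmod (G \<phi>) / l) powr q"
        using p q by (intro add_mono) (simp_all add: divide_le_eq mult_le_cancel_left1)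
      also have "\<dots> = l powr p * cmod (f \<phi>) powr p + 1 / l powr q * cmod (G \<phi>) powr q"
        using l by (simp add: powr_mult powr_divide)
      finally show "ennreal (cmod (f \<phi> * cnj (G \<phi>))) \<le> ennreal (l powr p) * ennreal (cmod (f \<phi>) powr p)
        + ennreal (1 / l powr q) * ennreal (cmod (G \<phi>) powr q)"
        using l(1) by (simp add: norm_mult ennreal_mult[symmetric] ennreal_plus[symmetric] ennreal_leI del: ennreal_plus)
    qed
    also have "\<dots> = ennreal (l powr p) * N + ennreal (1 / l powr q) * (\<integral>\<^sup>+\<phi>. ennreal (cmod (G \<phi>) powr q) \<partial>circ)"
      unfolding N_def by (simp add: nn_integral_add nn_integral_cmult)
    also have "\<dots> \<le> ennreal (l powr p) * N + ennreal (1 / l powr q) * (ennreal D * ennreal X)"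
      using D(2)[OF ih s] unfolding G_def hq X by (intro add_left_mono mult_left_mono) auto
    also have "ennreal (1 / l powr q) * (ennreal D * ennreal X) = ennreal (D / (2 * (D + 1)) * X)"
      using D X0 by (simp add: l ennreal_mult[symmetric])
    also have "\<dots> \<le> ennreal (X / 2)"
    proof (rule ennreal_leI)
      have "D / (2 * (D + 1)) \<le> 1 / 2" using D by (simp add: field_simps)
      from mult_right_mono[OF this X0] show "D / (2 * (D + 1)) * X \<le> X / 2" by simp
    qed
    finally have le: "ennreal X \<le> ennreal (l powr p) * N + ennreal (X / 2)" by (simp add: add_left_mono)
    have "ennreal X \<le> ennreal (2 * l powr p) * N"
    proof (cases "N = top")
      case True
      then show ?thesis using l by (simp add: ennreal_mult_top)
    next
      case False
      then obtain n where n: "N = ennreal n" "0 \<le> n" by (cases N) auto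
      have "X \<le> l powr p * n + X / 2"
        using le X0 n unfolding n by (simp add: ennreal_mult[symmetric] ennreal_plus[symmetric] del: ennreal_plus)
      then have "X \<le> 2 * l powr p * n" by simp
      then show ?thesis using n by (simp add: n ennreal_mult[symmetric] ennreal_leI)
    qed
    then show "(\<integral>\<^sup>+\<theta>. ennreal (cmod (cauchy_transform f (of_real s * cis \<theta>)) powr p) \<partial>circ)
        \<le> ennreal (2 * l powr p) * (\<integral>\<^sup>+\<phi>. ennreal (cmod (f \<phi>) powr p) \<partial>circ)"
      unfolding X[symmetric] unfolding F_def N_def .
  qed
qed

section \<open>Kernels with increasing coefficients\<close>

definition power_kernel :: "(nat \<Rightarrow> real) \<Rightarrow> complex \<Rightarrow> complex" where
  "power_kernel m w = (\<Sum>n. of_real (m n) * w ^ n)"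

definition backward_diff :: "(nat \<Rightarrow> real) \<Rightarrow> nat \<Rightarrow> real" where
  "backward_diff m j = m j - (case j of 0 \<Rightarrow> 0 | Suc i \<Rightarrow> m i)"

lemma backward_diff_nonneg: "incseq m \<Longrightarrow> 0 \<le> m 0 \<Longrightarrow> 0 \<le> backward_diff m j"
  by (auto simp: backward_diff_def incseq_Suc_iff split: nat.split)

text \<open>Multiplication by \<open>1 - w\<close> subtracts the shifted series. The statement is
  generic because it is used for complex \<open>w\<close>, to expand the kernel, and for the real
  radius, to add up the resulting norms.\<close>

lemma backward_diff_sums:
  fixes w :: "'a::{real_normed_field, banach}"
  assumes "summable (\<lambda>n. of_real (m n) * w ^ n)"
  shows "(\<lambda>j. of_real (backward_diff m j) * w ^ j) sums ((1 - w) * (\<Sum>n. of_real (m n) * w ^ n))"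
proof -
  let ?S = "\<Sum>n. of_real (m n) * w ^ n"
  have 1: "(\<lambda>n. of_real (m n) * w ^ n) sums ?S" using assms by (rule summable_sums)
  have "(\<lambda>n. w * (of_real (m n) * w ^ n)) sums (w * ?S)" by (rule sums_mult[OF 1])
  then have "(\<lambda>n. case Suc n of 0 \<Rightarrow> 0 | Suc i \<Rightarrow> w * (of_real (m i) * w ^ i)) sums (w * ?S)" by simp
  from sums_Suc[OF this]
  have 2: "(\<lambda>n. case n of 0 \<Rightarrow> 0 | Suc i \<Rightarrow> w * (of_real (m i) * w ^ i)) sums (w * ?S)" by simp
  have "(\<lambda>n. of_real (m n) * w ^ n - (case n of 0 \<Rightarrow> 0 | Suc i \<Rightarrow> w * (of_real (m i) * w ^ i))) sums (?S - w * ?S)"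
    by (rule sums_diff[OF 1 2])
  moreover have "of_real (m n) * w ^ n - (case n of 0 \<Rightarrow> 0 | Suc i \<Rightarrow> w * (of_real (m i) * w ^ i))
      = of_real (backward_diff m n) * w ^ n" for n
    by (cases n) (simp_all add: backward_diff_def algebra_simps)
  ultimately show ?thesis by (simp add: algebra_simps)
qed

lemma summable_power_norm:
  assumes s: "summable (\<lambda>n. m n * s ^ n)" and m: "\<And>n. 0 \<le> (m n :: real)" and w: "cmod w \<le> s"
  shows "summable (\<lambda>n. cmod (of_real (m n) * w ^ n))"
proof (rule summable_comparison_test'[OF s])
  show "norm (cmod (of_real (m n) * w ^ n)) \<le> m n * s ^ n" for n
    using m w by (auto simp: norm_mult norm_power intro!: mult_left_mono power_mono)
qed

text \<open>In \<open>w ^ j / (1 - w)\<close> the factor of \<open>w ^ j\<close> that depends on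
  \<theta> leaves the integral with modulus \<open>s ^ j\<close>, while the factor depending on
  \<phi> is unimodular and is absorbed into the function as \<open>fj j\<close>. Minkowski over
  counting measure in \<open>j\<close> then adds the norms.\<close>

lemma power_kernel_operator_bound:
  assumes p: "1 < p" and C: "0 \<le> C"
    and riesz: "\<And>f. integrable circ f \<Longrightarrow>
      (\<integral>\<^sup>+\<theta>. ennreal (cmod (cauchy_transform f (of_real s * cis \<theta>)) powr p) \<partial>circ)
        \<le> ennreal C * (\<integral>\<^sup>+\<phi>. ennreal (cmod (f \<phi>) powr p) \<partial>circ)"
    and f: "integrable circ f" and s: "0 \<le> s" "s < 1"
    and m: "incseq m" "\<And>n. 0 \<le> m n" "summable (\<lambda>n. m n * s ^ n)"
  shows "(\<integral>\<^sup>+\<theta>. ennreal (cmod (\<integral>\<phi>. f \<phi> * power_kernel m (of_real s * cis \<theta> * cis (- \<phi>)) \<partial>circ) powr p) \<partial>circ)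
    \<le> ennreal (C * ((1 - s) * (\<Sum>n. m n * s ^ n)) powr p) * (\<integral>\<^sup>+\<phi>. ennreal (cmod (f \<phi>) powr p) \<partial>circ)"
proof -
  have [measurable]: "f \<in> borel_measurable borel" using f by (auto dest: borel_measurable_integrable)
  define d where "d = backward_diff m"
  have d: "0 \<le> d j" for j unfolding d_def by (intro backward_diff_nonneg m)
  define \<delta> where "\<delta> = (1 - s) * (\<Sum>n. m n * s ^ n)"
  have dsum: "(\<lambda>j. d j * s ^ j) sums \<delta>"
    using backward_diff_sums[of m s] m(3) by (simp add: d_def \<delta>_def)
  have \<delta>: "0 \<le> \<delta>" unfolding \<delta>_def using s m by (intro mult_nonneg_nonneg suminf_nonneg) auto
  define N where "N = (\<integral>\<^sup>+\<phi>. ennreal (cmod (f \<phi>) powr p) \<partial>circ)"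
  define fj where "fj = (\<lambda>j \<phi>. f \<phi> * cis (- \<phi>) ^ j)"
  have [measurable]: "fj j \<in> borel_measurable borel" for j unfolding fj_def by measurable
  have nfj: "cmod (fj j \<phi>) = cmod (f \<phi>)" for j \<phi> by (simp add: fj_def norm_mult norm_power)
  have ifj: "integrable circ (fj j)" for j
    by (rule Bochner_Integration.integrable_bound[OF f]) (simp_all add: nfj)
  define T where "T = (\<lambda>j \<theta>. cauchy_transform (fj j) (of_real s * cis \<theta>))"
  have [measurable]: "T j \<in> borel_measurable borel" for j
    unfolding T_def by (rule cauchy_transform_measurable[OF ifj s])
  define S where "S = (\<lambda>\<theta>. \<integral>\<phi>. f \<phi> * power_kernel m (of_real s * cis \<theta> * cis (- \<phi>)) \<partial>circ)"
  have Sb: "ennreal (cmod (S \<theta>)) \<le> (\<integral>\<^sup>+j. ennreal (d j * s ^ j) * ennreal (cmod (T j \<theta>)) \<partial>count_space UNIV)" for \<theta>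
  proof -
    define g where "g = (\<lambda>j \<phi>. of_real (d j) * (of_real s * cis \<theta>) ^ j * (fj j \<phi> / (1 - of_real s * cis \<theta> * cis (- \<phi>))))"
    have z: "cmod (of_real s * cis \<theta>) < 1" using s by simp
    have ig: "integrable circ (g j)" for j
      unfolding g_def by (intro integrable_mult_right cauchy_transform_integrable[OF ifj z])
    have Ig: "integral\<^sup>L circ (g j) = of_real (d j) * (of_real s * cis \<theta>) ^ j * T j \<theta>" for j
      unfolding g_def T_def cauchy_transform_def by (rule integral_mult_right_zero)
    \<comment> \<open>The blow-up \<open>1 / (1 - s)\<close> does no harm: this domination only
      justifies exchanging sum and integral and does not enter the final constant.\<close>
    have gb: "cmod (g j \<phi>) \<le> d j * s ^ j * (cmod (f \<phi>) / (1 - s))" for j \<phi>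
    proof -
      have "1 - s \<le> cmod (1 - of_real s * cis \<theta> * cis (- \<phi>))"
        using cauchy_kernel_denom(2)[of "of_real s * cis \<theta> * cis (- \<phi>)"] s by (simp add: norm_mult)
      then have "cmod (f \<phi>) / cmod (1 - of_real s * cis \<theta> * cis (- \<phi>)) \<le> cmod (f \<phi>) / (1 - s)"
        using s by (intro frac_le) auto
      then have "d j * s ^ j * (cmod (f \<phi>) / cmod (1 - of_real s * cis \<theta> * cis (- \<phi>)))
          \<le> d j * s ^ j * (cmod (f \<phi>) / (1 - s))"
        using d s by (intro mult_left_mono) auto
      moreover have "cmod (g j \<phi>) = d j * s ^ j * (cmod (f \<phi>) / cmod (1 - of_real s * cis \<theta> * cis (- \<phi>)))"
        using d[of j] s by (simp only: g_def norm_mult norm_power norm_divide nfj norm_of_real norm_cis abs_of_nonneg mult_1_right)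
      ultimately show ?thesis by simp
    qed
    have sumd: "summable (\<lambda>j. d j * s ^ j * c)" for c
      using dsum by (intro summable_mult2) (auto simp: sums_iff)
    have Ib: "(\<integral>\<phi>. cmod (g j \<phi>) \<partial>circ) \<le> d j * s ^ j * ((\<integral>\<phi>. cmod (f \<phi>) \<partial>circ) / (1 - s))" for j
    proof -
      have "(\<integral>\<phi>. cmod (g j \<phi>) \<partial>circ) \<le> (\<integral>\<phi>. d j * s ^ j * (cmod (f \<phi>) / (1 - s)) \<partial>circ)"
        using ig f by (intro integral_mono gb) auto
      then show ?thesis by simp
    qed
    have "norm (\<integral>\<phi>. cmod (g j \<phi>) \<partial>circ) \<le> d j * s ^ j * ((\<integral>\<phi>. cmod (f \<phi>) \<partial>circ) / (1 - s))" for j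
      using Ib[of j] by simp
    then have sumI: "summable (\<lambda>j. \<integral>\<phi>. cmod (g j \<phi>) \<partial>circ)"
      by (rule summable_comparison_test'[OF sumd])
    have "(\<lambda>j. integral\<^sup>L circ (g j)) sums (\<integral>\<phi>. (\<Sum>j. g j \<phi>) \<partial>circ)"
    proof (rule sums_integral[OF ig _ sumI])
      show "AE \<phi> in circ. summable (\<lambda>j. cmod (g j \<phi>))"
        proof (rule AE_I2)
        fix \<phi>
        show "summable (\<lambda>j. cmod (g j \<phi>))"
          by (rule summable_comparison_test'[OF sumd[of "cmod (f \<phi>) / (1 - s)"]]) (simp only: real_norm_def abs_norm_cancel gb)
      qed
    qed
    moreover have "(\<Sum>j. g j \<phi>) = f \<phi> * power_kernel m (of_real s * cis \<theta> * cis (- \<phi>))" for \<phi>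
    proof -
      define w where "w = of_real s * cis \<theta> * cis (- \<phi>)"
      have w: "cmod w = s" using s by (simp add: w_def norm_mult)
      have "summable (\<lambda>n. of_real (m n) * w ^ n)"
        by (rule summable_norm_cancel[OF summable_power_norm[OF m(3,2)]]) (simp add: w)
      from sums_mult[OF backward_diff_sums[OF this], of "f \<phi> / (1 - w)"]
      have "(\<lambda>j. f \<phi> / (1 - w) * (of_real (d j) * w ^ j)) sums (f \<phi> * power_kernel m w)"
        using cauchy_kernel_denom(1)[of w] w s by (simp add: d_def power_kernel_def)
      moreover have "f \<phi> / (1 - w) * (of_real (d j) * w ^ j) = g j \<phi>" for j
        unfolding g_def fj_def w_def by (simp add: power_mult_distrib)
      ultimately show ?thesis by (simp add: sums_iff w_def)
    qed
    ultimately have sums: "(\<lambda>j. integral\<^sup>L circ (g j)) sums S \<theta>" by (simp add: S_def)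
    have su: "summable (\<lambda>j. cmod (integral\<^sup>L circ (g j)))"
      by (rule summable_comparison_test'[OF sumI]) simp
    have "cmod (S \<theta>) \<le> (\<Sum>j. cmod (integral\<^sup>L circ (g j)))"
      using summable_norm[OF su] sums by (simp add: sums_iff)
    then have "ennreal (cmod (S \<theta>)) \<le> ennreal (\<Sum>j. cmod (integral\<^sup>L circ (g j)))" by (rule ennreal_leI)
    also have "\<dots> = (\<Sum>j. ennreal (cmod (integral\<^sup>L circ (g j))))"
      by (rule suminf_ennreal2[symmetric]) (use su in auto)
    also have "\<dots> = (\<Sum>j. ennreal (d j * s ^ j) * ennreal (cmod (T j \<theta>)))"
    proof (intro suminf_cong)
      fix j
      have "cmod (integral\<^sup>L circ (g j)) = d j * s ^ j * cmod (T j \<theta>)"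
        using d[of j] s by (simp add: Ig norm_mult norm_power)
      then show "ennreal (cmod (integral\<^sup>L circ (g j))) = ennreal (d j * s ^ j) * ennreal (cmod (T j \<theta>))"
        using d[of j] s by (simp add: ennreal_mult)
    qed
    finally show ?thesis by (simp add: nn_integral_count_space_nat)
  qed
  interpret M: pair_sigma_finite "count_space (UNIV :: nat set)" circ
    by (intro pair_sigma_finite.intro sigma_finite_measure_count_space circ.sigma_finite_measure_axioms)
  define H where "H = (\<lambda>j \<theta>. ennreal (d j * s ^ j) * ennreal (cmod (T j \<theta>)))"
  \<comment> \<open>Modulation does not change the modulus, so \<open>R\<close> bounds the norms of
    all the \<open>T j\<close> at once.\<close>
  define R where "R = enn_powr (ennreal C * N) (1 / p)"
  have "(\<integral>\<^sup>+\<theta>. ennreal (cmod (S \<theta>) powr p) \<partial>circ)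
      \<le> (\<integral>\<^sup>+\<theta>. enn_powr (\<integral>\<^sup>+j. H j \<theta> \<partial>count_space UNIV) p \<partial>circ)"
  proof (intro nn_integral_mono)
    fix \<theta>
    have "enn_powr (ennreal (cmod (S \<theta>))) p \<le> enn_powr (\<integral>\<^sup>+j. H j \<theta> \<partial>count_space UNIV) p"
      using Sb[of \<theta>] p unfolding H_def by (intro enn_powr_mono) auto
    then show "ennreal (cmod (S \<theta>) powr p) \<le> enn_powr (\<integral>\<^sup>+j. H j \<theta> \<partial>count_space UNIV) p"
      by (simp add: enn_powr_ennreal)
  qed
  also have "\<dots> \<le> enn_powr (\<integral>\<^sup>+j. ennreal (d j * s ^ j) * R \<partial>count_space UNIV) p"
  proof (rule M.nn_integral_minkowski[OF _ _ p])
    have [measurable]: "H j \<in> borel_measurable circ" for j unfolding H_def by measurable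
    show "(\<lambda>(j, \<theta>). H j \<theta>) \<in> borel_measurable (count_space UNIV \<Otimes>\<^sub>M circ)"
      by (rule measurable_pair_measure_countable1) auto
    show "(\<integral>\<^sup>+\<theta>. enn_powr (H j \<theta>) p \<partial>circ) \<le> enn_powr (ennreal (d j * s ^ j) * R) p" for j
    proof -
      have "(\<integral>\<^sup>+\<theta>. enn_powr (H j \<theta>) p \<partial>circ)
          = enn_powr (ennreal (d j * s ^ j)) p * (\<integral>\<^sup>+\<theta>. ennreal (cmod (T j \<theta>) powr p) \<partial>circ)"
        unfolding H_def by (subst nn_integral_cmult[symmetric]) (auto simp: enn_powr_mult enn_powr_ennreal)
      also have "\<dots> \<le> enn_powr (ennreal (d j * s ^ j)) p * (ennreal C * N)"
        using riesz[OF ifj, of j] unfolding nfj T_def N_def by (intro mult_left_mono) auto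
      also have "ennreal C * N = enn_powr R p" using p by (simp add: R_def enn_powr_powr)
      finally show ?thesis by (simp add: enn_powr_mult)
    qed
  qed simp
  also have "(\<integral>\<^sup>+j. ennreal (d j * s ^ j) * R \<partial>count_space UNIV) = ennreal \<delta> * R"
  proof -
    have "(\<Sum>j. ennreal (d j * s ^ j)) = ennreal \<delta>"
      using dsum d s by (subst suminf_ennreal2) (auto simp: sums_iff)
    then show ?thesis by (simp add: nn_integral_multc nn_integral_count_space_nat)
  qed
  also have "enn_powr (ennreal \<delta> * R) p = ennreal (\<delta> powr p) * (ennreal C * N)"
    using p \<delta> by (simp add: enn_powr_mult enn_powr_ennreal R_def enn_powr_powr)
  also have "\<dots> = ennreal (C * \<delta> powr p) * N"
    using C by (simp add: ennreal_mult mult_ac)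
  finally show ?thesis unfolding S_def \<delta>_def N_def .
qed

section \<open>Polar coordinates\<close>

lemma borel_measurable_Complex [measurable (raw)]:
  assumes [measurable]: "f \<in> borel_measurable M" "g \<in> borel_measurable M"
  shows "(\<lambda>x. Complex (f x) (g x)) \<in> borel_measurable M"
  unfolding Complex_eq by measurable

lemma lborel_complex: "lborel = distr (lborel \<Otimes>\<^sub>M lborel) borel (\<lambda>(x, y). Complex x y)"
proof (rule lborel_eqI)
  have [measurable]: "(\<lambda>(x, y). Complex x y) \<in> borel_measurable (lborel \<Otimes>\<^sub>M lborel)"
    by measurable
  show "sets (distr (lborel \<Otimes>\<^sub>M lborel) borel (\<lambda>(x, y). Complex x y)) = sets borel" by simp
  fix l u :: complex assume lu: "\<And>b. b \<in> Basis \<Longrightarrow> l \<bullet> b \<le> u \<bullet> b"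
  have le: "Re l \<le> Re u" "Im l \<le> Im u" using lu[of 1] lu[of \<i>] by (auto simp: Basis_complex_def)
  have "(\<lambda>(x, y). Complex x y) -` box l u \<inter> space (lborel \<Otimes>\<^sub>M lborel) = {Re l<..<Re u} \<times> {Im l<..<Im u}"
    by (auto simp: in_box_complex_iff space_pair_measure)
  then have "emeasure (distr (lborel \<Otimes>\<^sub>M lborel) borel (\<lambda>(x, y). Complex x y)) (box l u)
      = emeasure (lborel \<Otimes>\<^sub>M lborel) ({Re l<..<Re u} \<times> {Im l<..<Im u})"
    by (subst emeasure_distr) auto
  also have "\<dots> = ennreal (Re u - Re l) * ennreal (Im u - Im l)"
    using le by (subst lborel.emeasure_pair_measure_Times) auto
  also have "\<dots> = ennreal (\<Prod>b\<in>Basis. (u - l) \<bullet> b)"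
    using le by (simp add: Basis_complex_def ennreal_mult)
  finally show "emeasure (distr (lborel \<Otimes>\<^sub>M lborel) borel (\<lambda>(x, y). Complex x y)) (box l u)
      = ennreal (\<Prod>b\<in>Basis. (u - l) \<bullet> b)" .
qed

lemma nn_integral_complex:
  assumes [measurable]: "h \<in> borel_measurable borel"
  shows "(\<integral>\<^sup>+z. h z \<partial>lborel) = (\<integral>\<^sup>+x. \<integral>\<^sup>+y. h (Complex x y) \<partial>lborel \<partial>lborel)"
  by (subst lborel_complex, subst nn_integral_distr)
    (auto simp: case_prod_beta lborel.nn_integral_fst[symmetric])

text \<open>The substitution is made on compact intervals: the intervals \<open>?I n\<close> exhaust
  the line, their images \<open>?J n\<close> exhaust the open interval of angles, and monotone
  convergence passes to the limit on both sides.\<close>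

lemma nn_integral_arctan:
  assumes [measurable]: "u \<in> borel_measurable borel"
  shows "(\<integral>\<^sup>+t. u (arctan t) * ennreal (1 / (1 + t\<^sup>2)) \<partial>lborel) = (\<integral>\<^sup>+\<phi>\<in>{-pi/2<..<pi/2}. u \<phi> \<partial>lborel)"
proof -
  let ?I = "\<lambda>n. {- real (Suc n)..real (Suc n)}"
  let ?J = "\<lambda>n. {arctan (- real (Suc n))..arctan (real (Suc n))}"
  have SI: "(SUP n. indicator (?I n) t) = (1 :: ennreal)" for t
  proof (rule antisym)
    obtain n where "\<bar>t\<bar> \<le> real n" using real_arch_simple by blast
    then have "(1 :: ennreal) = indicator (?I n) t" by (auto simp: indicator_def)
    also have "\<dots> \<le> (SUP n. indicator (?I n) t)" by (rule SUP_upper) simp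
    finally show "1 \<le> (SUP n. indicator (?I n) t :: ennreal)" .
    show "(SUP n. indicator (?I n) t) \<le> (1 :: ennreal)" by (rule SUP_least) (simp add: indicator_def)
  qed
  have SJ: "(SUP n. indicator (?J n) \<phi>) = (indicator {-pi/2<..<pi/2} \<phi> :: ennreal)" for \<phi>
  proof (cases "\<phi> \<in> {-pi/2<..<pi/2}")
    case True
    obtain n where n: "\<bar>tan \<phi>\<bar> \<le> real n" using real_arch_simple by blast
    have "arctan (tan \<phi>) = \<phi>" using True by (intro arctan_tan) auto
    moreover have "arctan (- real (Suc n)) \<le> arctan (tan \<phi>)" "arctan (tan \<phi>) \<le> arctan (real (Suc n))"
      unfolding arctan_le_iff using n by auto
    ultimately have "(1 :: ennreal) = indicator (?J n) \<phi>" by (simp only: indicator_def atLeastAtMost_iff simp_thms of_bool_eq)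
    also have "\<dots> \<le> (SUP n. indicator (?J n) \<phi>)" by (rule SUP_upper) simp
    finally have 1: "1 \<le> (SUP n. indicator (?J n) \<phi> :: ennreal)" .
    have 2: "(SUP n. indicator (?J n) \<phi>) \<le> (1 :: ennreal)" by (rule SUP_least) (simp add: indicator_def)
    have 3: "indicator {-pi/2<..<pi/2} \<phi> = (1 :: ennreal)" using True by simp
    show ?thesis unfolding 3 using 2 1 by (rule antisym)
  next
    case False
    have "\<phi> \<notin> ?J n" for n
      using False arctan_lbound[of "- real (Suc n)"] arctan_ubound[of "real (Suc n)"] by auto
    then have 1: "indicator (?J n) \<phi> = (0 :: ennreal)" for n by (simp only: indicator_def of_bool_eq simp_thms)
    have 2: "indicator {-pi/2<..<pi/2} \<phi> = (0 :: ennreal)" using False by (simp only: indicator_def of_bool_eq simp_thms)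
    show ?thesis unfolding 1 2 by simp
  qed
  have inc: "incseq (\<lambda>n t. c t * indicator (X n) t :: ennreal)" if "\<And>m n. m \<le> n \<Longrightarrow> X m \<subseteq> X n"
    for c :: "real \<Rightarrow> ennreal" and X :: "nat \<Rightarrow> real set"
    using that by (auto simp: incseq_def le_fun_def indicator_def)
  have incI: "?I m \<subseteq> ?I n" if "m \<le> n" for m n using that by simp
  have incJ: "?J m \<subseteq> ?J n" if "m \<le> n" for m n
    using that by (simp add: arctan_le_iff del: of_nat_Suc)
  have "(\<integral>\<^sup>+t. u (arctan t) * ennreal (1 / (1 + t\<^sup>2)) \<partial>lborel)
      = (\<integral>\<^sup>+t. (SUP n. u (arctan t) * ennreal (1 / (1 + t\<^sup>2)) * indicator (?I n) t) \<partial>lborel)"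
    by (simp only: SUP_mult_left_ennreal[symmetric] SI mult_1_right)
  also have "\<dots> = (SUP n. \<integral>\<^sup>+t. u (arctan t) * ennreal (1 / (1 + t\<^sup>2)) * indicator (?I n) t \<partial>lborel)"
    by (rule nn_integral_monotone_convergence_SUP[OF inc[OF incI]]) measurable
  also have "\<dots> = (SUP n. \<integral>\<^sup>+\<phi>. u \<phi> * indicator (?J n) \<phi> \<partial>lborel)"
  proof (intro SUP_cong refl)
    fix n
    show "(\<integral>\<^sup>+t. u (arctan t) * ennreal (1 / (1 + t\<^sup>2)) * indicator (?I n) t \<partial>lborel)
      = (\<integral>\<^sup>+\<phi>. u \<phi> * indicator (?J n) \<phi> \<partial>lborel)"
    proof (rule nn_integral_substitution_aux[symmetric])
      show "(arctan has_real_derivative 1 / (1 + x\<^sup>2)) (at x)" for x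
        using DERIV_arctan[of x] by (simp add: field_simps)
      show "continuous_on (?I n) (\<lambda>x. 1 / (1 + x\<^sup>2) :: real)"
        by (intro continuous_intros) (auto simp: add_nonneg_eq_0_iff)
    qed auto
  qed
  also have "\<dots> = (\<integral>\<^sup>+\<phi>. (SUP n. u \<phi> * indicator (?J n) \<phi>) \<partial>lborel)"
    by (rule nn_integral_monotone_convergence_SUP[OF inc[OF incJ], symmetric]) measurable
  also have "\<dots> = (\<integral>\<^sup>+\<phi>\<in>{-pi/2<..<pi/2}. u \<phi> \<partial>lborel)"
    by (simp only: SUP_mult_left_ennreal[symmetric] SJ)
  finally show ?thesis .
qed

lemma nn_integral_shift_interval:
  fixes u :: "real \<Rightarrow> ennreal"
  assumes [measurable]: "u \<in> borel_measurable borel"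
  shows "(\<integral>\<^sup>+\<phi>\<in>{a<..<b}. u (\<phi> + c) \<partial>lborel) = (\<integral>\<^sup>+\<phi>\<in>{a+c<..<b+c}. u \<phi> \<partial>lborel)"
proof -
  have "(\<integral>\<^sup>+\<phi>\<in>{a+c<..<b+c}. u \<phi> \<partial>lborel) = (\<integral>\<^sup>+\<phi>. u (c + 1 * \<phi>) * indicator {a+c<..<b+c} (c + 1 * \<phi>) \<partial>lborel)"
    by (subst nn_integral_real_affine[where c = 1 and t = c]) auto
  also have "\<dots> = (\<integral>\<^sup>+\<phi>\<in>{a<..<b}. u (\<phi> + c) \<partial>lborel)"
    by (intro nn_integral_cong) (auto simp: add.commute split: split_indicator)
  finally show ?thesis ..
qed

lemma nn_integral_split_interval:
  fixes u :: "real \<Rightarrow> ennreal"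
  assumes [measurable]: "u \<in> borel_measurable borel" and "a \<le> b" "b \<le> c"
  shows "(\<integral>\<^sup>+\<phi>\<in>{a<..<c}. u \<phi> \<partial>lborel) = (\<integral>\<^sup>+\<phi>\<in>{a<..<b}. u \<phi> \<partial>lborel) + (\<integral>\<^sup>+\<phi>\<in>{b<..<c}. u \<phi> \<partial>lborel)"
proof -
  have "AE \<phi> in lborel. u \<phi> * indicator {a<..<c} \<phi> = u \<phi> * indicator {a<..<b} \<phi> + u \<phi> * indicator {b<..<c} \<phi>"
    using AE_lborel_singleton[of b] by eventually_elim (use assms in \<open>auto simp: indicator_def\<close>)
  then have "(\<integral>\<^sup>+\<phi>\<in>{a<..<c}. u \<phi> \<partial>lborel)
      = (\<integral>\<^sup>+\<phi>. u \<phi> * indicator {a<..<b} \<phi> + u \<phi> * indicator {b<..<c} \<phi> \<partial>lborel)"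
    by (rule nn_integral_cong_AE)
  then show ?thesis by (simp add: nn_integral_add)
qed

text \<open>The angles between \<open>-pi/2\<close> and \<open>pi/2\<close> together with their
  antipodes make up one period; the part below 0 is moved up by \<open>2 * pi\<close>.\<close>

lemma nn_integral_periodic_circle:
  fixes u :: "real \<Rightarrow> ennreal"
  assumes [measurable]: "u \<in> borel_measurable borel" and per: "\<And>\<phi>. u (\<phi> + 2 * pi) = u \<phi>"
  shows "(\<integral>\<^sup>+\<phi>\<in>{-pi/2<..<pi/2}. u \<phi> + u (\<phi> + pi) \<partial>lborel) = (\<integral>\<^sup>+\<phi>\<in>{0..2*pi}. u \<phi> \<partial>lborel)"
proof -
  have e: "-pi/2 + pi = pi/2" "pi/2 + pi = 3*pi/2" "-pi/2 + 2*pi = 3*pi/2" "0 + 2*pi = 2*pi" by simp_all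
  define J where "J = (\<lambda>a b. \<integral>\<^sup>+\<phi>\<in>{a<..<b}. u \<phi> \<partial>lborel)"
  have split: "J a c = J a b + J b c" if "a \<le> b" "b \<le> c" for a b c
    unfolding J_def by (rule nn_integral_split_interval[OF assms(1) that])
  have "(\<integral>\<^sup>+\<phi>\<in>{-pi/2<..<pi/2}. u \<phi> + u (\<phi> + pi) \<partial>lborel)
      = J (-pi/2) (pi/2) + (\<integral>\<^sup>+\<phi>\<in>{-pi/2<..<pi/2}. u (\<phi> + pi) \<partial>lborel)"
    unfolding J_def by (subst nn_integral_add[symmetric]) (auto simp: distrib_right)
  also have "(\<integral>\<^sup>+\<phi>\<in>{-pi/2<..<pi/2}. u (\<phi> + pi) \<partial>lborel) = J (pi/2) (3*pi/2)"
    using nn_integral_shift_interval[OF assms(1), where a = "-pi/2" and b = "pi/2" and c = pi]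
    unfolding J_def by (simp only: e)
  also have "J (-pi/2) (pi/2) = J (-pi/2) 0 + J 0 (pi/2)" by (rule split) auto
  also have "J (-pi/2) 0 = J (3*pi/2) (2*pi)"
    using nn_integral_shift_interval[OF assms(1), where a = "-pi/2" and b = 0 and c = "2*pi"]
    unfolding J_def by (simp only: e per)
  also have "J (3*pi/2) (2*pi) + J 0 (pi/2) + J (pi/2) (3*pi/2) = J 0 (2*pi)"
    using split[of 0 "pi/2" "2*pi"] split[of "pi/2" "3*pi/2" "2*pi"] by (simp add: add_ac)
  also have "J 0 (2*pi) = (\<integral>\<^sup>+\<phi>\<in>{0..2*pi}. u \<phi> \<partial>lborel)"
    unfolding J_def
  proof (rule nn_integral_cong_AE)
    show "AE \<phi> in lborel. u \<phi> * indicator {0<..<2*pi} \<phi> = u \<phi> * indicator {0..2*pi} \<phi>"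
      using AE_lborel_singleton[of 0] AE_lborel_singleton[of "2*pi"]
      by eventually_elim (auto simp: indicator_def)
  qed
  finally show ?thesis .
qed

text \<open>The substitutions \<open>y = x t\<close>, \<open>x = \<rho> / sqrt (1 + t\<^sup>2)\<close> and \<open>t = tan \<phi>\<close> reduce polar coordinates to
  one-dimensional changes of variables.\<close>
theorem nn_integral_polar:
  assumes [measurable]: "h \<in> borel_measurable borel"
  shows "(\<integral>\<^sup>+z. h z \<partial>lborel)
    = (\<integral>\<^sup>+\<rho>\<in>{0..}. ennreal (2 * pi * \<rho>) * (\<integral>\<^sup>+\<theta>. h (of_real \<rho> * cis \<theta>) \<partial>circ) \<partial>lborel)"
proof -
  define v where "v = (\<lambda>\<phi>. \<integral>\<^sup>+\<rho>. ennreal \<bar>\<rho>\<bar> * h (of_real \<rho> * cis \<phi>) \<partial>lborel)"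
  have [measurable]: "v \<in> borel_measurable borel" unfolding v_def by measurable
  \<comment> \<open>With \<open>c = cos (arctan t)\<close>, one factor \<open>c\<close> comes from
    the weight \<open>\<bar>x\<bar>\<close> and a second from the change of variable. Their product
    is exactly the derivative of arctan.\<close>
  have inner: "(\<integral>\<^sup>+x. ennreal \<bar>x\<bar> * h (Complex x (x * t)) \<partial>lborel) = v (arctan t) * ennreal (1 / (1 + t\<^sup>2))" for t
  proof -
    define c where "c = 1 / sqrt (1 + t\<^sup>2)"
    have pos: "0 < 1 + t\<^sup>2" by (simp add: add_pos_nonneg)
    have c: "0 < c" using pos by (simp add: c_def)
    have cc: "c * c = 1 / (1 + t\<^sup>2)" using pos by (simp add: c_def)
    have "(\<integral>\<^sup>+x. ennreal \<bar>x\<bar> * h (Complex x (x * t)) \<partial>lborel)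
        = ennreal \<bar>c\<bar> * (\<integral>\<^sup>+\<rho>. ennreal \<bar>0 + c * \<rho>\<bar> * h (Complex (0 + c * \<rho>) ((0 + c * \<rho>) * t)) \<partial>lborel)"
      by (rule nn_integral_real_affine) (use c in auto)
    also have "\<dots> = (\<integral>\<^sup>+\<rho>. ennreal (1 / (1 + t\<^sup>2)) * (ennreal \<bar>\<rho>\<bar> * h (of_real \<rho> * cis (arctan t))) \<partial>lborel)"
    proof (subst nn_integral_cmult[symmetric])
      have "Complex (c * \<rho>) (c * \<rho> * t) = of_real \<rho> * cis (arctan t)" for \<rho>
        by (simp add: complex_eq_iff cos_arctan sin_arctan c_def)
      moreover have "ennreal \<bar>c\<bar> * ennreal \<bar>c * \<rho>\<bar> = ennreal (1 / (1 + t\<^sup>2)) * ennreal \<bar>\<rho>\<bar>" for \<rho>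
        using c by (simp add: ennreal_mult[symmetric] abs_mult mult.assoc[symmetric] cc)
      ultimately show "(\<integral>\<^sup>+\<rho>. ennreal \<bar>c\<bar> * (ennreal \<bar>0 + c * \<rho>\<bar> * h (Complex (0 + c * \<rho>) ((0 + c * \<rho>) * t))) \<partial>lborel)
        = (\<integral>\<^sup>+\<rho>. ennreal (1 / (1 + t\<^sup>2)) * (ennreal \<bar>\<rho>\<bar> * h (of_real \<rho> * cis (arctan t))) \<partial>lborel)"
        by (simp add: mult.assoc[symmetric])
    qed measurable
    also have "\<dots> = v (arctan t) * ennreal (1 / (1 + t\<^sup>2))"
      unfolding v_def by (subst nn_integral_cmult) (auto simp: mult.commute)
    finally show ?thesis .
  qed
  \<comment> \<open>In \<open>v\<close> the variable \<rho> runs over a whole line through the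
    origin; its negative half is the ray in the direction \<open>\<phi> + pi\<close>.\<close>
  have vsplit: "v \<phi> = (\<integral>\<^sup>+\<rho>\<in>{0..}. ennreal \<rho> * (h (of_real \<rho> * cis \<phi>) + h (of_real \<rho> * cis (\<phi> + pi))) \<partial>lborel)" for \<phi>
  proof -
    define w where "w = (\<lambda>\<rho>. ennreal \<bar>\<rho>\<bar> * h (of_real \<rho> * cis \<phi>))"
    have [measurable]: "w \<in> borel_measurable borel" unfolding w_def by measurable
    have "v \<phi> = (\<integral>\<^sup>+\<rho>. w \<rho> * indicator {0..} \<rho> + w \<rho> * indicator {..<0} \<rho> \<partial>lborel)"
      unfolding v_def w_def[symmetric] by (intro nn_integral_cong) (auto split: split_indicator)
    also have "\<dots> = (\<integral>\<^sup>+\<rho>. w \<rho> * indicator {0..} \<rho> \<partial>lborel) + (\<integral>\<^sup>+\<rho>. w \<rho> * indicator {..<0} \<rho> \<partial>lborel)"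
      by (rule nn_integral_add) measurable
    also have "(\<integral>\<^sup>+\<rho>. w \<rho> * indicator {..<0} \<rho> \<partial>lborel)
        = ennreal \<bar>-1\<bar> * (\<integral>\<^sup>+\<rho>. w (0 + (-1) * \<rho>) * indicator {..<0} (0 + (-1) * \<rho>) \<partial>lborel)"
      by (rule nn_integral_real_affine) auto
    also have "\<dots> = (\<integral>\<^sup>+\<rho>. w (- \<rho>) * indicator {0..} \<rho> \<partial>lborel)"
    proof -
      have "(\<integral>\<^sup>+\<rho>. w (- \<rho>) * indicator {..<0} (- \<rho>) \<partial>lborel) = (\<integral>\<^sup>+\<rho>. w (- \<rho>) * indicator {0..} \<rho> \<partial>lborel)"
        by (intro nn_integral_cong) (auto simp: w_def indicator_def)
      then show ?thesis by simp
    qed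
    also have "(\<integral>\<^sup>+\<rho>. w \<rho> * indicator {0..} \<rho> \<partial>lborel) + \<dots>
        = (\<integral>\<^sup>+\<rho>. w \<rho> * indicator {0..} \<rho> + w (- \<rho>) * indicator {0..} \<rho> \<partial>lborel)"
      by (rule nn_integral_add[symmetric]) measurable
    also have "\<dots> = (\<integral>\<^sup>+\<rho>\<in>{0..}. ennreal \<rho> * (h (of_real \<rho> * cis \<phi>) + h (of_real \<rho> * cis (\<phi> + pi))) \<partial>lborel)"
    proof (intro nn_integral_cong)
      fix \<rho> :: real
      have "cis (\<phi> + pi) = - cis \<phi>" by (simp add: cis_mult[symmetric])
      then show "w \<rho> * indicator {0..} \<rho> + w (- \<rho>) * indicator {0..} \<rho>
        = ennreal \<rho> * (h (of_real \<rho> * cis \<phi>) + h (of_real \<rho> * cis (\<phi> + pi))) * indicator {0..} \<rho>"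
        by (auto simp: w_def distrib_left split: split_indicator)
    qed
    finally show ?thesis .
  qed
  have "(\<integral>\<^sup>+z. h z \<partial>lborel) = (\<integral>\<^sup>+x. \<integral>\<^sup>+y. h (Complex x y) \<partial>lborel \<partial>lborel)"
    by (rule nn_integral_complex) measurable
  also have "\<dots> = (\<integral>\<^sup>+x. \<integral>\<^sup>+t. ennreal \<bar>x\<bar> * h (Complex x (x * t)) \<partial>lborel \<partial>lborel)"
  proof (rule nn_integral_cong_AE)
    show "AE x in lborel. (\<integral>\<^sup>+y. h (Complex x y) \<partial>lborel) = (\<integral>\<^sup>+t. ennreal \<bar>x\<bar> * h (Complex x (x * t)) \<partial>lborel)"
      using AE_lborel_singleton[of 0]
    proof eventually_elim
      case (elim x)
      have "(\<integral>\<^sup>+y. h (Complex x y) \<partial>lborel) = ennreal \<bar>x\<bar> * (\<integral>\<^sup>+t. h (Complex x (0 + x * t)) \<partial>lborel)"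
        by (rule nn_integral_real_affine) (use elim in auto)
      then show ?case by (simp add: nn_integral_cmult)
    qed
  qed
  also have "\<dots> = (\<integral>\<^sup>+t. \<integral>\<^sup>+x. ennreal \<bar>x\<bar> * h (Complex x (x * t)) \<partial>lborel \<partial>lborel)"
    by (rule lborel_pair.Fubini') measurable
  also have "\<dots> = (\<integral>\<^sup>+\<phi>\<in>{-pi/2<..<pi/2}. v \<phi> \<partial>lborel)"
    unfolding inner by (rule nn_integral_arctan) measurable
  also have "\<dots> = (\<integral>\<^sup>+\<phi>. \<integral>\<^sup>+\<rho>. ennreal \<rho> * indicator {0..} \<rho> * ((h (of_real \<rho> * cis \<phi>) + h (of_real \<rho> * cis (\<phi> + pi))) * indicator {-pi/2<..<pi/2} \<phi>) \<partial>lborel \<partial>lborel)"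
    unfolding vsplit by (subst nn_integral_multc[symmetric]) (auto simp: mult_ac)
  also have "\<dots> = (\<integral>\<^sup>+\<rho>. \<integral>\<^sup>+\<phi>. ennreal \<rho> * indicator {0..} \<rho> * ((h (of_real \<rho> * cis \<phi>) + h (of_real \<rho> * cis (\<phi> + pi))) * indicator {-pi/2<..<pi/2} \<phi>) \<partial>lborel \<partial>lborel)"
    by (rule lborel_pair.Fubini') measurable
  also have "\<dots> = (\<integral>\<^sup>+\<rho>\<in>{0..}. ennreal (2 * pi * \<rho>) * (\<integral>\<^sup>+\<theta>. h (of_real \<rho> * cis \<theta>) \<partial>circ) \<partial>lborel)"
  proof (intro nn_integral_cong)
    fix \<rho> :: real
    let ?u = "\<lambda>\<phi>. h (of_real \<rho> * cis \<phi>)"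
    have "(\<integral>\<^sup>+\<phi>. ennreal \<rho> * indicator {0..} \<rho> * ((?u \<phi> + ?u (\<phi> + pi)) * indicator {-pi/2<..<pi/2} \<phi>) \<partial>lborel)
      = ennreal \<rho> * indicator {0..} \<rho> * (\<integral>\<^sup>+\<phi>\<in>{-pi/2<..<pi/2}. ?u \<phi> + ?u (\<phi> + pi) \<partial>lborel)"
      by (rule nn_integral_cmult) measurable
    also have "(\<integral>\<^sup>+\<phi>\<in>{-pi/2<..<pi/2}. ?u \<phi> + ?u (\<phi> + pi) \<partial>lborel) = (\<integral>\<^sup>+\<phi>\<in>{0..2*pi}. ?u \<phi> \<partial>lborel)"
      by (rule nn_integral_periodic_circle) (auto simp: cis_mult[symmetric])
    also have "\<dots> = ennreal (2 * pi) * (\<integral>\<^sup>+\<theta>. ?u \<theta> \<partial>circ)"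
      by (subst nn_integral_circ) (simp_all add: mult.assoc[symmetric] ennreal_mult[symmetric])
    also have "ennreal \<rho> * indicator {0..} \<rho> * (ennreal (2 * pi) * (\<integral>\<^sup>+\<theta>. ?u \<theta> \<partial>circ))
      = ennreal (2 * pi * \<rho>) * (\<integral>\<^sup>+\<theta>. ?u \<theta> \<partial>circ) * indicator {0..} \<rho>"
      by (auto simp: ennreal_mult mult_ac split: split_indicator)
    finally show "(\<integral>\<^sup>+\<phi>. ennreal \<rho> * indicator {0..} \<rho> * ((?u \<phi> + ?u (\<phi> + pi)) * indicator {-pi/2<..<pi/2} \<phi>) \<partial>lborel)
      = ennreal (2 * pi * \<rho>) * (\<integral>\<^sup>+\<theta>. ?u \<theta> \<partial>circ) * indicator {0..} \<rho>" .
  qed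
  finally show ?thesis .
qed

section \<open>Weights with the doubling property\<close>

text \<open>The profile is normalised to be Borel on the whole line and 0 off [0,1), so that it can
  serve as a density; moments, tails at nonnegative points and the projection only see its values on
  [0,1).\<close>

locale dhat_weight =
  fixes \<omega> :: "real \<Rightarrow> real" and D :: real
  assumes weight_measurable [measurable]: "\<omega> \<in> borel_measurable borel"
    and weight_nonneg: "0 \<le> \<omega> r"
    and weight_outside: "r \<notin> {0..<1} \<Longrightarrow> \<omega> r = 0"
    and weight_integrable: "integrable lborel \<omega>"
    and hat_pos: "r < 1 \<Longrightarrow> 0 < omega_hat \<omega> r"
    and D_pos: "0 < D"
    and doubling: "r \<in> {0..<1} \<Longrightarrow> omega_hat \<omega> r \<le> D * omega_hat \<omega> ((1 + r) / 2)"
begin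

abbreviation hat :: "real \<Rightarrow> real" where "hat \<equiv> omega_hat \<omega>"

section \<open>The tail function and its distribution under the weight\<close>

definition \<nu> :: "real measure" where "\<nu> = density lborel (\<lambda>r. ennreal (\<omega> r))"

lemma sets_\<nu> [simp, measurable_cong]: "sets \<nu> = sets borel" by (simp add: \<nu>_def)
lemma space_\<nu> [simp]: "space \<nu> = UNIV" by (simp add: \<nu>_def)

lemma hat_integrable: "A \<in> sets borel \<Longrightarrow> integrable lborel (\<lambda>s. indicator A s * \<omega> s)"
  using integrable_mult_indicator[OF _ weight_integrable, of A] by simp

lemma emeasure_\<nu>_Ico: "emeasure \<nu> {r..<1} = ennreal (hat r)"
proof -
  have "emeasure \<nu> {r..<1} = (\<integral>\<^sup>+s. ennreal (indicator {r..<1} s * \<omega> s) \<partial>lborel)"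
    unfolding \<nu>_def by (subst emeasure_density) (auto intro!: nn_integral_cong split: split_indicator)
  also have "\<dots> = ennreal (hat r)"
    unfolding omega_hat_def set_lebesgue_integral_def real_scaleR_def
    by (rule nn_integral_eq_integral[OF hat_integrable]) (use weight_nonneg in auto)
  finally show ?thesis .
qed

sublocale \<nu>: finite_measure \<nu>
proof
  have "emeasure \<nu> UNIV = (\<integral>\<^sup>+s. ennreal (\<omega> s) \<partial>lborel)" unfolding \<nu>_def by (subst emeasure_density) auto
  also have "\<dots> < \<infinity>"
    using weight_integrable weight_nonneg by (simp add: integrable_iff_bounded)
  finally show "emeasure \<nu> (space \<nu>) \<noteq> \<infinity>" by simp
qed

lemma hat_nonneg: "0 \<le> hat r"
  unfolding omega_hat_def set_lebesgue_integral_def by (intro integral_nonneg_AE) (use weight_nonneg in auto)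

lemma hat_antimono: "r \<le> s \<Longrightarrow> hat s \<le> hat r"
proof -
  assume "r \<le> s"
  then have "emeasure \<nu> {s..<1} \<le> emeasure \<nu> {r..<1}" by (intro emeasure_mono) auto
  then show ?thesis using hat_nonneg by (simp add: emeasure_\<nu>_Ico)
qed

lemma hat_measurable [measurable]: "hat \<in> borel_measurable borel"
proof -
  have "(\<lambda>r. - hat r) \<in> borel_measurable borel"
    by (rule borel_measurable_mono) (use hat_antimono in \<open>auto simp: mono_def\<close>)
  then show ?thesis by simp
qed

text \<open>Since \<open>hat\<close> is decreasing, the set is a final segment below 1, and the part
  of it to the right of any of its points \<rho> has mass \<open>hat \<rho> \<le> t\<close>. In
  other words, the image of \<nu> under \<open>hat\<close> gives [0,t] no more mass than Lebesgue
  measure does.\<close>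

lemma emeasure_hat_le: "0 \<le> t \<Longrightarrow> emeasure \<nu> {\<rho>. \<rho> < 1 \<and> hat \<rho> \<le> t} \<le> ennreal t"
proof -
  assume t: "0 \<le> t"
  define X where "X = {\<rho>. \<rho> < 1 \<and> hat \<rho> \<le> t}"
  have up: "\<rho>' \<in> X" if "\<rho> \<in> X" "\<rho> \<le> \<rho>'" "\<rho>' < 1" for \<rho> \<rho>'
    using that hat_antimono[of \<rho> \<rho>'] by (auto simp: X_def)
  have X1: "\<rho> < 1" if "\<rho> \<in> X" for \<rho> using that by (simp add: X_def)
  have le: "emeasure \<nu> {\<rho>..<1} \<le> ennreal t" if "\<rho> \<in> X" for \<rho>
    using that by (simp add: emeasure_\<nu>_Ico X_def ennreal_leI)
  have neg: "emeasure \<nu> {..<0} = 0"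
    unfolding \<nu>_def by (subst emeasure_density) (auto simp: nn_integral_0_iff_AE weight_outside split: split_indicator)
  show ?thesis
  proof (cases "\<exists>\<rho>\<in>X. \<rho> < 0")
    case True
    then obtain \<rho> where \<rho>: "\<rho> \<in> X" "\<rho> < 0" by blast
    have "emeasure \<nu> X \<le> emeasure \<nu> ({\<rho>..<1} \<union> {..<0})"
      using \<rho> by (intro emeasure_mono) (auto simp: X_def)
    also have "\<dots> \<le> emeasure \<nu> {\<rho>..<1} + emeasure \<nu> {..<0}" by (rule emeasure_subadditive) auto
    finally show ?thesis using le[OF \<rho>(1)] neg by (simp add: X_def)
  next
    case False
    then have nn: "0 \<le> \<rho>" if "\<rho> \<in> X" for \<rho> using that by force
    show ?thesis
    proof (cases "X = {}")
      case False
      define a where "a = Inf X"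
      have bdd: "bdd_below X" using nn by (rule bdd_belowI)
      have ge: "a \<le> \<rho>" if "\<rho> \<in> X" for \<rho> unfolding a_def by (rule cInf_lower[OF that bdd])
      have above: "\<rho> \<in> X" if r: "a < \<rho>" "\<rho> < 1" for \<rho>
      proof -
        obtain \<rho>' where "\<rho>' \<in> X" "\<rho>' < \<rho>"
          using cInf_lessD[OF False, of \<rho>] r unfolding a_def by auto
        then show ?thesis using up[of \<rho>' \<rho>] r by simp
      qed
      show ?thesis
      proof (cases "a \<in> X")
        case True
        then have "X = {a..<1}" using X1 by (auto intro: up[OF True] ge)
        then show ?thesis using le[OF True] by (simp add: X_def)
      next
        case False
        \<comment> \<open>When the infimum is not attained, the open segment is exhausted by
          segments that start inside \<open>X\<close>; those whose left end is 1 or more are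
          empty.\<close>
        let ?A = "\<lambda>n. {a + 1 / real (Suc n)..<1}"
        have "X = (\<Union>n. ?A n)"
        proof (intro set_eqI iffI)
          fix \<rho> assume \<rho>: "\<rho> \<in> X"
          then have "a < \<rho>" using ge[OF \<rho>] False by (metis order_le_less)
          then obtain n where "1 / real (Suc n) < \<rho> - a" using nat_approx_posE[of "\<rho> - a"] by auto
          then have "\<rho> \<in> ?A n" using X1[OF \<rho>] unfolding atLeastLessThan_iff by linarith
          then show "\<rho> \<in> (\<Union>n. ?A n)" by blast
        next
          fix \<rho> assume "\<rho> \<in> (\<Union>n. ?A n)"
          then obtain n where n: "a + 1 / real (Suc n) \<le> \<rho>" "\<rho> < 1" by auto
          moreover have "0 < 1 / real (Suc n)" by simp
          ultimately show "\<rho> \<in> X" by (intro above) linarith+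
        qed
        also have "emeasure \<nu> (\<Union>n. ?A n) = (SUP n. emeasure \<nu> (?A n))"
        proof (rule SUP_emeasure_incseq[symmetric])
          show "incseq ?A"
          proof (intro incseq_SucI subsetI)
            fix n \<rho> assume "\<rho> \<in> ?A n"
            moreover have "1 / real (Suc (Suc n)) \<le> 1 / real (Suc n)" by (intro frac_le) auto
            ultimately show "\<rho> \<in> ?A (Suc n)" unfolding atLeastLessThan_iff by linarith
          qed
        qed auto
        also have "\<dots> \<le> ennreal t"
        proof (rule SUP_least)
          fix n
          show "emeasure \<nu> (?A n) \<le> ennreal t"
          proof (cases "a + 1 / real (Suc n) < 1")
            case True
            have "0 < 1 / real (Suc n)" by simp
            then have "a + 1 / real (Suc n) \<in> X" using True by (intro above) linarith+
            then show ?thesis by (rule le)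
          qed simp
        qed
        finally show ?thesis by (simp add: X_def)
      qed
    next
      case True
      then show ?thesis unfolding X_def[symmetric] by simp
    qed
  qed
qed

text \<open>The integrand is at most a constant times the integral of \<open>s powr (-a-1) / max t0 s\<close> over
  \<open>hat \<rho> \<le> s \<le> 2 * hat \<rho>\<close>, so Tonelli and the bound on the distribution of \<open>hat\<close> apply.\<close>
lemma nn_integral_hat_power_kernel:
  assumes a: "0 < a" "a < 1" and t0: "0 < t0"
  shows "(\<integral>\<^sup>+\<rho>. ennreal (hat \<rho> powr (-a) / max t0 (hat \<rho>)) \<partial>\<nu>)
     \<le> ennreal (2 powr (a + 2) * (1 / (1 - a) + 1 / a) * t0 powr (-a))"
proof -
  define \<psi> where "\<psi> = (\<lambda>s. s powr (-a-1) / max t0 s)"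
  have \<psi>0: "0 \<le> \<psi> s" for s using t0 by (simp add: \<psi>_def)
  have [measurable]: "\<psi> \<in> borel_measurable borel" unfolding \<psi>_def by measurable
  have AE1: "AE \<rho> in \<nu>. \<rho> < 1"
  proof -
    have "0 < \<omega> x \<longrightarrow> x < 1" for x using weight_outside[of x] by (cases "x < 1") auto
    then show ?thesis unfolding \<nu>_def by (subst AE_density) auto
  qed
  have pt: "ennreal (t powr (-a) / max t0 t) \<le> ennreal (2 powr (a + 2)) * (\<integral>\<^sup>+s. ennreal (\<psi> s) * indicator {t..} s \<partial>lborel)"
    if t: "0 < t" for t
  proof -
    \<comment> \<open>A lower bound for \<open>\<psi>\<close> on the interval from \<open>t\<close>
      to \<open>2 * t\<close>, where the numerator decreases and \<open>max t0 s\<close> at most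
      doubles. The length \<open>t\<close> of the interval restores the exponent; the factors
      \<open>2 powr (a + 1)\<close> and 2 lost here give \<open>2 powr (a + 2)\<close>.\<close>
    define c where "c = (2 * t) powr (-a-1) / (2 * max t0 t)"
    have c: "0 \<le> c" using t t0 by (simp add: c_def)
    have "ennreal (c * t) = (\<integral>\<^sup>+s. ennreal c * indicator {t..2*t} s \<partial>lborel)"
      using t c by (simp add: nn_integral_cmult ennreal_mult)
    also have "\<dots> \<le> (\<integral>\<^sup>+s. ennreal (\<psi> s) * indicator {t..} s \<partial>lborel)"
    proof (intro nn_integral_mono)
      fix s
      show "ennreal c * indicator {t..2*t} s \<le> ennreal (\<psi> s) * indicator {t..} s"
      proof (cases "s \<in> {t..2*t}")
        case True
        have "(2 * t) powr (-a-1) \<le> s powr (-a-1)" using True t a by (intro powr_mono2') auto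
        then have "c \<le> \<psi> s" unfolding c_def \<psi>_def using True t t0 by (intro frac_le) auto
        then show ?thesis using True by (simp add: ennreal_leI)
      qed simp
    qed
    finally have le: "ennreal (c * t) \<le> (\<integral>\<^sup>+s. ennreal (\<psi> s) * indicator {t..} s \<partial>lborel)" .
    have "(2 * t) powr (-a-1) * t = 2 powr (-a-1) * t powr (-a)"
      using t by (simp add: powr_mult powr_diff)
    then have "2 powr (a + 2) * (c * t) = 2 powr (a + 2) * 2 powr (-a-1) / 2 * (t powr (-a) / max t0 t)"
      by (simp add: c_def)
    also have "2 powr (a + 2) * 2 powr (-a-1) / 2 = (1::real)" by (simp flip: powr_add)
    finally have "ennreal (t powr (-a) / max t0 t) = ennreal (2 powr (a + 2)) * ennreal (c * t)"
      using c t by (simp add: ennreal_mult[symmetric])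
    then show ?thesis using le by (simp add: mult_left_mono)
  qed
  have "(\<integral>\<^sup>+\<rho>. ennreal (hat \<rho> powr (-a) / max t0 (hat \<rho>)) \<partial>\<nu>)
      \<le> (\<integral>\<^sup>+\<rho>. ennreal (2 powr (a + 2)) * (\<integral>\<^sup>+s. ennreal (\<psi> s) * indicator {\<rho>. \<rho> < 1 \<and> hat \<rho> \<le> s} \<rho> * indicator {0<..} s \<partial>lborel) \<partial>\<nu>)"
  proof (rule nn_integral_mono_AE)
    show "AE \<rho> in \<nu>. ennreal (hat \<rho> powr (-a) / max t0 (hat \<rho>)) \<le>
        ennreal (2 powr (a + 2)) * (\<integral>\<^sup>+s. ennreal (\<psi> s) * indicator {\<rho>. \<rho> < 1 \<and> hat \<rho> \<le> s} \<rho> * indicator {0<..} s \<partial>lborel)"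
      using AE1
    proof eventually_elim
      case (elim \<rho>)
      have "(\<integral>\<^sup>+s. ennreal (\<psi> s) * indicator {hat \<rho>..} s \<partial>lborel)
          = (\<integral>\<^sup>+s. ennreal (\<psi> s) * indicator {\<rho>. \<rho> < 1 \<and> hat \<rho> \<le> s} \<rho> * indicator {0<..} s \<partial>lborel)"
        using elim hat_pos[OF elim] by (intro nn_integral_cong) (auto simp: indicator_def)
      then show ?case using pt[OF hat_pos[OF elim]] by simp
    qed
  qed
  also have "\<dots> = ennreal (2 powr (a + 2)) * (\<integral>\<^sup>+\<rho>. \<integral>\<^sup>+s. ennreal (\<psi> s) * indicator {\<rho>. \<rho> < 1 \<and> hat \<rho> \<le> s} \<rho> * indicator {0<..} s \<partial>lborel \<partial>\<nu>)"
    by (rule nn_integral_cmult) measurable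
  also have "(\<integral>\<^sup>+\<rho>. \<integral>\<^sup>+s. ennreal (\<psi> s) * indicator {\<rho>. \<rho> < 1 \<and> hat \<rho> \<le> s} \<rho> * indicator {0<..} s \<partial>lborel \<partial>\<nu>)
      = (\<integral>\<^sup>+s. \<integral>\<^sup>+\<rho>. ennreal (\<psi> s) * indicator {\<rho>. \<rho> < 1 \<and> hat \<rho> \<le> s} \<rho> * indicator {0<..} s \<partial>\<nu> \<partial>lborel)"
  proof -
    interpret P: pair_sigma_finite lborel \<nu> ..
    show ?thesis by (rule P.Fubini') measurable
  qed
  \<comment> \<open>The distribution bound contributes one factor \<open>s\<close> and leaves
    \<open>s powr (-a) / max t0 s\<close>. Splitting at \<open>t0\<close> gives an integral that
    converges at 0 because \<open>a < 1\<close> and one that converges at infinity because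
    \<open>0 < a\<close>.\<close>
  also have "\<dots> \<le> (\<integral>\<^sup>+s. ennreal (indicator {0..t0} s * (s powr (-a) / t0)) + ennreal (indicator {t0..} s * s powr (-a-1)) \<partial>lborel)"
  proof (rule nn_integral_mono)
    fix s :: real
    show "(\<integral>\<^sup>+\<rho>. ennreal (\<psi> s) * indicator {\<rho>. \<rho> < 1 \<and> hat \<rho> \<le> s} \<rho> * indicator {0<..} s \<partial>\<nu>)
        \<le> ennreal (indicator {0..t0} s * (s powr (-a) / t0)) + ennreal (indicator {t0..} s * s powr (-a-1))"
    proof (cases "0 < s")
      case True
      have "(\<integral>\<^sup>+\<rho>. ennreal (\<psi> s) * indicator {\<rho>. \<rho> < 1 \<and> hat \<rho> \<le> s} \<rho> * indicator {0<..} s \<partial>\<nu>)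
          = ennreal (\<psi> s) * emeasure \<nu> {\<rho>. \<rho> < 1 \<and> hat \<rho> \<le> s}"
        using True by (simp add: nn_integral_cmult)
      also have "\<dots> \<le> ennreal (\<psi> s) * ennreal s"
        using True by (intro mult_left_mono emeasure_hat_le) auto
      also have "\<dots> = ennreal (s powr (-a) / max t0 s)"
        using True \<psi>0[of s] by (simp add: ennreal_mult[symmetric] \<psi>_def powr_diff)
      also have "\<dots> \<le> ennreal (indicator {0..t0} s * (s powr (-a) / t0)) + ennreal (indicator {t0..} s * s powr (-a-1))"
        using True t0 by (cases "s \<le> t0") (auto simp: indicator_def max_def powr_diff add_increasing2)
      finally show ?thesis .
    qed simp
  qed
  also have "\<dots> = (\<integral>\<^sup>+s. ennreal (indicator {0..t0} s * (s powr (-a) / t0)) \<partial>lborel)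
      + (\<integral>\<^sup>+s. ennreal (indicator {t0..} s * s powr (-a-1)) \<partial>lborel)"
    by (rule nn_integral_add) measurable
  also have "(\<integral>\<^sup>+s. ennreal (indicator {0..t0} s * (s powr (-a) / t0)) \<partial>lborel) = ennreal (t0 powr (-a) / (1 - a))"
  proof -
    have "((\<lambda>s. s powr (-a) / t0) has_integral (t0 powr (-a + 1) / (-a + 1)) / t0) {0..t0}"
      by (intro has_integral_divide has_integral_powr_from_0) (use a t0 in auto)
    then have "(\<integral>\<^sup>+s. ennreal (indicator {0..t0} s * (s powr (-a) / t0)) \<partial>lborel) = ennreal ((t0 powr (-a + 1) / (-a + 1)) / t0)"
      by (rule nn_integral_has_integral_lebesgue[rotated]) (use t0 in auto)
    also have "(t0 powr (-a + 1) / (-a + 1)) / t0 = t0 powr (-a) / (1 - a)"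
      using t0 powr_add[of t0 "-a" 1] by simp
    finally show ?thesis .
  qed
  also have "(\<integral>\<^sup>+s. ennreal (indicator {t0..} s * s powr (-a-1)) \<partial>lborel) = ennreal (t0 powr (-a) / a)"
  proof -
    have "((\<lambda>s. s powr (-a-1)) has_integral - (t0 powr (-a-1 + 1)) / (-a-1 + 1)) {t0..}"
      by (intro has_integral_powr_to_inf) (use a t0 in auto)
    then have "(\<integral>\<^sup>+s. ennreal (indicator {t0..} s * s powr (-a-1)) \<partial>lborel) = ennreal (- (t0 powr (-a-1 + 1)) / (-a-1 + 1))"
      by (rule nn_integral_has_integral_lebesgue[rotated]) auto
    then show ?thesis by simp
  qed
  also have "ennreal (2 powr (a + 2)) * (ennreal (t0 powr (-a) / (1 - a)) + ennreal (t0 powr (-a) / a))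
     = ennreal (2 powr (a + 2) * (1 / (1 - a) + 1 / a) * t0 powr (-a))"
    using a by (simp add: ennreal_plus[symmetric] ennreal_mult[symmetric] algebra_simps del: ennreal_plus)
  finally show ?thesis by (simp add: mult_left_mono)
qed

section \<open>Moments of the weight and the power series of their reciprocals\<close>

definition inv_moment :: "nat \<Rightarrow> real" where
  "inv_moment n = 1 / moment \<omega> (2 * real n + 1)"

lemma moment_integrable: "0 \<le> x \<Longrightarrow> integrable lborel (\<lambda>r. indicator {0..<1} r * (r powr x * \<omega> r))"
proof (rule Bochner_Integration.integrable_bound[OF weight_integrable])
  assume "0 \<le> x"
  then show "AE r in lborel. norm (indicator {0..<1} r * (r powr x * \<omega> r)) \<le> norm (\<omega> r)"
    using weight_nonneg by (intro AE_I2) (auto simp: abs_mult powr_le1 mult_left_le_one_le split: split_indicator)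
qed measurable

lemma moment_ge:
  assumes "0 \<le> x" "0 \<le> c" "c < 1"
  shows "c powr x * hat c \<le> moment \<omega> x"
proof -
  have "c powr x * hat c = (\<integral>r. c powr x * (indicator {c..<1} r * \<omega> r) \<partial>lborel)"
    unfolding omega_hat_def set_lebesgue_integral_def by simp
  also have "\<dots> \<le> (\<integral>r. indicator {0..<1} r * (r powr x * \<omega> r) \<partial>lborel)"
  proof (intro integral_mono)
    show "integrable lborel (\<lambda>r. c powr x * (indicator {c..<1} r * \<omega> r))"
      by (intro integrable_mult_right hat_integrable) simp
    show "c powr x * (indicator {c..<1} r * \<omega> r) \<le> indicator {0..<1} r * (r powr x * \<omega> r)" for r
      using assms weight_nonneg[of r] by (auto simp: indicator_def intro!: mult_right_mono powr_mono2)
  qed (use assms moment_integrable in auto)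
  finally show ?thesis by (simp add: moment_def set_lebesgue_integral_def)
qed

lemma moment_pos: "0 \<le> x \<Longrightarrow> 0 < moment \<omega> x"
proof -
  assume "0 \<le> x"
  have "0 < (1/2) powr x * hat (1/2)" using hat_pos[of "1/2"] by simp
  also have "\<dots> \<le> moment \<omega> x" using \<open>0 \<le> x\<close> by (intro moment_ge) auto
  finally show ?thesis .
qed

lemma moment_antimono:
  assumes "0 \<le> x" "x \<le> y" shows "moment \<omega> y \<le> moment \<omega> x"
  unfolding moment_def set_lebesgue_integral_def real_scaleR_def
proof (intro integral_mono moment_integrable)
  show "indicator {0..<1} r * (r powr y * \<omega> r) \<le> indicator {0..<1} r * (r powr x * \<omega> r)" for r
    using assms weight_nonneg[of r] by (auto simp: indicator_def intro!: mult_right_mono powr_mono')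
qed (use assms in auto)

lemma inv_moment_nonneg: "0 \<le> inv_moment n"
  using moment_pos[of "2 * real n + 1"] by (simp add: inv_moment_def)

lemma incseq_inv_moment: "incseq inv_moment"
  unfolding inv_moment_def
  by (intro incseq_SucI divide_left_mono moment_antimono mult_pos_pos moment_pos) auto

text \<open>The moments are bounded below through the tail at \<open>x = 1 - (1 - s) / 4\<close>; since
  \<open>x\<^sup>2 \<ge> (1 + s) / 2\<close> this costs two doublings and leaves a geometric series.\<close>
lemma inv_moment_series:
  assumes s: "0 \<le> s" "s < 1"
  shows "summable (\<lambda>n. inv_moment n * s ^ n)"
    and "(1 - s) * (\<Sum>n. inv_moment n * s ^ n) \<le> 2 * D\<^sup>2 / hat s"
proof -
  define x where "x = (3 + s) / 4"
  have x: "0 < x" "x < 1" using s by (auto simp: x_def)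
  have hs: "0 < hat s" "0 < hat x" using s x hat_pos by auto
  have "hat s \<le> D * hat ((1 + s) / 2)" using doubling s by simp
  also have "\<dots> \<le> D * (D * hat ((1 + (1 + s) / 2) / 2))"
    using s D_pos by (intro mult_left_mono doubling) auto
  also have "(1 + (1 + s) / 2) / 2 = x" by (simp add: x_def field_simps)
  finally have hx: "hat s \<le> D\<^sup>2 * hat x" by (simp add: power2_eq_square)
  have "x\<^sup>2 - (1 + s) / 2 = (1 - s)\<^sup>2 / 16" by (simp add: x_def power2_eq_square field_simps)
  then have x2: "(1 + s) / 2 \<le> x\<^sup>2" by (smt (verit) zero_le_power2 divide_nonneg_pos)
  define t where "t = s / x\<^sup>2"
  have t: "0 \<le> t" "t < 1" using s x x2 by (auto simp: t_def field_simps)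
  have tm: "inv_moment n * s ^ n \<le> D\<^sup>2 / hat s / x * t ^ n" for n
  proof -
    have "x powr (2 * real n + 1) = x powr real (2 * n + 1)" by (simp add: add.commute)
    also have "\<dots> = x ^ (2 * n + 1)" by (rule powr_realpow[OF x(1)])
    finally have "x powr (2 * real n + 1) = (x\<^sup>2) ^ n * x" by (simp add: power_mult)
    then have mg: "(x\<^sup>2) ^ n * x * hat x \<le> moment \<omega> (2 * real n + 1)"
      using moment_ge[of "2 * real n + 1" x] x by simp
    have "inv_moment n \<le> 1 / ((x\<^sup>2) ^ n * x * hat x)"
      unfolding inv_moment_def using mg x hs by (intro divide_left_mono) (auto intro!: mult_pos_pos moment_pos)
    also have "\<dots> \<le> D\<^sup>2 / hat s / x / (x\<^sup>2) ^ n"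
      using hx x hs by (simp add: field_simps)
    finally have "inv_moment n * s ^ n \<le> D\<^sup>2 / hat s / x / (x\<^sup>2) ^ n * s ^ n"
      using s by (intro mult_right_mono) auto
    then show ?thesis by (simp add: t_def power_divide)
  qed
  have geo: "summable (\<lambda>n. D\<^sup>2 / hat s / x * t ^ n)" using t by (intro summable_mult summable_geometric) auto
  show sm: "summable (\<lambda>n. inv_moment n * s ^ n)"
    by (rule summable_comparison_test'[OF geo]) (use tm inv_moment_nonneg s in auto)
  have "(\<Sum>n. inv_moment n * s ^ n) \<le> (\<Sum>n. D\<^sup>2 / hat s / x * t ^ n)"
    by (rule suminf_le[OF tm sm geo])
  also have "\<dots> = D\<^sup>2 / hat s / x * (1 / (1 - t))"
    using t by (subst suminf_mult) (auto simp: suminf_geometric)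
  finally have "(1 - s) * (\<Sum>n. inv_moment n * s ^ n) \<le> (1 - s) * (D\<^sup>2 / hat s / x * (1 / (1 - t)))"
    using s by (intro mult_left_mono) auto
  also have "\<dots> = D\<^sup>2 / hat s * ((1 - s) / (x * (1 - t)))" using x by (simp add: field_simps)
  \<comment> \<open>The choice of \<open>x\<close> gives
    \<open>x\<^sup>2 - s \<ge> (1 - s) / 2\<close>, so the prefactor \<open>1 - s\<close> cancels
    the geometric sum up to the factor 2.\<close>
  also have "(1 - s) / (x * (1 - t)) \<le> 2"
  proof -
    have "x * (1 - t) = (x\<^sup>2 - s) / x" using x by (simp add: t_def field_simps power2_eq_square)
    also have "\<dots> \<ge> (x\<^sup>2 - s) / 1" using x x2 s by (intro divide_left_mono) auto
    finally have "(1 - s) / 2 \<le> x * (1 - t)" using x2 by (simp add: field_simps)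
    then show ?thesis using x t by (simp add: divide_le_eq)
  qed
  then have "D\<^sup>2 / hat s * ((1 - s) / (x * (1 - t))) \<le> D\<^sup>2 / hat s * 2"
    using hs by (intro mult_left_mono) auto
  finally show "(1 - s) * (\<Sum>n. inv_moment n * s ^ n) \<le> 2 * D\<^sup>2 / hat s" by (simp add: mult.commute)
qed

end

section \<open>Schur test\<close>

lemma power_kernel_measurable [measurable (raw)]:
  assumes [measurable]: "g \<in> borel_measurable M"
  shows "(\<lambda>x. power_kernel m (g x)) \<in> borel_measurable M"
  unfolding power_kernel_def by measurable

lemma norm_power_kernel_le:
  assumes "summable (\<lambda>n. m n * s ^ n)" "\<And>n. 0 \<le> (m n :: real)" "cmod w \<le> s"
  shows "cmod (power_kernel m w) \<le> (\<Sum>n. m n * s ^ n)"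
proof -
  note su = summable_power_norm[OF assms]
  have "cmod (power_kernel m w) \<le> (\<Sum>n. cmod (of_real (m n) * w ^ n))"
    unfolding power_kernel_def by (rule summable_norm[OF su])
  also have "\<dots> \<le> (\<Sum>n. m n * s ^ n)"
    by (rule suminf_le[OF _ su assms(1)])
      (use assms(2,3) in \<open>auto simp: norm_mult norm_power intro!: mult_left_mono power_mono\<close>)
  finally show ?thesis .
qed

context dhat_weight
begin

section \<open>The radial measure of the norm and the Hardy type operator\<close>

definition R :: "real measure" where "R = density lborel (\<lambda>\<rho>. ennreal (\<rho> * \<omega> \<rho>))"

lemma sets_R [simp, measurable_cong]: "sets R = sets borel" by (simp add: R_def)
lemma space_R [simp]: "space R = UNIV" by (simp add: R_def)

lemma AE_R: "AE \<rho> in R. \<rho> \<in> {0..<1}"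
proof -
  have "0 < \<rho> * \<omega> \<rho> \<longrightarrow> \<rho> \<in> {0..<1}" for \<rho> using weight_outside[of \<rho>] by (cases "\<rho> \<in> {0..<1}") auto
  then show ?thesis unfolding R_def by (subst AE_density) auto
qed

lemma nn_integral_R_le:
  assumes [measurable]: "f \<in> borel_measurable borel"
  shows "(\<integral>\<^sup>+\<rho>. f \<rho> \<partial>R) \<le> (\<integral>\<^sup>+\<rho>. f \<rho> \<partial>\<nu>)"
proof -
  have "\<rho> * \<omega> \<rho> \<le> \<omega> \<rho>" for \<rho>
    using weight_outside[of \<rho>] weight_nonneg[of \<rho>] by (cases "\<rho> \<in> {0..<1}") (auto intro: mult_left_le_one_le)
  then have "(\<integral>\<^sup>+\<rho>. ennreal (\<rho> * \<omega> \<rho>) * f \<rho> \<partial>lborel) \<le> (\<integral>\<^sup>+\<rho>. ennreal (\<omega> \<rho>) * f \<rho> \<partial>lborel)"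
    by (intro nn_integral_mono mult_right_mono ennreal_leI) auto
  then show ?thesis unfolding R_def \<nu>_def by (simp add: nn_integral_density)
qed

sublocale R: finite_measure R
proof
  have "emeasure R UNIV = (\<integral>\<^sup>+\<rho>. 1 \<partial>R)" by simp
  also have "\<dots> \<le> (\<integral>\<^sup>+\<rho>. 1 \<partial>\<nu>)" by (rule nn_integral_R_le) simp
  finally have "emeasure R UNIV \<le> emeasure \<nu> UNIV" by simp
  then show "emeasure R (space R) \<noteq> \<infinity>" by (auto simp: top_unique)
qed

lemma pair_R_R: "pair_sigma_finite R R" ..
lemma pair_R_circ: "pair_sigma_finite R circ" ..

definition schur_const :: "real \<Rightarrow> real" where
  "schur_const a = 2 powr (a + 2) * (1 / (1 - a) + 1 / a)"

text \<open>By monotonicity \<open>max (hat r) (hat \<rho>)\<close> is \<open>hat\<close> at the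
  smaller radius. In the variable \<open>hat \<rho>\<close> this is the Hardy kernel
  \<open>1 / max s t\<close>, homogeneous of degree -1, so powers with exponent strictly between -1
  and 0 are reproduced up to a constant.\<close>

lemma schur_row:
  assumes a: "0 < a" "a < 1" and r: "r < 1"
  shows "(\<integral>\<^sup>+\<rho>. ennreal (1 / max (hat r) (hat \<rho>)) * ennreal (hat \<rho> powr (-a)) \<partial>R)
    \<le> ennreal (schur_const a * hat r powr (-a))"
proof -
  have "(\<integral>\<^sup>+\<rho>. ennreal (1 / max (hat r) (hat \<rho>)) * ennreal (hat \<rho> powr (-a)) \<partial>R)
      = (\<integral>\<^sup>+\<rho>. ennreal (hat \<rho> powr (-a) / max (hat r) (hat \<rho>)) \<partial>R)"
    using hat_nonneg by (intro nn_integral_cong) (simp add: ennreal_mult[symmetric] le_max_iff_disj)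
  also have "\<dots> \<le> (\<integral>\<^sup>+\<rho>. ennreal (hat \<rho> powr (-a) / max (hat r) (hat \<rho>)) \<partial>\<nu>)"
    by (rule nn_integral_R_le) measurable
  also have "\<dots> \<le> ennreal (schur_const a * hat r powr (-a))"
    unfolding schur_const_def by (rule nn_integral_hat_power_kernel[OF a hat_pos[OF r]])
  finally show ?thesis .
qed

text \<open>Jensen with the weight \<open>k r \<rho> * u (-a) \<rho>\<close> leaves the power
  \<open>a * (q - 1)\<close> of \<open>hat\<close> in both variables, with opposite signs. For
  \<open>a = 1 / q\<close> this is \<open>b = 1 - 1 / q\<close>, again strictly between 0 and 1, so
  after Tonelli the symmetry of the kernel lets \<open>schur_row\<close> handle the other variable
  as well.\<close>

lemma schur_test:
  fixes g :: "real \<Rightarrow> ennreal"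
  assumes [measurable]: "g \<in> borel_measurable borel" and q: "1 < q"
  shows "(\<integral>\<^sup>+r. enn_powr (\<integral>\<^sup>+\<rho>. ennreal (1 / max (hat r) (hat \<rho>)) * g \<rho> \<partial>R) q \<partial>R)
    \<le> ennreal (schur_const (1 / q) powr (q - 1) * schur_const (1 - 1 / q)) * (\<integral>\<^sup>+\<rho>. enn_powr (g \<rho>) q \<partial>R)"
proof -
  interpret P: pair_sigma_finite R R by (rule pair_R_R)
  define a where "a = 1 / q"
  define b where "b = 1 - 1 / q"
  have ab: "0 < a" "a < 1" "0 < b" "b < 1" "a * (q - 1) = b" "a * q = 1" "1 - a = b"
    using q by (auto simp: a_def b_def field_simps)
  have sc: "0 \<le> schur_const a" "0 \<le> schur_const b" using ab by (auto simp: schur_const_def)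
  define k where "k = (\<lambda>r \<rho>. ennreal (1 / max (hat r) (hat \<rho>)))"
  have [measurable]: "(\<lambda>(r, \<rho>). k r \<rho>) \<in> borel_measurable (borel \<Otimes>\<^sub>M borel)" unfolding k_def by measurable
  have k_sym: "k r \<rho> = k \<rho> r" for r \<rho> by (simp add: k_def max.commute)
  define u where "u = (\<lambda>c \<rho>. ennreal (hat \<rho> powr c))"
  have [measurable]: "u c \<in> borel_measurable borel" for c unfolding u_def by measurable
  have uu: "u c \<rho> * u d \<rho> = u (c + d) \<rho>" for c d \<rho> by (simp add: u_def ennreal_mult[symmetric] powr_add)
  have step: "enn_powr (\<integral>\<^sup>+\<rho>. k r \<rho> * g \<rho> \<partial>R) q
      \<le> ennreal (schur_const a powr (q - 1)) * (\<integral>\<^sup>+\<rho>. u (-b) r * (enn_powr (g \<rho>) q * k r \<rho> * u b \<rho>) \<partial>R)"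
    if r: "r < 1" for r
  proof -
    have "(\<integral>\<^sup>+\<rho>. k r \<rho> * g \<rho> \<partial>R) = (\<integral>\<^sup>+\<rho>. (g \<rho> * u a \<rho>) * (k r \<rho> * u (-a) \<rho>) \<partial>R)"
    proof (rule nn_integral_cong_AE)
      show "AE \<rho> in R. k r \<rho> * g \<rho> = (g \<rho> * u a \<rho>) * (k r \<rho> * u (-a) \<rho>)"
        using AE_R
      proof eventually_elim
        case (elim \<rho>)
        have "(g \<rho> * u a \<rho>) * (k r \<rho> * u (-a) \<rho>) = k r \<rho> * g \<rho> * (u a \<rho> * u (-a) \<rho>)" by (simp add: mult_ac)
        also have "u a \<rho> * u (-a) \<rho> = 1" using elim hat_pos[of \<rho>] by (subst uu) (simp add: u_def)
        finally show ?case by simp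
      qed
    qed
    then have "enn_powr (\<integral>\<^sup>+\<rho>. k r \<rho> * g \<rho> \<partial>R) q
        \<le> enn_powr (\<integral>\<^sup>+\<rho>. k r \<rho> * u (-a) \<rho> \<partial>R) (q - 1)
          * (\<integral>\<^sup>+\<rho>. enn_powr (g \<rho> * u a \<rho>) q * (k r \<rho> * u (-a) \<rho>) \<partial>R)"
      using nn_integral_weighted_jensen[of "\<lambda>\<rho>. g \<rho> * u a \<rho>" R "\<lambda>\<rho>. k r \<rho> * u (-a) \<rho>" q] q by simp
    also have "(\<integral>\<^sup>+\<rho>. enn_powr (g \<rho> * u a \<rho>) q * (k r \<rho> * u (-a) \<rho>) \<partial>R)
        = (\<integral>\<^sup>+\<rho>. enn_powr (g \<rho>) q * k r \<rho> * u b \<rho> \<partial>R)"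
    proof (intro nn_integral_cong)
      fix \<rho>
      have "enn_powr (u a \<rho>) q = u 1 \<rho>" by (simp add: u_def enn_powr_ennreal powr_powr ab)
      then have "enn_powr (g \<rho> * u a \<rho>) q * (k r \<rho> * u (-a) \<rho>) = enn_powr (g \<rho>) q * k r \<rho> * (u 1 \<rho> * u (-a) \<rho>)"
        by (simp add: enn_powr_mult mult_ac)
      then show "enn_powr (g \<rho> * u a \<rho>) q * (k r \<rho> * u (-a) \<rho>) = enn_powr (g \<rho>) q * k r \<rho> * u b \<rho>"
        using ab by (simp add: uu)
    qed
    also have "enn_powr (\<integral>\<^sup>+\<rho>. k r \<rho> * u (-a) \<rho> \<partial>R) (q - 1) \<le> enn_powr (ennreal (schur_const a * hat r powr (-a))) (q - 1)"
      using schur_row[OF ab(1,2) r] q unfolding k_def u_def by (intro enn_powr_mono) auto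
    also have "\<dots> = ennreal (schur_const a powr (q - 1)) * u (-b) r"
    proof -
      have "enn_powr (ennreal (schur_const a * hat r powr (-a))) (q - 1)
          = ennreal ((schur_const a * hat r powr (-a)) powr (q - 1))"
        using sc by (intro enn_powr_ennreal) simp
      also have "(schur_const a * hat r powr (-a)) powr (q - 1) = schur_const a powr (q - 1) * hat r powr (-b)"
        using sc ab by (simp add: powr_mult powr_powr)
      finally show ?thesis by (simp add: u_def ennreal_mult)
    qed
    finally have "enn_powr (\<integral>\<^sup>+\<rho>. k r \<rho> * g \<rho> \<partial>R) q
        \<le> ennreal (schur_const a powr (q - 1)) * u (-b) r * (\<integral>\<^sup>+\<rho>. enn_powr (g \<rho>) q * k r \<rho> * u b \<rho> \<partial>R)"
      by (simp add: mult_right_mono)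
    then show ?thesis by (simp add: nn_integral_cmult mult.assoc)
  qed
  have "(\<integral>\<^sup>+r. enn_powr (\<integral>\<^sup>+\<rho>. k r \<rho> * g \<rho> \<partial>R) q \<partial>R)
      \<le> (\<integral>\<^sup>+r. ennreal (schur_const a powr (q - 1)) * (\<integral>\<^sup>+\<rho>. u (-b) r * (enn_powr (g \<rho>) q * k r \<rho> * u b \<rho>) \<partial>R) \<partial>R)"
  proof (rule nn_integral_mono_AE)
    show "AE r in R. enn_powr (\<integral>\<^sup>+\<rho>. k r \<rho> * g \<rho> \<partial>R) q
      \<le> ennreal (schur_const a powr (q - 1)) * (\<integral>\<^sup>+\<rho>. u (-b) r * (enn_powr (g \<rho>) q * k r \<rho> * u b \<rho>) \<partial>R)"
      using AE_R by eventually_elim (rule step, simp)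
  qed
  also have "\<dots> = ennreal (schur_const a powr (q - 1)) * (\<integral>\<^sup>+r. \<integral>\<^sup>+\<rho>. u (-b) r * (enn_powr (g \<rho>) q * k r \<rho> * u b \<rho>) \<partial>R \<partial>R)"
    by (rule nn_integral_cmult) measurable
  also have "(\<integral>\<^sup>+r. \<integral>\<^sup>+\<rho>. u (-b) r * (enn_powr (g \<rho>) q * k r \<rho> * u b \<rho>) \<partial>R \<partial>R)
      = (\<integral>\<^sup>+\<rho>. \<integral>\<^sup>+r. u (-b) r * (enn_powr (g \<rho>) q * k r \<rho> * u b \<rho>) \<partial>R \<partial>R)"
    by (rule P.Fubini') measurable
  also have "\<dots> \<le> (\<integral>\<^sup>+\<rho>. ennreal (schur_const b) * enn_powr (g \<rho>) q \<partial>R)"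
  proof (rule nn_integral_mono_AE)
    show "AE \<rho> in R. (\<integral>\<^sup>+r. u (-b) r * (enn_powr (g \<rho>) q * k r \<rho> * u b \<rho>) \<partial>R)
        \<le> ennreal (schur_const b) * enn_powr (g \<rho>) q"
      using AE_R
    proof eventually_elim
      case (elim \<rho>)
      have "(\<integral>\<^sup>+r. u (-b) r * (enn_powr (g \<rho>) q * k r \<rho> * u b \<rho>) \<partial>R)
          = (\<integral>\<^sup>+r. (enn_powr (g \<rho>) q * u b \<rho>) * (k \<rho> r * u (-b) r) \<partial>R)"
        by (intro nn_integral_cong) (simp add: mult_ac k_sym)
      also have "\<dots> = enn_powr (g \<rho>) q * u b \<rho> * (\<integral>\<^sup>+r. k \<rho> r * u (-b) r \<partial>R)"
        by (rule nn_integral_cmult) measurable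
      also have "\<dots> \<le> enn_powr (g \<rho>) q * u b \<rho> * (ennreal (schur_const b) * u (-b) \<rho>)"
        using schur_row[OF ab(3,4), of \<rho>] elim sc unfolding k_def u_def
        by (intro mult_left_mono) (auto simp: ennreal_mult)
      also have "\<dots> = ennreal (schur_const b) * enn_powr (g \<rho>) q * (u b \<rho> * u (-b) \<rho>)" by (simp add: mult_ac)
      also have "u b \<rho> * u (-b) \<rho> = 1" using elim hat_pos[of \<rho>] by (subst uu) (simp add: u_def)
      finally show ?case by simp
    qed
  qed
  also have "(\<integral>\<^sup>+\<rho>. ennreal (schur_const b) * enn_powr (g \<rho>) q \<partial>R) = ennreal (schur_const b) * (\<integral>\<^sup>+\<rho>. enn_powr (g \<rho>) q \<partial>R)"
    by (rule nn_integral_cmult) measurable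
  finally show ?thesis
    unfolding k_def a_def[symmetric] b_def[symmetric] using sc by (simp add: ennreal_mult mult.assoc mult_left_mono ab)
qed

text \<open>The factor \<open>1 / (2 * pi)\<close> combines the \<open>1 / pi\<close> of normalised
  area with the \<open>1 / 2\<close> in the coefficients of the Bergman kernel. In polar coordinates
  it cancels, and the measure becomes the plain product of \<open>R\<close> and
  \<open>circ\<close>.\<close>

definition \<mu> :: "complex measure" where
  "\<mu> = density lborel (\<lambda>\<zeta>. ennreal (\<omega> (cmod \<zeta>) / (2 * pi)))"

lemma \<mu>_polar: "\<mu> = distr (R \<Otimes>\<^sub>M circ) borel (\<lambda>(\<rho>, \<theta>). of_real \<rho> * cis \<theta>)"
proof (rule measure_eqI)
  show "sets \<mu> = sets (distr (R \<Otimes>\<^sub>M circ) borel (\<lambda>(\<rho>, \<theta>). of_real \<rho> * cis \<theta>))" by (simp add: \<mu>_def)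
  fix A assume "A \<in> sets \<mu>"
  then have [measurable]: "A \<in> sets borel" by (simp add: \<mu>_def)
  have "emeasure \<mu> A = (\<integral>\<^sup>+\<zeta>. ennreal (\<omega> (cmod \<zeta>) / (2 * pi)) * indicator A \<zeta> \<partial>lborel)"
    unfolding \<mu>_def by (subst emeasure_density) auto
  also have "\<dots> = (\<integral>\<^sup>+\<rho>\<in>{0..}. ennreal (2 * pi * \<rho>) * (\<integral>\<^sup>+\<theta>. ennreal (\<omega> (cmod (of_real \<rho> * cis \<theta>)) / (2 * pi)) * indicator A (of_real \<rho> * cis \<theta>) \<partial>circ) \<partial>lborel)"
    by (rule nn_integral_polar) measurable
  also have "\<dots> = (\<integral>\<^sup>+\<rho>. ennreal (\<rho> * \<omega> \<rho>) * (\<integral>\<^sup>+\<theta>. indicator A (of_real \<rho> * cis \<theta>) \<partial>circ) \<partial>lborel)"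
  proof (intro nn_integral_cong)
    fix \<rho> :: real
    show "ennreal (2 * pi * \<rho>) * (\<integral>\<^sup>+\<theta>. ennreal (\<omega> (cmod (of_real \<rho> * cis \<theta>)) / (2 * pi)) * indicator A (of_real \<rho> * cis \<theta>) \<partial>circ) * indicator {0..} \<rho>
      = ennreal (\<rho> * \<omega> \<rho>) * (\<integral>\<^sup>+\<theta>. indicator A (of_real \<rho> * cis \<theta>) \<partial>circ)"
    proof (cases "0 \<le> \<rho>")
      case True
      have "ennreal (2 * pi * \<rho>) * ennreal (\<omega> \<rho> / (2 * pi)) = ennreal (\<rho> * \<omega> \<rho>)"
        using True weight_nonneg[of \<rho>] by (subst ennreal_mult[symmetric]) auto
      then show ?thesis using True by (simp add: nn_integral_cmult flip: mult.assoc)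
    next
      case False
      then show ?thesis using weight_outside[of \<rho>] by simp
    qed
  qed
  also have "\<dots> = (\<integral>\<^sup>+\<rho>. \<integral>\<^sup>+\<theta>. indicator A (of_real \<rho> * cis \<theta>) \<partial>circ \<partial>R)"
    unfolding R_def by (subst nn_integral_density) auto
  also have "\<dots> = (\<integral>\<^sup>+x. indicator A (case x of (\<rho>, \<theta>) \<Rightarrow> of_real \<rho> * cis \<theta>) \<partial>(R \<Otimes>\<^sub>M circ))"
    by (subst circ.nn_integral_fst[symmetric]) auto
  also have "\<dots> = emeasure (distr (R \<Otimes>\<^sub>M circ) borel (\<lambda>(\<rho>, \<theta>). of_real \<rho> * cis \<theta>)) A"
    by (subst nn_integral_distr[symmetric, where f = "indicator A" and M' = borel]) auto
  finally show "emeasure \<mu> A = emeasure (distr (R \<Otimes>\<^sub>M circ) borel (\<lambda>(\<rho>, \<theta>). of_real \<rho> * cis \<theta>)) A" .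
qed

end

section \<open>The projection in polar coordinates\<close>

context dhat_weight
begin

definition project :: "(complex \<Rightarrow> complex) \<Rightarrow> complex \<Rightarrow> complex" where
  "project f z = (\<integral>\<zeta>. f \<zeta> * power_kernel inv_moment (z * cnj \<zeta>) \<partial>\<mu>)"

section \<open>Integral means and integrability\<close>

definition mean_powr :: "real \<Rightarrow> (complex \<Rightarrow> complex) \<Rightarrow> real \<Rightarrow> ennreal" where
  "mean_powr p f r = (\<integral>\<^sup>+\<theta>. ennreal (cmod (f (of_real r * cis \<theta>)) powr p) \<partial>circ)"

lemma mean_powr_measurable [measurable]:
  assumes [measurable]: "f \<in> borel_measurable borel"
  shows "mean_powr p f \<in> borel_measurable borel"
  unfolding mean_powr_def by measurable

lemma mean_le_mean_powr:
  assumes [measurable]: "f \<in> borel_measurable borel" and p: "1 < p"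
  shows "enn_powr (\<integral>\<^sup>+\<theta>. ennreal (cmod (f (of_real r * cis \<theta>))) \<partial>circ) p \<le> mean_powr p f r"
  using nn_integral_weighted_jensen[of "\<lambda>\<theta>. ennreal (cmod (f (of_real r * cis \<theta>)))" circ "\<lambda>_. 1" p] p
    enn_powr_ennreal[of 1 "p - 1"]
  by (simp add: enn_powr_ennreal mean_powr_def)

lemma mean_integrable:
  assumes [measurable]: "f \<in> borel_measurable borel" and p: "1 < p"
    and fin: "mean_powr p f r < top"
  shows "integrable circ (\<lambda>\<theta>. f (of_real r * cis \<theta>))"
proof (rule integrableI_bounded)
  have "enn_powr (\<integral>\<^sup>+\<theta>. ennreal (cmod (f (of_real r * cis \<theta>))) \<partial>circ) p < top"
    using mean_le_mean_powr[OF assms(1) p] fin by (rule le_less_trans)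
  then show "(\<integral>\<^sup>+\<theta>. ennreal (cmod (f (of_real r * cis \<theta>))) \<partial>circ) < \<infinity>" by simp
qed measurable

text \<open>The mixed norm space embeds into the integrable functions, so the integral defining the
  projection exists: Jensen compares the mean modulus on each circle with the mean of exponent
  \<open>p\<close>, and \<open>x \<le> 1 + x powr q\<close> together with the finite mass of
  \<open>R\<close> handles the radius.\<close>

lemma integrable_\<mu>:
  assumes [measurable]: "f \<in> borel_measurable borel" and p: "1 < p" and q: "1 < q"
    and fin: "(\<integral>\<^sup>+r. enn_powr (mean_powr p f r) (q / p) \<partial>R) < top"
  shows "integrable \<mu> f"
proof (rule integrableI_bounded)
  show "f \<in> borel_measurable \<mu>" by (simp add: \<mu>_def)
  have "(\<integral>\<^sup>+\<zeta>. ennreal (cmod (f \<zeta>)) \<partial>\<mu>) = (\<integral>\<^sup>+r. \<integral>\<^sup>+\<theta>. ennreal (cmod (f (of_real r * cis \<theta>))) \<partial>circ \<partial>R)"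
    unfolding \<mu>_polar by (subst nn_integral_distr) (auto simp: case_prod_beta circ.nn_integral_fst[symmetric])
  also have "\<dots> \<le> (\<integral>\<^sup>+r. 1 + enn_powr (mean_powr p f r) (q / p) \<partial>R)"
  proof (rule nn_integral_mono)
    fix r
    define A where "A = (\<integral>\<^sup>+\<theta>. ennreal (cmod (f (of_real r * cis \<theta>))) \<partial>circ)"
    have "A \<le> 1 + enn_powr A q"
    proof (cases A)
      case (real x)
      have "x \<le> 1 + x powr q"
      proof (cases "x \<le> 1")
        case False
        then have "x powr 1 \<le> x powr q" using q by (intro powr_mono) auto
        then show ?thesis using False by simp
      qed (simp add: add_increasing2)
      then show ?thesis
        using real by (simp add: enn_powr_ennreal ennreal_plus[symmetric] ennreal_leI flip: ennreal_1 del: ennreal_plus)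
    qed simp
    also have "enn_powr A q = enn_powr (enn_powr A p) (q / p)" using p by (simp add: enn_powr_powr)
    also have "\<dots> \<le> enn_powr (mean_powr p f r) (q / p)"
      using mean_le_mean_powr[OF assms(1) p, of r] p q unfolding A_def by (intro enn_powr_mono) auto
    finally show "A \<le> 1 + enn_powr (mean_powr p f r) (q / p)" by (simp add: add_left_mono)
  qed
  also have "\<dots> = emeasure R UNIV + (\<integral>\<^sup>+r. enn_powr (mean_powr p f r) (q / p) \<partial>R)"
    by (subst nn_integral_add) auto
  also have "\<dots> < \<infinity>" using fin by (simp add: R.emeasure_finite less_top[symmetric])
  finally show "(\<integral>\<^sup>+\<zeta>. ennreal (cmod (f \<zeta>)) \<partial>\<mu>) < \<infinity>" .
qed

lemma AE_\<mu>: "AE \<zeta> in \<mu>. cmod \<zeta> < 1"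
proof -
  have "0 < \<omega> (cmod \<zeta>) \<longrightarrow> cmod \<zeta> < 1" for \<zeta> using weight_outside[of "cmod \<zeta>"] by (cases "cmod \<zeta> < 1") auto
  then show ?thesis unfolding \<mu>_def by (subst AE_density) (auto simp: zero_less_divide_iff)
qed

lemma project_integrable:
  assumes [measurable]: "f \<in> borel_measurable borel" and f: "integrable \<mu> f" and z: "cmod z < 1"
  shows "integrable \<mu> (\<lambda>\<zeta>. f \<zeta> * power_kernel inv_moment (z * cnj \<zeta>))"
proof (rule Bochner_Integration.integrable_bound)
  define b where "b = (\<Sum>n. inv_moment n * cmod z ^ n)"
  show "integrable \<mu> (\<lambda>\<zeta>. b *\<^sub>R f \<zeta>)" using f by simp
  have [measurable_cong]: "sets \<mu> = sets borel" by (simp add: \<mu>_def)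
  show "(\<lambda>\<zeta>. f \<zeta> * power_kernel inv_moment (z * cnj \<zeta>)) \<in> borel_measurable \<mu>" by measurable
  show "AE \<zeta> in \<mu>. norm (f \<zeta> * power_kernel inv_moment (z * cnj \<zeta>)) \<le> norm (b *\<^sub>R f \<zeta>)"
    using AE_\<mu>
  proof eventually_elim
    case (elim \<zeta>)
    have "cmod (z * cnj \<zeta>) \<le> cmod z" using elim by (simp add: norm_mult mult_left_le)
    then have "cmod (power_kernel inv_moment (z * cnj \<zeta>)) \<le> b"
      unfolding b_def using inv_moment_series(1)[of "cmod z"] z inv_moment_nonneg
      by (intro norm_power_kernel_le) auto
    then have "cmod (f \<zeta>) * cmod (power_kernel inv_moment (z * cnj \<zeta>)) \<le> cmod (f \<zeta>) * \<bar>b\<bar>"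
      by (intro mult_left_mono) auto
    then show ?case by (simp add: norm_mult mult.commute)
  qed
qed

text \<open>The contribution of the circle of radius \<rho> to the projection at radius
  \<open>r\<close>: an operator of the form treated in \<open>power_kernel_operator_bound\<close>,
  at radius \<open>r * \<rho>\<close>.\<close>

definition slice :: "(complex \<Rightarrow> complex) \<Rightarrow> real \<Rightarrow> real \<Rightarrow> real \<Rightarrow> complex" where
  "slice f r \<rho> \<theta> = (\<integral>\<phi>. f (of_real \<rho> * cis \<phi>) * power_kernel inv_moment (of_real (r * \<rho>) * cis \<theta> * cis (- \<phi>)) \<partial>circ)"

lemma slice_measurable [measurable]:
  assumes [measurable]: "f \<in> borel_measurable borel"
  shows "(\<lambda>(\<rho>, \<theta>). slice f r \<rho> \<theta>) \<in> borel_measurable (borel \<Otimes>\<^sub>M borel)"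
  unfolding slice_def by measurable

lemma norm_project_le:
  assumes [measurable]: "f \<in> borel_measurable borel" and f: "integrable \<mu> f" and r: "0 \<le> r" "r < 1"
  shows "ennreal (cmod (project f (of_real r * cis \<theta>))) \<le> (\<integral>\<^sup>+\<rho>. ennreal (cmod (slice f r \<rho> \<theta>)) \<partial>R)"
proof -
  interpret P: pair_sigma_finite R circ by (rule pair_R_circ)
  define z where "z = of_real r * cis \<theta>"
  define h where "h = (\<lambda>\<zeta>. f \<zeta> * power_kernel inv_moment (z * cnj \<zeta>))"
  have [measurable]: "h \<in> borel_measurable borel" unfolding h_def by measurable
  have int: "integrable \<mu> h"
    unfolding h_def by (rule project_integrable[OF assms(1) f]) (use r in \<open>simp add: z_def\<close>)
  have meas: "(\<lambda>(\<rho>, \<phi>). of_real \<rho> * cis \<phi>) \<in> R \<Otimes>\<^sub>M circ \<rightarrow>\<^sub>M borel" by measurable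
  have int': "integrable (R \<Otimes>\<^sub>M circ) (\<lambda>x. h (case x of (\<rho>, \<phi>) \<Rightarrow> of_real \<rho> * cis \<phi>))"
    using int unfolding \<mu>_polar by (subst (asm) integrable_distr_eq[OF meas]) auto
  have hs: "(\<integral>\<phi>. h (of_real \<rho> * cis \<phi>) \<partial>circ) = slice f r \<rho> \<theta>" for \<rho>
    unfolding slice_def h_def z_def by (intro Bochner_Integration.integral_cong) (simp_all add: cis_cnj mult_ac)
  have "project f z = (\<integral>x. h (case x of (\<rho>, \<phi>) \<Rightarrow> of_real \<rho> * cis \<phi>) \<partial>(R \<Otimes>\<^sub>M circ))"
    unfolding project_def h_def[symmetric] \<mu>_polar by (rule integral_distr[OF meas]) measurable
  also have "\<dots> = (\<integral>\<rho>. slice f r \<rho> \<theta> \<partial>R)"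
    using P.integral_fst'[OF int'] hs by simp
  finally have eq: "project f z = (\<integral>\<rho>. slice f r \<rho> \<theta> \<partial>R)" .
  have "integrable R (\<lambda>\<rho>. slice f r \<rho> \<theta>)"
    using P.integrable_fst'[OF int'] hs by simp
  then show ?thesis unfolding z_def[symmetric] eq by (rule integral_norm_bound_ennreal)
qed

lemma project_mean_powr_le:
  assumes [measurable]: "f \<in> borel_measurable borel" and f: "integrable \<mu> f" and r: "0 \<le> r" "r < 1"
    and p: "1 < p" and C: "0 < C"
    and riesz: "\<And>f s. integrable circ f \<Longrightarrow> 0 \<le> s \<Longrightarrow> s < 1 \<Longrightarrow>
      (\<integral>\<^sup>+\<theta>. ennreal (cmod (cauchy_transform f (of_real s * cis \<theta>)) powr p) \<partial>circ)
        \<le> ennreal C * (\<integral>\<^sup>+\<phi>. ennreal (cmod (f \<phi>) powr p) \<partial>circ)"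
  shows "mean_powr p (project f) r
    \<le> enn_powr (ennreal (C powr (1 / p) * (2 * D\<^sup>2)) *
        (\<integral>\<^sup>+\<rho>. ennreal (1 / max (hat r) (hat \<rho>)) * enn_powr (mean_powr p f \<rho>) (1 / p) \<partial>R)) p"
proof -
  interpret P: pair_sigma_finite R circ by (rule pair_R_circ)
  define c where "c = C powr (1 / p) * (2 * D\<^sup>2)"
  \<comment> \<open>Strict positivity matters where the mean of \<open>f\<close> is infinite: there
    \<open>K \<rho>\<close> has to be top, whereas \<open>0 * top = 0\<close>.\<close>
  have c: "0 < c" using C D_pos by (simp add: c_def)
  \<comment> \<open>Minkowski is stated with a bound for every \<rho>, not almost every one. Off
    [0,1) the slice is not controlled, but \<open>R\<close> has no mass there, so it can be cut
    off.\<close>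
  define H where "H = (\<lambda>\<rho> \<theta>. indicator {0..<1} \<rho> * ennreal (cmod (slice f r \<rho> \<theta>)))"
  define K where "K = (\<lambda>\<rho>. ennreal c * (ennreal (1 / max (hat r) (hat \<rho>)) * enn_powr (mean_powr p f \<rho>) (1 / p)))"
  have HK: "(\<integral>\<^sup>+\<theta>. enn_powr (H \<rho> \<theta>) p \<partial>circ) \<le> enn_powr (K \<rho>) p" for \<rho>
  proof (cases "\<rho> \<in> {0..<1}")
    case False
    then show ?thesis by (simp add: H_def)
  next
    case True
    define M where "M = max (hat r) (hat \<rho>)"
    have M: "0 < M" using hat_pos[of r] r by (simp add: M_def less_max_iff_disj)
    show ?thesis
    proof (cases "mean_powr p f \<rho> = top")
      case True
      then have "K \<rho> = top" using c M by (simp add: K_def M_def[symmetric] ennreal_mult_top)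
      then show ?thesis by simp
    next
      case False
      then have int: "integrable circ (\<lambda>\<phi>. f (of_real \<rho> * cis \<phi>))"
        by (intro mean_integrable[OF assms(1) p]) (simp add: less_top[symmetric])
      define s where "s = r * \<rho>"
      have s: "0 \<le> s" "s < 1" "s \<le> r" "s \<le> \<rho>"
        using r True by (auto simp: s_def mult_left_le mult_left_le_one_le mult_le_one intro: le_less_trans[OF mult_left_le])
      define \<delta> where "\<delta> = (1 - s) * (\<Sum>n. inv_moment n * s ^ n)"
      have "0 \<le> \<delta>" unfolding \<delta>_def using s inv_moment_nonneg inv_moment_series(1)[OF s(1,2)]
        by (intro mult_nonneg_nonneg suminf_nonneg) auto
      have "\<delta> \<le> 2 * D\<^sup>2 / hat s" unfolding \<delta>_def by (rule inv_moment_series(2)[OF s(1,2)])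
      \<comment> \<open>The product \<open>s = r * \<rho>\<close> is at most each of the two radii,
        so \<open>hat s\<close> is at least \<open>hat r\<close> and \<open>hat \<rho>\<close>. This
        replaces the product by a kernel symmetric in the radii.\<close>
      also have "\<dots> \<le> 2 * D\<^sup>2 / M"
        using M hat_antimono[OF s(3)] hat_antimono[OF s(4)] hat_pos[OF s(2)]
        by (intro divide_left_mono) (auto simp: M_def)
      finally have \<delta>: "\<delta> \<le> 2 * D\<^sup>2 / M" .
      have "(\<integral>\<^sup>+\<theta>. enn_powr (H \<rho> \<theta>) p \<partial>circ) = (\<integral>\<^sup>+\<theta>. ennreal (cmod (slice f r \<rho> \<theta>) powr p) \<partial>circ)"
        using True by (simp add: H_def enn_powr_ennreal)
      also have "\<dots> \<le> ennreal (C * \<delta> powr p) * mean_powr p f \<rho>"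
        unfolding slice_def s_def[symmetric] \<delta>_def mean_powr_def
        by (rule power_kernel_operator_bound[OF p _ _ int s(1,2) incseq_inv_moment inv_moment_nonneg inv_moment_series(1)[OF s(1,2)]])
          (use C s riesz in auto)
      also have "\<dots> \<le> ennreal (C * (2 * D\<^sup>2 / M) powr p) * mean_powr p f \<rho>"
        using C \<delta> \<open>0 \<le> \<delta>\<close> p by (intro mult_right_mono ennreal_leI mult_left_mono powr_mono2) auto
      also have "C * (2 * D\<^sup>2 / M) powr p = (c * (1 / M)) powr p"
      proof -
        have "(c * (1 / M)) powr p = (C powr (1 / p) * (2 * D\<^sup>2 / M)) powr p" by (simp add: c_def)
        also have "\<dots> = (C powr (1 / p)) powr p * (2 * D\<^sup>2 / M) powr p"
          by (rule powr_mult)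
        also have "(C powr (1 / p)) powr p = C" using C p by (simp add: powr_powr)
        finally show ?thesis by simp
      qed
      also have "ennreal ((c * (1 / M)) powr p) * mean_powr p f \<rho> = enn_powr (K \<rho>) p"
      proof -
        have "K \<rho> = ennreal (c * (1 / M)) * enn_powr (mean_powr p f \<rho>) (1 / p)"
          unfolding K_def M_def[symmetric] using c M by (subst ennreal_mult) (auto simp: mult.assoc)
        moreover have "enn_powr (ennreal (c * (1 / M))) p = ennreal ((c * (1 / M)) powr p)"
          using c M by (intro enn_powr_ennreal) simp
        ultimately show ?thesis using p by (simp only: enn_powr_mult enn_powr_powr) simp
      qed
      finally show ?thesis .
    qed
  qed
  have "mean_powr p (project f) r \<le> (\<integral>\<^sup>+\<theta>. enn_powr (\<integral>\<^sup>+\<rho>. H \<rho> \<theta> \<partial>R) p \<partial>circ)"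
    unfolding mean_powr_def
  proof (rule nn_integral_mono)
    fix \<theta>
    have "(\<integral>\<^sup>+\<rho>. ennreal (cmod (slice f r \<rho> \<theta>)) \<partial>R) = (\<integral>\<^sup>+\<rho>. H \<rho> \<theta> \<partial>R)"
      using AE_R by (intro nn_integral_cong_AE) (auto simp: H_def elim: eventually_mono)
    then have "ennreal (cmod (project f (of_real r * cis \<theta>))) \<le> (\<integral>\<^sup>+\<rho>. H \<rho> \<theta> \<partial>R)"
      using norm_project_le[OF assms(1) f r, of \<theta>] by simp
    then have "enn_powr (ennreal (cmod (project f (of_real r * cis \<theta>)))) p \<le> enn_powr (\<integral>\<^sup>+\<rho>. H \<rho> \<theta> \<partial>R) p"
      using p by (intro enn_powr_mono) auto
    then show "ennreal (cmod (project f (of_real r * cis \<theta>)) powr p) \<le> enn_powr (\<integral>\<^sup>+\<rho>. H \<rho> \<theta> \<partial>R) p"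
      by (simp add: enn_powr_ennreal)
  qed
  also have "\<dots> \<le> enn_powr (\<integral>\<^sup>+\<rho>. K \<rho> \<partial>R) p"
  proof (rule P.nn_integral_minkowski[OF _ _ p HK])
    show "(\<lambda>(\<rho>, \<theta>). H \<rho> \<theta>) \<in> borel_measurable (R \<Otimes>\<^sub>M circ)" unfolding H_def by measurable
    show "K \<in> borel_measurable R" unfolding K_def by measurable
  qed
  also have "(\<integral>\<^sup>+\<rho>. K \<rho> \<partial>R) = ennreal c *
      (\<integral>\<^sup>+\<rho>. ennreal (1 / max (hat r) (hat \<rho>)) * enn_powr (mean_powr p f \<rho>) (1 / p) \<partial>R)"
    unfolding K_def by (rule nn_integral_cmult) measurable
  finally show ?thesis unfolding c_def .
qed

lemma project_bounded:
  assumes p: "1 < p" and q: "1 < q"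
  obtains B where "0 \<le> B"
    "\<And>f. f \<in> borel_measurable borel \<Longrightarrow>
      (\<integral>\<^sup>+r. enn_powr (mean_powr p f r) (q / p) \<partial>R) < top \<Longrightarrow>
      (\<integral>\<^sup>+r. enn_powr (mean_powr p (project f) r) (q / p) \<partial>R)
        \<le> ennreal B * (\<integral>\<^sup>+r. enn_powr (mean_powr p f r) (q / p) \<partial>R)"
proof -
  obtain C where C: "0 \<le> C" "\<And>f s. integrable circ f \<Longrightarrow> 0 \<le> s \<Longrightarrow> s < 1 \<Longrightarrow>
      (\<integral>\<^sup>+\<theta>. ennreal (cmod (cauchy_transform f (of_real s * cis \<theta>)) powr p) \<partial>circ)
        \<le> ennreal C * (\<integral>\<^sup>+\<phi>. ennreal (cmod (f \<phi>) powr p) \<partial>circ)"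
    using cauchy_transform_riesz[OF p] by blast
  \<comment> \<open>The constant is raised to a strictly positive one, as
    \<open>project_mean_powr_le\<close> requires.\<close>
  have C': "(\<integral>\<^sup>+\<theta>. ennreal (cmod (cauchy_transform f (of_real s * cis \<theta>)) powr p) \<partial>circ)
        \<le> ennreal (C + 1) * (\<integral>\<^sup>+\<phi>. ennreal (cmod (f \<phi>) powr p) \<partial>circ)"
    if "integrable circ f" "0 \<le> s" "s < 1" for f s
    by (rule order_trans[OF C(2)[OF that]]) (intro mult_right_mono ennreal_leI, auto)
  define c where "c = (C + 1) powr (1 / p) * (2 * D\<^sup>2)"
  define S where "S = schur_const (1 / q) powr (q - 1) * schur_const (1 - 1 / q)"
  have c: "0 \<le> c" by (simp add: c_def)
  have S: "0 \<le> S" using q by (simp add: S_def schur_const_def field_simps)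
  show ?thesis
  proof (rule that[of "c powr q * S"])
    show "0 \<le> c powr q * S" using S by simp
    fix f :: "complex \<Rightarrow> complex"
    assume [measurable]: "f \<in> borel_measurable borel"
      and fin: "(\<integral>\<^sup>+r. enn_powr (mean_powr p f r) (q / p) \<partial>R) < top"
    have f: "integrable \<mu> f" by (rule integrable_\<mu>[OF _ p q fin]) measurable
    define g where "g = (\<lambda>\<rho>. enn_powr (mean_powr p f \<rho>) (1 / p))"
    have [measurable]: "g \<in> borel_measurable borel" unfolding g_def by measurable
    have "(\<integral>\<^sup>+r. enn_powr (mean_powr p (project f) r) (q / p) \<partial>R)
        \<le> (\<integral>\<^sup>+r. ennreal (c powr q) * enn_powr (\<integral>\<^sup>+\<rho>. ennreal (1 / max (hat r) (hat \<rho>)) * g \<rho> \<partial>R) q \<partial>R)"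
    proof (rule nn_integral_mono_AE)
      show "AE r in R. enn_powr (mean_powr p (project f) r) (q / p)
        \<le> ennreal (c powr q) * enn_powr (\<integral>\<^sup>+\<rho>. ennreal (1 / max (hat r) (hat \<rho>)) * g \<rho> \<partial>R) q"
        using AE_R
      proof eventually_elim
        case (elim r)
        let ?I = "\<integral>\<^sup>+\<rho>. ennreal (1 / max (hat r) (hat \<rho>)) * g \<rho> \<partial>R"
        have "mean_powr p (project f) r \<le> enn_powr (ennreal c * ?I) p"
          unfolding c_def g_def
          by (rule project_mean_powr_le[OF _ f _ _ p _ C']) (use elim C in auto)
        then have "enn_powr (mean_powr p (project f) r) (q / p) \<le> enn_powr (enn_powr (ennreal c * ?I) p) (q / p)"
          using p q by (intro enn_powr_mono) auto
        also have "\<dots> = enn_powr (ennreal c * ?I) q" using p by (simp add: enn_powr_powr)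
        also have "\<dots> = ennreal (c powr q) * enn_powr ?I q" using c by (simp add: enn_powr_mult enn_powr_ennreal)
        finally show ?case .
      qed
    qed
    also have "\<dots> = ennreal (c powr q) * (\<integral>\<^sup>+r. enn_powr (\<integral>\<^sup>+\<rho>. ennreal (1 / max (hat r) (hat \<rho>)) * g \<rho> \<partial>R) q \<partial>R)"
      by (rule nn_integral_cmult) measurable
    also have "\<dots> \<le> ennreal (c powr q) * (ennreal S * (\<integral>\<^sup>+\<rho>. enn_powr (g \<rho>) q \<partial>R))"
      unfolding S_def by (intro mult_left_mono schur_test q) auto
    also have "\<dots> = ennreal (c powr q * S) * (\<integral>\<^sup>+r. enn_powr (mean_powr p f r) (q / p) \<partial>R)"
      using S by (simp add: g_def enn_powr_powr ennreal_mult mult.assoc)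
    finally show "(\<integral>\<^sup>+r. enn_powr (mean_powr p (project f) r) (q / p) \<partial>R)
        \<le> ennreal (c powr q * S) * (\<integral>\<^sup>+r. enn_powr (mean_powr p f r) (q / p) \<partial>R)" .
  qed
qed

end

section \<open>Return to the Bergman projection\<close>

lemma cnj_bergman_kernel:
  assumes "\<And>s. 0 \<le> s \<Longrightarrow> s < 1 \<Longrightarrow> summable (\<lambda>n. m n * s ^ n)" "\<And>n. 0 \<le> m n"
    and m: "\<And>n. m n = 1 / moment \<omega> (2 * real n + 1)"
    and "cmod (z * cnj \<zeta>) < 1"
  shows "cnj (bergman_kernel \<omega> z \<zeta>) = power_kernel m (z * cnj \<zeta>) / 2"
proof -
  \<comment> \<open>Both kernels are defined through \<open>suminf\<close>, which has the intended
    meaning only for a convergent series; absolute convergence justifies conjugating term by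
    term.\<close>
  have "summable (\<lambda>n. cmod (of_real (m n) * (z * cnj \<zeta>) ^ n))"
    by (rule summable_power_norm[OF assms(1)]) (use assms in auto)
  then have "(\<lambda>n. of_real (m n) * (z * cnj \<zeta>) ^ n) sums power_kernel m (z * cnj \<zeta>)"
    unfolding power_kernel_def by (rule summable_sums[OF summable_norm_cancel])
  then have "(\<lambda>n. cnj (of_real (m n) * (z * cnj \<zeta>) ^ n) / 2) sums (cnj (power_kernel m (z * cnj \<zeta>)) / 2)"
    by (intro sums_divide sums_cnj[THEN iffD2])
  moreover have "cnj (of_real (m n) * (z * cnj \<zeta>) ^ n) / 2 = (cnj z * \<zeta>) ^ n / of_real (2 * moment \<omega> (2 * real n + 1))" for n
    by (simp add: m)
  ultimately have "(\<lambda>n. (cnj z * \<zeta>) ^ n / of_real (2 * moment \<omega> (2 * real n + 1))) sums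
      (cnj (power_kernel m (z * cnj \<zeta>)) / 2)" by (simp only:)
  then have "bergman_kernel \<omega> z \<zeta> = cnj (power_kernel m (z * cnj \<zeta>)) / 2"
    unfolding bergman_kernel_def by (rule sums_unique[symmetric])
  then show ?thesis by (simp only: complex_cnj_divide complex_cnj_cnj complex_cnj_numeral)
qed

theorem theorem1p2:
  fixes \<omega> :: "real \<Rightarrow> real" and p q :: real
  assumes "radial_weight \<omega>"
    and "\<forall>r\<in>{0..<1}. omega_hat \<omega> r > 0"
    and "Dhat \<omega>"
    and "1 < p" and "1 < q"
  shows "\<exists>C. \<forall>f\<in>Lpq \<omega> p q.
           (\<forall>z\<in>ball 0 1. set_integrable lborel (ball 0 1) (bergman_integrand \<omega> f z))
         \<and> bergman_proj \<omega> f \<in> Lpq \<omega> p q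
         \<and> Lpq_norm \<omega> p q (bergman_proj \<omega> f) \<le> C * Lpq_norm \<omega> p q f"
proof -
  \<comment> \<open>Nothing is known about \<omega> off [0,1), not even measurability on the line.
    The cut-off profile satisfies the requirements of \<open>dhat_weight\<close> and has the same
    moments, and the same tails at nonnegative points.\<close>
  define w where "w = (\<lambda>r. indicator {0..<1} r * \<omega> r)"
  have w_eq: "w r = \<omega> r" if "r \<in> {0..<1}" for r using that by (simp add: w_def)
  have w0: "0 \<le> w r" for r using assms(1) by (auto simp: w_def radial_weight_def indicator_def)
  have w_int: "integrable lborel w"
    using assms(1) by (simp add: radial_weight_def set_integrable_def w_def)
  have hat_w: "omega_hat w r = omega_hat \<omega> r" if "0 \<le> r" for r
    unfolding omega_hat_def set_lebesgue_integral_def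
    using that by (intro Bochner_Integration.integral_cong) (auto simp: w_def indicator_def)
  have moment_w: "moment w x = moment \<omega> x" for x
    unfolding moment_def set_lebesgue_integral_def
    by (intro Bochner_Integration.integral_cong) (auto simp: w_def indicator_def)
  obtain D where D: "0 < D" "\<And>r. r \<in> {0..<1} \<Longrightarrow> omega_hat \<omega> r \<le> D * omega_hat \<omega> ((1 + r) / 2)"
    using assms(3) by (auto simp: Dhat_def)
  \<comment> \<open>The locale asks for positive tails at negative points too; there the tail of
    \<open>w\<close> is constant because \<open>w\<close> vanishes.\<close>
  have hat_neg: "omega_hat w r = omega_hat w 0" if "r < 0" for r
    unfolding omega_hat_def set_lebesgue_integral_def
    using that by (intro Bochner_Integration.integral_cong) (auto simp: w_def indicator_def)
  interpret dhat_weight w D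
  proof
    show "w \<in> borel_measurable borel" using borel_measurable_integrable[OF w_int] by simp
    show "0 < omega_hat w r" if "r < 1" for r
      using assms(2) that hat_w hat_neg by (cases "0 \<le> r") auto
    show "omega_hat w r \<le> D * omega_hat w ((1 + r) / 2)" if "r \<in> {0..<1}" for r
      using D(2)[OF that] that by (simp add: hat_w)
  qed (use w0 w_int D in \<open>auto simp: w_def\<close>)
  have inv_moment: "inv_moment n = 1 / moment \<omega> (2 * real n + 1)" for n
    by (simp add: inv_moment_def moment_w)
  \<comment> \<open>\<open>g\<close> may be arbitrary outside the disc, while \<open>h\<close> is a
    Borel function on the plane that agrees with it inside. This serves both for the given function
    and for its projection.\<close>
  have norm_eq: "Lpq_norm_q \<omega> p q g = (\<integral>\<^sup>+r. enn_powr (mean_powr p h r) (q / p) \<partial>R)"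
    if [measurable]: "h \<in> borel_measurable borel" and gh: "\<And>z. cmod z < 1 \<Longrightarrow> g z = h z" for g h
  proof -
    have "Lpq_norm_q \<omega> p q g = (\<integral>\<^sup>+r. ennreal (r * w r) * enn_powr (mean_powr p h r) (q / p) \<partial>lborel)"
      unfolding Lpq_norm_q_def
    proof (intro nn_integral_cong)
      fix r :: real
      show "enn_powr (Mp p g r) (q / p) * ennreal (r * \<omega> r) * indicator {0..<1} r
          = ennreal (r * w r) * enn_powr (mean_powr p h r) (q / p)"
      proof (cases "r \<in> {0..<1}")
        case True
        then have "Mp p g r = mean_powr p h r"
          unfolding Mp_def mean_powr_def by (subst nn_integral_circ) (auto simp: gh)
        then show ?thesis using True by (simp add: w_def mult.commute)
      qed (simp add: w_def)
    qed
    also have "\<dots> = (\<integral>\<^sup>+r. enn_powr (mean_powr p h r) (q / p) \<partial>R)"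
      unfolding R_def by (subst nn_integral_density) auto
    finally show ?thesis .
  qed
  obtain B where B: "0 \<le> B"
    "\<And>f. f \<in> borel_measurable borel \<Longrightarrow>
      (\<integral>\<^sup>+r. enn_powr (mean_powr p f r) (q / p) \<partial>R) < top \<Longrightarrow>
      (\<integral>\<^sup>+r. enn_powr (mean_powr p (project f) r) (q / p) \<partial>R)
        \<le> ennreal B * (\<integral>\<^sup>+r. enn_powr (mean_powr p f r) (q / p) \<partial>R)"
    using project_bounded[OF assms(4,5)] by blast
  show ?thesis
  proof (intro exI[of _ "B powr (1 / q)"] ballI conjI)
    fix f assume f: "f \<in> Lpq \<omega> p q"
    define f1 where "f1 = (\<lambda>z. indicator (ball 0 1) z * f z)"
    have f1m [measurable]: "f1 \<in> borel_measurable borel" using f by (simp add: Lpq_def f1_def)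
    have Nf: "Lpq_norm_q \<omega> p q f = (\<integral>\<^sup>+r. enn_powr (mean_powr p f1 r) (q / p) \<partial>R)"
      by (rule norm_eq[OF f1m]) (simp add: f1_def)
    have fin: "(\<integral>\<^sup>+r. enn_powr (mean_powr p f1 r) (q / p) \<partial>R) < top"
      using f by (simp add: Lpq_def Nf)
    have f1_int: "integrable \<mu> f1" by (rule integrable_\<mu>[OF _ assms(4,5) fin]) measurable
    \<comment> \<open>The leading \<open>pi\<close> compensates for the normalisation:
      \<open>bergman_proj\<close> carries its own \<open>1 / pi\<close>, the density of \<mu>
      contains it once more, and the remaining 2 is the denominator of the Bergman kernel.\<close>
    have kernel: "indicator (ball 0 1) \<zeta> *\<^sub>R bergman_integrand \<omega> f z \<zeta>
        = pi *\<^sub>R ((w (cmod \<zeta>) / (2 * pi)) *\<^sub>R (f1 \<zeta> * power_kernel inv_moment (z * cnj \<zeta>)))"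
      if z: "cmod z < 1" for z \<zeta>
    proof (cases "cmod \<zeta> < 1")
      case True
      have "cmod (z * cnj \<zeta>) < 1" using z True by (simp add: norm_mult) (metis mult_strict_mono' norm_ge_zero mult_1_right)
      then have "cnj (bergman_kernel \<omega> z \<zeta>) = power_kernel inv_moment (z * cnj \<zeta>) / 2"
        by (intro cnj_bergman_kernel inv_moment_series inv_moment_nonneg inv_moment)
      then show ?thesis
        using True by (simp add: bergman_integrand_def f1_def w_def scaleR_conv_of_real field_simps)
    qed (simp add: f1_def)
    have dens: "integrable lborel (\<lambda>\<zeta>. (w (cmod \<zeta>) / (2 * pi)) *\<^sub>R (f1 \<zeta> * power_kernel inv_moment (z * cnj \<zeta>)))"
      and proj: "bergman_proj \<omega> f z = project f1 z" if z: "cmod z < 1" for z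
    proof -
      have "integrable \<mu> (\<lambda>\<zeta>. f1 \<zeta> * power_kernel inv_moment (z * cnj \<zeta>))"
        by (rule project_integrable[OF _ f1_int z]) measurable
      then show i: "integrable lborel (\<lambda>\<zeta>. (w (cmod \<zeta>) / (2 * pi)) *\<^sub>R (f1 \<zeta> * power_kernel inv_moment (z * cnj \<zeta>)))"
        unfolding \<mu>_def by (subst (asm) integrable_density) (use w0 in auto)
      have "(LINT \<zeta>:ball 0 1|lborel. bergman_integrand \<omega> f z \<zeta>)
          = pi *\<^sub>R (\<integral>\<zeta>. (w (cmod \<zeta>) / (2 * pi)) *\<^sub>R (f1 \<zeta> * power_kernel inv_moment (z * cnj \<zeta>)) \<partial>lborel)"
        unfolding set_lebesgue_integral_def kernel[OF z] by (rule integral_scaleR_right)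
      also have "(\<integral>\<zeta>. (w (cmod \<zeta>) / (2 * pi)) *\<^sub>R (f1 \<zeta> * power_kernel inv_moment (z * cnj \<zeta>)) \<partial>lborel) = project f1 z"
        unfolding project_def \<mu>_def by (rule integral_density[symmetric]) (use w0 in auto)
      finally show "bergman_proj \<omega> f z = project f1 z"
        unfolding bergman_proj_def by (simp add: scaleR_conv_of_real)
    qed
    show "set_integrable lborel (ball 0 1) (bergman_integrand \<omega> f z)" if "z \<in> ball 0 1" for z
    proof -
      have z: "cmod z < 1" using that by simp
      show ?thesis unfolding set_integrable_def kernel[OF z] using dens[OF z] by (intro integrable_scaleR_right)
    qed
    \<comment> \<open>Measurability of an integral in its parameter needs \<mu> to be
      \<sigma>-finite; the polar form presents it as the image of a finite product measure.\<close>
    have pm [measurable]: "project f1 \<in> borel_measurable borel"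
    proof -
      have [measurable_cong]: "sets \<mu> = sets borel" by (simp add: \<mu>_def)
      have "finite_measure \<mu>"
        unfolding \<mu>_polar
        by (rule finite_measure.finite_measure_distr[OF finite_measure_pair_measure[OF circ.finite_measure_axioms R.finite_measure_axioms]]) measurable
      then interpret \<mu>: finite_measure \<mu> .
      show ?thesis unfolding project_def by measurable
    qed
    have Np: "Lpq_norm_q \<omega> p q (bergman_proj \<omega> f) = (\<integral>\<^sup>+r. enn_powr (mean_powr p (project f1) r) (q / p) \<partial>R)"
      by (rule norm_eq[OF pm]) (simp add: proj)
    have le: "Lpq_norm_q \<omega> p q (bergman_proj \<omega> f) \<le> ennreal B * Lpq_norm_q \<omega> p q f"
      unfolding Np Nf by (rule B(2)[OF _ fin]) measurable
    have fin': "Lpq_norm_q \<omega> p q f < top" using f by (simp add: Lpq_def)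
    have finp: "Lpq_norm_q \<omega> p q (bergman_proj \<omega> f) < top"
      by (rule le_less_trans[OF le]) (use fin' in \<open>simp add: ennreal_mult_less_top\<close>)
    show "bergman_proj \<omega> f \<in> Lpq \<omega> p q"
    proof -
      have "(\<lambda>z. indicator (ball 0 1) z * bergman_proj \<omega> f z) = (\<lambda>z. indicator (ball 0 1) z * project f1 z)"
        by (auto simp: indicator_def proj)
      moreover have "(\<lambda>z. indicator (ball 0 1) z * project f1 z) \<in> borel_measurable lborel"
        by (intro borel_measurable_times borel_measurable_indicator) auto
      ultimately have "(\<lambda>z. indicator (ball 0 1) z * bergman_proj \<omega> f z) \<in> borel_measurable lborel"
        by (simp only:)
      then show ?thesis using finp by (simp add: Lpq_def)
    qed
    have "enn2real (Lpq_norm_q \<omega> p q (bergman_proj \<omega> f)) \<le> B * enn2real (Lpq_norm_q \<omega> p q f)"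
      using enn2real_mono[OF le] fin' B(1) by (simp add: ennreal_mult_less_top enn2real_mult)
    then have "enn2real (Lpq_norm_q \<omega> p q (bergman_proj \<omega> f)) powr (1 / q)
        \<le> (B * enn2real (Lpq_norm_q \<omega> p q f)) powr (1 / q)"
      using assms(5) by (intro powr_mono2) auto
    then show "Lpq_norm \<omega> p q (bergman_proj \<omega> f) \<le> B powr (1 / q) * Lpq_norm \<omega> p q f"
      using B(1) by (simp add: Lpq_norm_def powr_mult)
  qed
qed

end
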